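(* Let $G$ be a (simple) graph with $|G| \geq 6$ and $\sigma_2(G) \geq 5$ that does not have two disjoint cycles. Then $G$ is one of the following: (a) $K_5 + K_2$; (b) $K_5$ with a pendant edge, possibly subdivided; (c) $K_5$ with one edge subdivided and then a leaf added adjacent to the degree-2 vertex; (d) a graph $H$ of type (1), (2) or (3) with no multiple edge, and possibly one edge subdivided once or twice, and if $|H| = 6-i$ with $i \geq 1$ then some edge is subdivided at least $i$ times; (e) a graph $H$ of type (2) or (3) with one edge of multiplicity two, and one of its parallel parts is subdivided once or twice, and twice if $|H| = 4$.
   Context: $G$ is a finite simple graph; $|G|$ is its number of vertices and $d(x)$ the degree of $x$. $\sigma_2(G) = \infty$ if $G$ is complete, and otherwise $\sigma_2(G) := \min\{d(x)+d(y) : x \neq y,\ xy \notin E(G)\}$. "Disjoint cycles" means vertex-disjoint cycles. $A + B$ denotes the disjoint union of graphs $A$ and $B$. Subdividing an edge $t$ times means replacing it by a path with $t$ new internal vertices. $K_s$ and $K_{s,t}$ denote simple (complete, complete bipartite) graphs. $W^*_s$ denotes a wheel on $s$ vertices (a cycle on $s-1$ vertices together with a hub vertex adjacent to all vertices of the cycle) whose spokes, but not outer cycle edges, may be multiple. A multigraph $H$ is of type (1) if it is $K_5$; type (2) if it is $W^*_s$ for some $s$; type (3) if it is $K_{3,|H|-3}$ together with a multigraph (possibly edgeless) on the vertices of the (first) class of size 3. *)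

theory Defs
  imports Complex_Main "HOL-Library.Multiset" "HOL-Library.Extended_Nat"
begin

text \<open>Undirected loopless multigraphs: an edge is a two-element set of vertices, and parallel
  edges are repeated elements of the edge multiset. A simple graph is a multigraph without
  repeated edges. All notions below are invariant under isomorphism, so that ``$G$ is the graph
  \dots'' is expressed by the existence of the relevant pieces on the vertex type of \<open>G\<close>.\<close>

record 'a multigraph =
  verts :: "'a set"
  edges :: "'a set multiset"

definition multigraph :: "'a multigraph \<Rightarrow> bool" where
  "multigraph G \<longleftrightarrow> finite (verts G) \<and> (\<forall>e \<in># edges G. e \<subseteq> verts G \<and> card e = 2)"

definition simple_graph :: "'a multigraph \<Rightarrow> bool" where
  "simple_graph G \<longleftrightarrow> multigraph G \<and> (\<forall>e. count (edges G) e \<le> 1)"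

definition adjacent :: "'a multigraph \<Rightarrow> 'a \<Rightarrow> 'a \<Rightarrow> bool" where
  "adjacent G x y \<longleftrightarrow> {x, y} \<in># edges G"

definition degree :: "'a multigraph \<Rightarrow> 'a \<Rightarrow> nat" where
  "degree G x = size {#e \<in># edges G. x \<in> e#}"

definition is_complete :: "'a multigraph \<Rightarrow> bool" where
  "is_complete G \<longleftrightarrow> (\<forall>x \<in> verts G. \<forall>y \<in> verts G. x \<noteq> y \<longrightarrow> adjacent G x y)"

definition sigma2 :: "'a multigraph \<Rightarrow> enat" where
  "sigma2 G = (if is_complete G then \<infinity>
     else enat (Min {degree G x + degree G y |x y.
       x \<in> verts G \<and> y \<in> verts G \<and> x \<noteq> y \<and> \<not> adjacent G x y}))"

definition path_edges :: "'a list \<Rightarrow> 'a set multiset" where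
  "path_edges xs = mset (map2 (\<lambda>x y. {x, y}) xs (tl xs))"

definition cycle_edges :: "'a list \<Rightarrow> 'a set multiset" where
  "cycle_edges xs = path_edges (xs @ [hd xs])"

text \<open>For \<open>xs = [x, y]\<close> the multiset \<open>cycle_edges xs\<close> contains \<open>{x, y}\<close> twice, so a cycle of
  length 2 needs two parallel edges; in a simple graph every cycle has length at least 3.\<close>

definition is_cycle :: "'a multigraph \<Rightarrow> 'a list \<Rightarrow> bool" where
  "is_cycle G xs \<longleftrightarrow> length xs \<ge> 2 \<and> distinct xs \<and> set xs \<subseteq> verts G \<and> cycle_edges xs \<subseteq># edges G"

definition has_two_disjoint_cycles :: "'a multigraph \<Rightarrow> bool" where
  "has_two_disjoint_cycles G \<longleftrightarrow>
     (\<exists>xs ys. is_cycle G xs \<and> is_cycle G ys \<and> set xs \<inter> set ys = {})"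

definition complete_graph :: "nat \<Rightarrow> 'a multigraph \<Rightarrow> bool" where
  "complete_graph s K \<longleftrightarrow> finite (verts K) \<and> card (verts K) = s \<and>
     edges K = mset_set {e. e \<subseteq> verts K \<and> card e = 2}"

definition disjoint_union :: "'a multigraph \<Rightarrow> 'a multigraph \<Rightarrow> 'a multigraph \<Rightarrow> bool" where
  "disjoint_union A B G \<longleftrightarrow> verts A \<inter> verts B = {} \<and>
     G = \<lparr>verts = verts A \<union> verts B, edges = edges A + edges B\<rparr>"

text \<open>\<open>G\<close> arises from \<open>H\<close> by adding the new vertex \<open>l\<close> with single neighbour \<open>v\<close>.\<close>

definition leaf_added :: "'a multigraph \<Rightarrow> 'a \<Rightarrow> 'a \<Rightarrow> 'a multigraph \<Rightarrow> bool" where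
  "leaf_added H v l G \<longleftrightarrow> v \<in> verts H \<and> l \<notin> verts H \<and>
     G = \<lparr>verts = insert l (verts H), edges = add_mset {v, l} (edges H)\<rparr>"

text \<open>\<open>G\<close> arises from \<open>H\<close> by subdividing one edge between \<open>u\<close> and \<open>v\<close> exactly \<open>t\<close> times. Only
  one of several parallel edges is replaced, and \<open>t = 0\<close> gives \<open>G = H\<close>.\<close>

definition subdivided :: "'a multigraph \<Rightarrow> 'a \<Rightarrow> 'a \<Rightarrow> nat \<Rightarrow> 'a multigraph \<Rightarrow> bool" where
  "subdivided H u v t G \<longleftrightarrow> {u, v} \<in># edges H \<and>
     (\<exists>ws. length ws = t \<and> distinct ws \<and> set ws \<inter> verts H = {} \<and>
        G = \<lparr>verts = verts H \<union> set ws,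
             edges = edges H - {#{u, v}#} + path_edges (u # ws @ [v])\<rparr>)"

definition type1 :: "'a multigraph \<Rightarrow> bool" where
  "type1 H \<longleftrightarrow> complete_graph 5 H"

text \<open>Wheels with hub \<open>h\<close> and outer cycle \<open>xs\<close>: the edges avoiding the hub are exactly those of
  the outer cycle, each once, while spokes have arbitrary positive multiplicity.\<close>

definition type2 :: "'a multigraph \<Rightarrow> bool" where
  "type2 H \<longleftrightarrow> multigraph H \<and>
     (\<exists>h xs. length xs \<ge> 3 \<and> distinct xs \<and> h \<notin> set xs \<and> verts H = insert h (set xs) \<and>
        {#e \<in># edges H. h \<notin> e#} = cycle_edges xs \<and>
        (\<forall>x \<in> set xs. {h, x} \<in># edges H))"

text \<open>\<open>A\<close> is the first class; edges inside \<open>A\<close> are arbitrary, all others form a simple complete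
  bipartite graph between \<open>A\<close> and the remaining vertices.\<close>

definition type3 :: "'a multigraph \<Rightarrow> bool" where
  "type3 H \<longleftrightarrow> multigraph H \<and>
     (\<exists>A \<subseteq> verts H. card A = 3 \<and>
        {#e \<in># edges H. \<not> e \<subseteq> A#} = mset_set {{a, b} |a b. a \<in> A \<and> b \<in> verts H - A})"

definition one_double_edge :: "'a multigraph \<Rightarrow> 'a \<Rightarrow> 'a \<Rightarrow> bool" where
  "one_double_edge H u v \<longleftrightarrow> count (edges H) {u, v} = 2 \<and>
     (\<forall>e. e \<noteq> {u, v} \<longrightarrow> count (edges H) e \<le> 1)"

end

theory Submission
  imports Defs
begin

text \<open>
  The heart of the matter is a classification of finite graphs of minimum degree at least three
  without two disjoint cycles (a case of a theorem of Lovasz): such a simple graph is a \<open>K\<^sub>5\<close>, a wheel,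
  or a \<open>K\<^sub>3\<^sub>,\<^sub>m\<close> with further edges inside the class of size three (\<open>lovasz_min_degree_3\<close>).
  All arguments are local, so simple graphs are handled as symmetric irreflexive relations
  restricted to finite vertex sets, and a cycle is replaced by a \<^emph>\<open>core\<close>: a nonempty finite set
  inducing minimum degree at least two. A set contains a core exactly if it contains a cycle, and
  cores are far easier to transport along subdivisions than lists of vertices.

  Choose a short cycle \<open>T\<close>; what remains, \<open>F\<close>, is a forest, because a cycle in \<open>F\<close> would be
  disjoint from \<open>T\<close>. A forest has few edges, so the degree condition forces many edges between every
  part of \<open>F\<close> and \<open>T\<close>. Two components of \<open>F\<close> would each form a cycle with its own part of \<open>T\<close>,
  hence \<open>F\<close> is a tree. A tree either is a star, which leads to \<open>K\<^sub>3\<^sub>,\<^sub>m\<close> and a few small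
  graphs, or has an edge \<open>xy\<close> whose removal leaves two sides with at least two vertices each
  (\<open>star_or_bridge\<close>). In the second case, if one side forms a cycle with a single vertex \<open>a\<close> of \<open>T\<close>,
  then the other side has at most one edge to the rest of \<open>T\<close>, so it is completely joined to \<open>a\<close>;
  by symmetry everything is joined to \<open>a\<close>, and an edge count shows that the rest is one cycle: a wheel
  with hub \<open>a\<close> (\<open>hub_of_bridge\<close>). This scheme applies when \<open>T\<close> is a triangle (\<open>triangle_structure\<close>) and,
  for multigraphs with one double edge, when \<open>T\<close> consists of the two ends of that edge
  (\<open>digon_structure\<close>). In a triangle-free graph a shortest cycle has length four (\<open>girth_le_4\<close>), and
  similar counts show that deleting it leaves a star (\<open>square_structure\<close>).

  For the theorem itself, the condition on degree sums makes the vertices of degree at most two a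
  clique. A vertex of degree zero or one forces degree at least four almost everywhere else, which among
  the three types only \<open>K\<^sub>5\<close> allows. If the smallest degree is two, then the one or two
  vertices of degree two are the interior of a path between distinct vertices \<open>x\<close> and \<open>y\<close>, and suppressing them
  leaves a graph of minimum degree three with the new edge \<open>xy\<close>: a simple graph if \<open>x\<close> and \<open>y\<close> were not
  adjacent (\<open>suppress\<close> shows that it has no two disjoint cycles), and a graph with exactly one double
  edge otherwise.
\<close>

section \<open>Cores: sets inducing minimum degree two\<close>

locale rel_graph =
  fixes adj :: "'a \<Rightarrow> 'a \<Rightarrow> bool"
  assumes sym: "adj x y \<Longrightarrow> adj y x"
    and irrefl [simp]: "\<not> adj x x"
begin

lemma adj_commute: "adj x y \<longleftrightarrow> adj y x"
  using sym by blast

definition nb :: "'a set \<Rightarrow> 'a \<Rightarrow> 'a set" where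
  "nb S v = {y \<in> S. adj v y}"

definition dg :: "'a set \<Rightarrow> 'a \<Rightarrow> nat" where
  "dg S v = card (nb S v)"

text \<open>A core plays the role of a cycle. By \<open>core_cycle_list\<close> and \<open>cycle_list_core\<close> below, a finite set
  contains a core iff it contains the vertex set of a cycle.\<close>
definition core :: "'a set \<Rightarrow> bool" where
  "core S \<longleftrightarrow> finite S \<and> S \<noteq> {} \<and> (\<forall>v \<in> S. 2 \<le> dg S v)"

definition cyclic :: "'a set \<Rightarrow> bool" where
  "cyclic S \<longleftrightarrow> (\<exists>T \<subseteq> S. core T)"

definition two_cores :: "'a set \<Rightarrow> bool" where
  "two_cores V \<longleftrightarrow> (\<exists>S T. S \<subseteq> V \<and> T \<subseteq> V \<and> S \<inter> T = {} \<and> core S \<and> core T)"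

text \<open>Connectedness is phrased by edge cuts because crossing edges are all that is ever needed of it.\<close>
definition conn :: "'a set \<Rightarrow> bool" where
  "conn S \<longleftrightarrow> (\<forall>X \<subseteq> S. X \<noteq> {} \<longrightarrow> X \<noteq> S \<longrightarrow> (\<exists>x \<in> X. \<exists>y \<in> S - X. adj x y))"

lemma finite_nb [simp]: "finite S \<Longrightarrow> finite (nb S v)"
  by (simp add: nb_def)

lemma nb_subset: "nb S v \<subseteq> S"
  by (auto simp: nb_def)

lemma dg_mono: "finite T \<Longrightarrow> S \<subseteq> T \<Longrightarrow> dg S v \<le> dg T v"
  unfolding dg_def by (intro card_mono) (auto simp: nb_def)

lemma dg_le_card: "finite S \<Longrightarrow> dg S v \<le> card S"
  unfolding dg_def by (intro card_mono nb_subset)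

lemma dg_less_card: "finite S \<Longrightarrow> v \<in> S \<Longrightarrow> dg S v < card S"
proof -
  assume "finite S" "v \<in> S"
  moreover from this have "nb S v \<subset> S" using irrefl[of v] unfolding nb_def by blast
  ultimately show ?thesis unfolding dg_def by (intro psubset_card_mono)
qed

lemma dg_Un: "finite S \<Longrightarrow> finite T \<Longrightarrow> S \<inter> T = {} \<Longrightarrow> dg (S \<union> T) v = dg S v + dg T v"
  unfolding dg_def nb_def by (subst card_Un_disjoint[symmetric]) (auto intro: arg_cong[where f = card])

lemma dg_insert: "finite S \<Longrightarrow> a \<notin> S \<Longrightarrow> dg (insert a S) v = (if adj v a then Suc (dg S v) else dg S v)"
proof -
  assume "finite S" "a \<notin> S"
  moreover have "nb (insert a S) v = (if adj v a then insert a (nb S v) else nb S v)"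
    by (auto simp: nb_def)
  ultimately show ?thesis by (auto simp: dg_def nb_def)
qed

lemma dg_empty [simp]: "dg {} v = 0"
  by (simp add: dg_def nb_def)

lemma dg_pos_iff: "finite S \<Longrightarrow> 0 < dg S v \<longleftrightarrow> (\<exists>y \<in> S. adj v y)"
  unfolding dg_def by (auto simp: card_gt_0_iff nb_def)

lemma dg_ge2I: "finite S \<Longrightarrow> y \<in> S \<Longrightarrow> z \<in> S \<Longrightarrow> y \<noteq> z \<Longrightarrow> adj v y \<Longrightarrow> adj v z \<Longrightarrow> 2 \<le> dg S v"
proof -
  assume "finite S" "y \<in> S" "z \<in> S" "y \<noteq> z" "adj v y" "adj v z"
  then have "card {y, z} \<le> dg S v" unfolding dg_def by (intro card_mono) (auto simp: nb_def)
  then show ?thesis using \<open>y \<noteq> z\<close> by simp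
qed

lemma dg_ge2E:
  assumes "2 \<le> dg S v"
  obtains y z where "y \<in> S" "z \<in> S" "y \<noteq> z" "adj v y" "adj v z"
proof -
  from assms obtain B where B: "B \<subseteq> nb S v" "card B = 2"
    unfolding dg_def by (meson obtain_subset_with_card_n)
  then obtain y z where "B = {y, z}" "y \<noteq> z" by (auto simp: card_2_iff)
  then show ?thesis using B that by (auto simp: nb_def)
qed

lemma dg_full: "finite S \<Longrightarrow> card S \<le> dg S v \<Longrightarrow> y \<in> S \<Longrightarrow> adj v y"
proof -
  assume "finite S" "card S \<le> dg S v" "y \<in> S"
  then have "nb S v = S" unfolding dg_def by (intro card_seteq nb_subset)
  then show ?thesis using \<open>y \<in> S\<close> by (auto simp: nb_def)
qed

text \<open>Both sides count the edges between the two sets when these are disjoint.\<close>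
lemma sum_dg_swap:
  assumes "finite S" "finite T"
  shows "(\<Sum>v\<in>S. dg T v) = (\<Sum>t\<in>T. dg S t)"
proof -
  have e: "dg A v = (\<Sum>y\<in>A. if adj v y then 1 else 0)" if "finite A" for A v
    using that by (simp add: dg_def nb_def sum.If_cases Int_def)
  have "(\<Sum>v\<in>S. dg T v) = (\<Sum>v\<in>S. \<Sum>t\<in>T. if adj v t then 1 else 0)"
    by (simp add: e assms)
  also have "\<dots> = (\<Sum>t\<in>T. \<Sum>v\<in>S. if adj v t then 1 else 0)" by (rule sum.swap)
  also have "\<dots> = (\<Sum>t\<in>T. dg S t)" by (simp add: e assms adj_commute)
  finally show ?thesis .
qed

lemma core_triangle:
  assumes "adj a b" "adj b c" "adj c a"
  shows "core {a, b, c}"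
proof -
  have "a \<noteq> b" "b \<noteq> c" "c \<noteq> a" using assms by auto
  then show ?thesis
    using assms assms[THEN sym] by (auto simp: core_def dg_insert)
qed

lemma core_square:
  assumes "adj a b" "adj b c" "adj c d" "adj d a" "a \<noteq> c" "b \<noteq> d"
  shows "core {a, b, c, d}"
proof -
  have "a \<noteq> b" "b \<noteq> c" "c \<noteq> d" "d \<noteq> a" using assms by auto
  then show ?thesis
    using assms assms(1-4)[THEN sym] by (auto simp: core_def dg_insert)
qed

lemma cyclic_core: "core S \<Longrightarrow> cyclic S"
  unfolding cyclic_def by blast

lemma cyclic_mono: "cyclic S \<Longrightarrow> S \<subseteq> T \<Longrightarrow> cyclic T"
  unfolding cyclic_def by blast

lemma two_coresI:
  assumes "cyclic S" "cyclic T" "S \<subseteq> V" "T \<subseteq> V" "S \<inter> T = {}"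
  shows "two_cores V"
proof -
  obtain A B where "A \<subseteq> S" "core A" "B \<subseteq> T" "core B" using assms unfolding cyclic_def by blast
  moreover from this have "A \<subseteq> V" "B \<subseteq> V" "A \<inter> B = {}" using assms(3-5) by auto
  ultimately show ?thesis unfolding two_cores_def by metis
qed

lemma two_cores_mono: "two_cores S \<Longrightarrow> S \<subseteq> T \<Longrightarrow> two_cores T"
  unfolding two_cores_def by (meson order.trans)

lemma acyclic_low_vertex:
  assumes "finite S" "S \<noteq> {}" "\<not> cyclic S"
  obtains v where "v \<in> S" "dg S v \<le> 1"
proof -
  have "\<not> core S" using assms(3) cyclic_core by blast
  then have "\<exists>v\<in>S. \<not> 2 \<le> dg S v" using assms(1,2) unfolding core_def by blast
  then show ?thesis using that by fastforce
qed

section \<open>Connected sets and forests\<close>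

text \<open>Every edge of a forest is a bridge. A forest has a vertex \<open>l\<close> of degree at most one; if \<open>l\<close> is
  an end of the edge then \<open>l\<close> itself is one side of the cut, and otherwise \<open>l\<close> is deleted and
  later put on the side of its only neighbour.\<close>
lemma bridge_ex:
  assumes "finite S" "\<not> cyclic S" "x \<in> S" "y \<in> S" "adj x y"
  shows "\<exists>X \<subseteq> S. x \<in> X \<and> y \<notin> X \<and> (\<forall>u \<in> X. \<forall>w \<in> S - X. adj u w \<longrightarrow> u = x \<and> w = y)"
  using assms
proof (induction S rule: finite_psubset_induct)
  case (psubset S)
  obtain l where l: "l \<in> S" "dg S l \<le> 1"
    using acyclic_low_vertex psubset by (metis empty_iff)
  have uniq: "p = q" if "p \<in> S" "q \<in> S" "adj l p" "adj l q" for p q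
    using dg_ge2I[of S p q l] that l psubset.hyps by fastforce
  consider "l = x" | "l = y" | "l \<noteq> x" "l \<noteq> y" by blast
  then show ?case
  proof cases
    case 1
    then show ?thesis using uniq psubset.prems by (intro exI[of _ "{x}"]) (auto)
  next
    case 2
    then show ?thesis using uniq psubset.prems sym by (intro exI[of _ "S - {y}"]) (auto)
  next
    case 3
    have "\<not> cyclic (S - {l})" using psubset.prems cyclic_mono by blast
    then obtain X where X: "X \<subseteq> S - {l}" "x \<in> X" "y \<notin> X"
      "\<forall>u \<in> X. \<forall>w \<in> S - {l} - X. adj u w \<longrightarrow> u = x \<and> w = y"
      using psubset.IH[of "S - {l}"] psubset.prems l 3 by blast
    show ?thesis
    proof (cases "\<exists>p \<in> X. adj l p")
      case True
      then show ?thesis using X uniq l 3 sym by (intro exI[of _ "insert l X"]) blast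
    next
      case False
      then show ?thesis using X uniq l 3 sym by (intro exI[of _ X]) blast
    qed
  qed
qed

text \<open>In a forest the first edge \<open>st\<close> would be a bridge. Connectedness puts all of \<open>S\<close> on one side and
  all of \<open>T\<close> on the other, so the second edge would cross the same cut.\<close>
lemma cyclic_two_edges:
  assumes fin: "finite S" "finite T" and c: "conn S" "conn T" and d: "S \<inter> T = {}"
    and e: "s \<in> S" "t \<in> T" "adj s t" "s' \<in> S" "t' \<in> T" "adj s' t'" "(s, t) \<noteq> (s', t')"
  shows "cyclic (S \<union> T)"
proof (rule ccontr)
  assume "\<not> cyclic (S \<union> T)"
  then obtain X where X: "X \<subseteq> S \<union> T" "s \<in> X" "t \<notin> X"
    "\<forall>u \<in> X. \<forall>w \<in> S \<union> T - X. adj u w \<longrightarrow> u = s \<and> w = t"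
    using bridge_ex[of "S \<union> T" s t] assms by blast
  have "S \<inter> X = S"
  proof (rule ccontr)
    assume "S \<inter> X \<noteq> S"
    then obtain a b where "a \<in> S \<inter> X" "b \<in> S - S \<inter> X" "adj a b"
      using c(1) X e unfolding conn_def by (metis IntI Int_lower1 empty_iff)
    then show False using X e d by blast
  qed
  moreover have "T - X = T"
  proof (rule ccontr)
    assume "T - X \<noteq> T"
    then obtain a b where "a \<in> T - X" "b \<in> T - (T - X)" "adj a b"
      using c(2) X e unfolding conn_def by (metis Diff_iff Diff_subset empty_iff)
    then show False using X e d sym by blast
  qed
  ultimately show False using X e by blast
qed

lemma cyclic_edge_count:
  assumes fin: "finite S" "finite T" and c: "conn S" "conn T" and d: "S \<inter> T = {}"
    and e: "2 \<le> (\<Sum>v\<in>S. dg T v)"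
  shows "cyclic (S \<union> T)"
proof -
  have "card (SIGMA s:S. nb T s) = (\<Sum>v\<in>S. dg T v)"
    using fin by (simp add: dg_def card_SigmaI)
  then obtain B where B: "B \<subseteq> (SIGMA s:S. nb T s)" "card B = 2"
    using e by (metis obtain_subset_with_card_n)
  then obtain p q where "B = {p, q}" "p \<noteq> q" by (auto simp: card_2_iff)
  then show ?thesis
    using B cyclic_two_edges[OF fin c d, of "fst p" "snd p" "fst q" "snd q"] by (auto simp: nb_def)
qed

lemma conn_singleton [simp]: "conn {a}"
  unfolding conn_def by blast

lemma conn_pair: "adj a b \<Longrightarrow> conn {a, b}"
  unfolding conn_def
proof (intro allI impI)
  fix X assume ab: "adj a b" and X: "X \<subseteq> {a, b}" "X \<noteq> {}" "X \<noteq> {a, b}"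
  then have "X = {a} \<or> X = {b}" by auto
  moreover have "a \<noteq> b" using ab by auto
  ultimately show "\<exists>x\<in>X. \<exists>y\<in>{a, b} - X. adj x y" using ab sym by auto
qed

lemma cyclic_apex:
  assumes "finite S" "conn S" "a \<notin> S" "2 \<le> dg S a"
  shows "cyclic (insert a S)"
  using cyclic_edge_count[of "{a}" S] assms by auto

text \<open>A forest on \<open>n\<close> vertices has at most \<open>n - 1\<close> edges, stated as a degree sum.\<close>
lemma forest_sum:
  assumes "finite S" "S \<noteq> {}" "\<not> cyclic S"
  shows "(\<Sum>v\<in>S. dg S v) + 2 \<le> 2 * card S"
  using assms
proof (induction S rule: finite_psubset_induct)
  case (psubset S)
  obtain l where l: "l \<in> S" "dg S l \<le> 1"
    using acyclic_low_vertex psubset by metis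
  define R where "R = S - {l}"
  have S: "S = insert l R" "l \<notin> R" "finite R" using l psubset by (auto simp: R_def)
  show ?case
  proof (cases "R = {}")
    case True
    then show ?thesis using S by (simp add: dg_insert)
  next
    case False
    have "\<not> cyclic R" using psubset.prems cyclic_mono S by blast
    then have IH: "(\<Sum>v\<in>R. dg R v) + 2 \<le> 2 * card R"
      using psubset.IH[of R] False S by blast
    have "(\<Sum>v\<in>S. dg S v) = dg S l + (\<Sum>v\<in>R. dg S v)" using S by simp
    also have "(\<Sum>v\<in>R. dg S v) = (\<Sum>v\<in>R. dg R v) + (\<Sum>v\<in>R. dg {l} v)"
      using S by (simp add: sum.distrib[symmetric] dg_Un[of R "{l}", simplified])
    also have "(\<Sum>v\<in>R. dg {l} v) = dg R l" using sum_dg_swap[of R "{l}"] S by simp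
    also have "dg R l \<le> dg S l" using S by (intro dg_mono) auto
    finally show ?thesis using IH l S by simp
  qed
qed

text \<open>The source of all edge counts below: vertices of a forest \<open>C\<close> have average degree less than two
  in \<open>C\<close>, so if each has degree at least three then more than \<open>card C\<close> edges leave \<open>C\<close>.
  The outside is given in two parts \<open>Y\<close> and \<open>P\<close>: for a component of the forest \<open>Y\<close> is empty, and for
  one side of a bridge \<open>Y\<close> is the other side.\<close>
lemma forest_boundary_count:
  assumes "finite C" "C \<noteq> {}" "\<not> cyclic C"
    and "\<And>v. v \<in> C \<Longrightarrow> 3 \<le> dg C v + dg Y v + dg P v"
  shows "card C + 2 \<le> (\<Sum>v\<in>C. dg Y v) + (\<Sum>v\<in>C. dg P v)"
proof -
  have "3 * card C \<le> (\<Sum>v\<in>C. dg C v + dg Y v + dg P v)"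
    using sum_mono[of C "\<lambda>_. 3" "\<lambda>v. dg C v + dg Y v + dg P v"] assms(4) by simp
  then show ?thesis using forest_sum[OF assms(1-3)] by (simp add: sum.distrib)
qed

text \<open>The component of \<open>v\<close> is obtained as a smallest set containing \<open>v\<close> that no edge of \<open>F\<close> leaves; a cut
  of it without edges would give a smaller one.\<close>
lemma component_ex:
  assumes "finite F" "v \<in> F"
  shows "\<exists>C \<subseteq> F. v \<in> C \<and> conn C \<and> (\<forall>x \<in> C. \<forall>y \<in> F - C. \<not> adj x y)"
proof -
  let ?P = "\<lambda>C. C \<subseteq> F \<and> v \<in> C \<and> (\<forall>x \<in> C. \<forall>y \<in> F - C. \<not> adj x y)"
  have "?P F" using assms by auto
  then have "\<exists>C. ?P C \<and> (\<forall>D. ?P D \<longrightarrow> card C \<le> card D)" by (rule ex_has_least_nat)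
  then obtain C where C: "?P C" "\<And>D. ?P D \<Longrightarrow> card C \<le> card D" by (elim exE conjE) metis
  have finC: "finite C" using C(1) assms finite_subset by metis
  have "conn C" unfolding conn_def
  proof (intro allI impI)
    fix X assume X: "X \<subseteq> C" "X \<noteq> {}" "X \<noteq> C"
    show "\<exists>x\<in>X. \<exists>y\<in>C - X. adj x y"
    proof (rule ccontr)
      assume n: "\<not> (\<exists>x\<in>X. \<exists>y\<in>C - X. adj x y)"
      show False
      proof (cases "v \<in> X")
        case True
        have "X \<subseteq> F" using X(1) C(1) by (meson order.trans)
        moreover have "\<not> adj x y" if "x \<in> X" "y \<in> F - X" for x y
          using n that C(1) X(1)[THEN subsetD] by (cases "y \<in> C") auto
        ultimately have "?P X" using True by blast
        then have "card C \<le> card X" by (rule C(2))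
        moreover have "card X < card C" using psubset_card_mono[OF finC, of X] X by blast
        ultimately show False by simp
      next
        case False
        have "C - X \<subseteq> F" using C(1) by auto
        moreover have "\<not> adj x y" if "x \<in> C - X" "y \<in> F - (C - X)" for x y
          using n that C(1) sym[of x y] by (cases "y \<in> C") auto
        ultimately have "?P (C - X)" using False C(1) by blast
        then have "card C \<le> card (C - X)" by (rule C(2))
        moreover have "card (C - X) < card C" using psubset_card_mono[OF finC, of "C - X"] X by blast
        ultimately show False by simp
      qed
    qed
  qed
  then show ?thesis using C by blast
qed

definition bridge_split :: "'a set \<Rightarrow> 'a set \<Rightarrow> 'a set \<Rightarrow> 'a \<Rightarrow> 'a \<Rightarrow> bool" where
  "bridge_split F X Y x y \<longleftrightarrow> F = X \<union> Y \<and> X \<inter> Y = {} \<and> conn X \<and> conn Y \<and>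
     x \<in> X \<and> y \<in> Y \<and> adj x y \<and> (\<forall>u \<in> X. \<forall>w \<in> Y. adj u w \<longrightarrow> u = x \<and> w = y)"

lemma bridge_split_commute: "bridge_split F X Y x y \<Longrightarrow> bridge_split F Y X y x"
  unfolding bridge_split_def using sym by blast

text \<open>For a part \<open>W\<close> of \<open>X\<close> that avoids \<open>x\<close>, an edge leaving \<open>W\<close> in \<open>F\<close> cannot be the bridge,
  so it stays in \<open>X\<close>. A part that contains \<open>x\<close> is replaced by its complement in \<open>X\<close>.\<close>
lemma bridge_side_conn:
  assumes "conn F" "X \<subseteq> F" "\<forall>u \<in> X. \<forall>w \<in> F - X. adj u w \<longrightarrow> u = x \<and> w = y"
  shows "conn X"
  unfolding conn_def
proof (intro allI impI)
  fix Z assume Z: "Z \<subseteq> X" "Z \<noteq> {}" "Z \<noteq> X"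
  have *: "\<exists>a\<in>W. \<exists>b\<in>X - W. adj a b" if W: "W \<subseteq> X" "W \<noteq> {}" "W \<noteq> X" "x \<notin> W" for W
  proof -
    obtain a b where "a \<in> W" "b \<in> F - W" "adj a b"
      using assms W unfolding conn_def by (metis order.trans subset_antisym)
    then show ?thesis using assms W by blast
  qed
  show "\<exists>a\<in>Z. \<exists>b\<in>X - Z. adj a b"
  proof (cases "x \<in> Z")
    case True
    then have "\<exists>a\<in>X - Z. \<exists>b\<in>X - (X - Z). adj a b" using *[of "X - Z"] Z by blast
    then show ?thesis using sym by blast
  next
    case False
    then show ?thesis using * Z by blast
  qed
qed

lemma bridge_split_ex:
  assumes "finite F" "\<not> cyclic F" "conn F" "x \<in> F" "y \<in> F" "adj x y"
  obtains X Y where "bridge_split F X Y x y"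
proof -
  obtain X where X: "X \<subseteq> F" "x \<in> X" "y \<notin> X"
    "\<forall>u \<in> X. \<forall>w \<in> F - X. adj u w \<longrightarrow> u = x \<and> w = y"
    using bridge_ex[OF assms(1,2,4-6)] by blast
  have "conn X" using bridge_side_conn[OF assms(3) X(1,4)] .
  moreover
  have "\<forall>u \<in> F - X. \<forall>w \<in> F - (F - X). adj u w \<longrightarrow> u = y \<and> w = x"
    using X(4) sym by auto
  then have "conn (F - X)" using bridge_side_conn[OF assms(3), of "F - X" y x] by simp
  moreover have "F = X \<union> (F - X)" "X \<inter> (F - X) = {}" "y \<in> F - X"
    using X(1,3) assms(5) by auto
  ultimately have "bridge_split F X (F - X) x y"
    unfolding bridge_split_def using X(2,4) assms(6) by (intro conjI)
  then show ?thesis by (rule that)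
qed

text \<open>If every edge cuts off a single vertex, then all neighbours of a vertex \<open>z\<close> of degree at least two
  are leaves, so that \<open>z\<close> and its neighbours are all of \<open>F\<close>. If there is no such \<open>z\<close>, then \<open>F\<close> has at
  most two vertices. The trees with one or two vertices count as stars.\<close>
lemma star_or_bridge:
  assumes "finite F" "\<not> cyclic F" "conn F" "F \<noteq> {}"
  shows "(\<exists>z \<in> F. \<forall>l \<in> F - {z}. nb F l = {z}) \<or>
    (\<exists>X Y x y. bridge_split F X Y x y \<and> 2 \<le> card X \<and> 2 \<le> card Y)"
proof (rule disjCI)
  assume nb: "\<not> (\<exists>X Y x y. bridge_split F X Y x y \<and> 2 \<le> card X \<and> 2 \<le> card Y)"
  have leaf: "nb F y = {x}" if xy: "x \<in> F" "y \<in> F" "adj x y" "2 \<le> dg F x" for x y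
  proof -
    obtain X Y where XY: "bridge_split F X Y x y"
      using bridge_split_ex[OF assms(1-3)] xy by blast
    have f: "finite X" "finite Y" using XY assms(1) by (auto simp: bridge_split_def)
    have "2 \<le> card X"
    proof (rule ccontr)
      assume "\<not> 2 \<le> card X"
      then have "card X \<le> Suc 0" by simp
      then have "X = {x}" using f XY by (auto simp: card_le_Suc0_iff_eq bridge_split_def)
      then have "nb F x \<subseteq> {y}" using XY by (auto simp: bridge_split_def nb_def)
      then show False using xy(4) card_mono[of "{y}" "nb F x"] by (simp add: dg_def)
    qed
    then have "card Y \<le> Suc 0" using nb XY by force
    then have "Y = {y}" using f XY by (auto simp: card_le_Suc0_iff_eq bridge_split_def)
    then show ?thesis using XY xy sym by (auto simp: bridge_split_def nb_def)
  qed
  show "\<exists>z \<in> F. \<forall>l \<in> F - {z}. nb F l = {z}"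
  proof (cases "\<exists>z \<in> F. 2 \<le> dg F z")
    case True
    then obtain z where z: "z \<in> F" "2 \<le> dg F z" by blast
    have "insert z (nb F z) = F"
    proof (rule ccontr)
      assume "insert z (nb F z) \<noteq> F"
      then obtain a b where "a \<in> insert z (nb F z)" "b \<in> F - insert z (nb F z)" "adj a b"
        using assms(3) z unfolding conn_def by (metis insert_not_empty insert_subset nb_subset)
      then show False using leaf[OF z(1) _ _ z(2), of a] by (auto simp: nb_def)
    qed
    then show ?thesis using leaf z by (intro bexI[of _ z]) (auto simp: nb_def)
  next
    case False
    obtain z where z: "z \<in> F" using assms by blast
    show ?thesis
    proof (cases "F = {z}")
      case True
      then show ?thesis by auto
    next
      case F: False
      then obtain b where b: "b \<in> F" "adj z b"
        using assms(3) z unfolding conn_def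
        by (metis DiffD1 empty_subsetI insert_not_empty insert_subset singletonD)
      have uniq: "p = q" if "r \<in> F" "p \<in> F" "q \<in> F" "adj r p" "adj r q" for p q r
        using False dg_ge2I[OF assms(1), of p q r] that by blast
      have "{z, b} = F"
      proof (rule ccontr)
        assume "{z, b} \<noteq> F"
        then obtain c d where "c \<in> {z, b}" "d \<in> F - {z, b}" "adj c d"
          using assms(3) z b unfolding conn_def by (metis empty_subsetI insert_not_empty insert_subset)
        then show False using uniq b z sym by blast
      qed
      then show ?thesis using b sym by (intro bexI[of _ z]) (auto simp: nb_def)
    qed
  qed
qed

text \<open>The form in which disconnectedness is used: two components, the first of which contains a
  prescribed vertex.\<close>
lemma component_pair:
  assumes "finite F" "v \<in> F"
  shows "conn F \<or> (\<exists>C D. C \<subseteq> F \<and> D \<subseteq> F \<and> C \<inter> D = {} \<and> v \<in> C \<and> D \<noteq> {} \<and> conn C \<and> conn D \<and>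
    (\<forall>x \<in> C. \<forall>y \<in> F - C. \<not> adj x y) \<and> (\<forall>x \<in> D. \<forall>y \<in> F - D. \<not> adj x y))"
proof -
  obtain C where C: "C \<subseteq> F" "v \<in> C" "conn C" "\<forall>x \<in> C. \<forall>y \<in> F - C. \<not> adj x y"
    using component_ex[OF assms] by (elim exE conjE)
  show ?thesis
  proof (cases "C = F")
    case True
    then show ?thesis using C(3) by simp
  next
    case False
    then obtain w where w: "w \<in> F - C" using C(1) by auto
    obtain D where D: "D \<subseteq> F - C" "w \<in> D" "conn D" "\<forall>x \<in> D. \<forall>y \<in> F - C - D. \<not> adj x y"
      using component_ex[of "F - C" w] assms(1) w by auto
    have "\<not> adj x y" if "x \<in> D" "y \<in> F - D" for x y
    proof (cases "y \<in> C")
      case True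
      moreover have "x \<in> F - C" using D(1) that by auto
      ultimately show ?thesis using C(4) sym[of x y] by auto
    next
      case False
      then show ?thesis using D(4) that by auto
    qed
    moreover have "D \<subseteq> F" "C \<inter> D = {}" "D \<noteq> {}" using D(1,2) by auto
    ultimately show ?thesis using C D(3) by metis
  qed
qed

lemma closed_dg:
  assumes "finite F" "C \<subseteq> F" "\<forall>x \<in> C. \<forall>y \<in> F - C. \<not> adj x y" "v \<in> C"
  shows "dg F v = dg C v"
proof -
  have "nb F v = nb C v" using assms by (auto simp: nb_def)
  then show ?thesis by (simp add: dg_def)
qed

section \<open>Cycles as lists, and wheels\<close>
definition cycle_list :: "'a list \<Rightarrow> bool" where
  "cycle_list xs \<longleftrightarrow> 3 \<le> length xs \<and> distinct xs \<and> successively adj xs \<and> adj (last xs) (hd xs)"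

lemma cycle_list_rotate: "cycle_list (as @ bs) \<Longrightarrow> cycle_list (bs @ as)"
  by (cases "as = []"; cases "bs = []") (auto simp: cycle_list_def successively_append_iff)

lemma cycle_list_neighbours:
  assumes "cycle_list (x # ys)"
  shows "adj x (hd ys)" "adj x (last ys)" "hd ys \<in> set ys" "last ys \<in> set ys" "hd ys \<noteq> last ys"
proof -
  obtain y z zs where "ys = y # z # zs"
    using assms by (cases ys rule: list.exhaust[case_product list.exhaust, of _ "tl ys"])
      (auto simp: cycle_list_def neq_Nil_conv)
  then show "adj x (hd ys)" "adj x (last ys)" "hd ys \<in> set ys" "last ys \<in> set ys" "hd ys \<noteq> last ys"
    using assms sym by (auto simp: cycle_list_def)
qed

lemma cycle_list_rotate_to:
  assumes "cycle_list xs" "v \<in> set xs"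
  obtains ys where "cycle_list (v # ys)" "set (v # ys) = set xs" "length (v # ys) = length xs"
proof -
  obtain as bs where "xs = as @ v # bs" using assms by (meson split_list)
  then show ?thesis using cycle_list_rotate[of as "v # bs"] assms by (intro that[of "bs @ as"]) auto
qed

lemma cycle_list_core:
  assumes "cycle_list xs"
  shows "core (set xs)"
  unfolding core_def
proof (intro conjI ballI)
  show "set xs \<noteq> {}" using assms by (auto simp: cycle_list_def)
  fix v assume "v \<in> set xs"
  then obtain ys where ys: "cycle_list (v # ys)" "set (v # ys) = set xs"
    using cycle_list_rotate_to assms by metis
  show "2 \<le> dg (set xs) v"
    using cycle_list_neighbours[OF ys(1)] ys(2) by (intro dg_ge2I[of _ "hd ys" "last ys"]) auto
qed simp

text \<open>The first vertex \<open>x\<close> of a longest path has all its neighbours on the path. At least one of them is not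
  the second vertex, and with it \<open>x\<close> closes a cycle of length at least three.\<close>
lemma core_cycle_list:
  assumes "core S"
  obtains xs where "cycle_list xs" "set xs \<subseteq> S"
proof -
  let ?P = "\<lambda>xs. xs \<noteq> [] \<and> distinct xs \<and> set xs \<subseteq> S \<and> successively adj xs"
  have fin: "finite S" and ne: "S \<noteq> {}" and two: "\<And>v. v \<in> S \<Longrightarrow> 2 \<le> dg S v"
    using assms by (auto simp: core_def)
  obtain v where "v \<in> S" using ne by auto
  then have "?P [v]" by simp
  moreover have "\<forall>xs. ?P xs \<longrightarrow> length xs < Suc (card S)"
  proof (intro allI impI)
    fix xs assume "?P xs"
    then have "length xs = card (set xs)" "card (set xs) \<le> card S"
      using card_mono[OF fin, of "set xs"] by (auto simp: distinct_card)
    then show "length xs < Suc (card S)" by simp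
  qed
  ultimately have "\<exists>xs. ?P xs \<and> (\<forall>ys. ?P ys \<longrightarrow> length ys \<le> length xs)"
    by (rule ex_has_greatest_nat)
  then obtain xs where xs: "?P xs" and max: "\<And>ys. ?P ys \<Longrightarrow> length ys \<le> length xs"
    by (elim exE conjE) metis
  obtain x ys where x: "xs = x # ys" using xs by (cases xs) auto
  have "2 \<le> dg S x" using two xs x by simp
  then obtain p q where pq: "p \<in> S" "q \<in> S" "p \<noteq> q" "adj x p" "adj x q" by (rule dg_ge2E)
  have inys: "w \<in> set ys" if "w \<in> S" "adj x w" for w
  proof (rule ccontr)
    assume "w \<notin> set ys"
    then have "?P (w # xs)" using xs x that sym by (auto simp: successively_Cons)
    then have "length (w # xs) \<le> length xs" by (rule max)
    then show False by simp
  qed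
  obtain w where w: "w \<in> set ys" "adj x w" "w \<noteq> hd ys"
    using pq inys[of p] inys[of q] by metis
  then obtain as bs where ys: "ys = as @ w # bs" by (meson split_list)
  then have "as \<noteq> []" using w by auto
  moreover have "successively adj ((x # as @ [w]) @ bs)" using xs x ys by simp
  then have "successively adj (x # as @ [w])" unfolding successively_append_iff by simp
  moreover have "distinct (x # as @ [w])" using xs x ys by auto
  ultimately have "cycle_list (x # as @ [w])"
    using sym[OF w(2)] by (cases as) (simp_all add: cycle_list_def)
  then show ?thesis using xs x ys by (intro that) auto
qed

text \<open>The degree condition says that the rim has no chords.\<close>
definition wheel_at :: "'a \<Rightarrow> 'a set \<Rightarrow> bool" where
  "wheel_at h V \<longleftrightarrow> (\<exists>xs. cycle_list xs \<and> h \<notin> set xs \<and> V = insert h (set xs) \<and>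
     (\<forall>x \<in> set xs. adj h x \<and> dg (set xs) x = 2))"

text \<open>\<open>K\<^sub>3\<^sub>,\<^sub>m\<close> with first class \<open>A\<close>, together with arbitrary edges inside \<open>A\<close>.\<close>
definition k3_at :: "'a set \<Rightarrow> 'a set \<Rightarrow> bool" where
  "k3_at A V \<longleftrightarrow> A \<subseteq> V \<and> card A = 3 \<and> (\<forall>a \<in> A. \<forall>b \<in> V - A. adj a b) \<and>
     (\<forall>b \<in> V - A. \<forall>b' \<in> V - A. \<not> adj b b')"

text \<open>The bounds on the degrees force \<open>R\<close> to be 2-regular. A cycle in \<open>R\<close> is then joined to nothing
  else in \<open>R\<close>, so the remaining vertices would contain a second, disjoint cycle.\<close>
lemma wheel_criterion:
  assumes fin: "finite R" and ne: "R \<noteq> {}" and a: "a \<notin> R" "\<And>v. v \<in> R \<Longrightarrow> adj a v"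
    and two: "\<And>v. v \<in> R \<Longrightarrow> 2 \<le> dg R v" and sum: "(\<Sum>v\<in>R. dg R v) \<le> 2 * card R"
    and nt: "\<not> two_cores R"
  shows "wheel_at a (insert a R)"
proof -
  have eq2: "dg R v = 2" if "v \<in> R" for v
  proof (rule ccontr)
    assume "dg R v \<noteq> 2"
    then have "(\<Sum>v\<in>R. 2) < (\<Sum>v\<in>R. dg R v)"
      using fin that two by (intro sum_strict_mono_ex1) (auto intro!: bexI[of _ v] simp: le_less)
    then show False using sum by simp
  qed
  have "core R" using fin ne two by (auto simp: core_def)
  then obtain xs where xs: "cycle_list xs" "set xs \<subseteq> R" by (rule core_cycle_list)
  have "R - set xs = {}"
  proof (rule ccontr)
    assume M: "R - set xs \<noteq> {}"
    have "2 \<le> dg (R - set xs) v" if v: "v \<in> R - set xs" for v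
    proof -
      have "dg (set xs) v = 0"
      proof (rule ccontr)
        assume "dg (set xs) v \<noteq> 0"
        then obtain u where u: "u \<in> set xs" "adj v u" using dg_pos_iff[of "set xs" v] by auto
        have "2 \<le> dg (set xs) u" using cycle_list_core[OF xs(1)] u by (simp add: core_def)
        then have "3 \<le> dg (insert v (set xs)) u" using v u sym by (simp add: dg_insert)
        also have "\<dots> \<le> dg R u" using fin xs v by (intro dg_mono) auto
        finally show False using eq2[of u] u xs by auto
      qed
      moreover have "dg (set xs \<union> (R - set xs)) v = dg (set xs) v + dg (R - set xs) v"
        using fin by (intro dg_Un) auto
      moreover have "set xs \<union> (R - set xs) = R" using xs by auto
      ultimately show ?thesis using eq2 v by simp
    qed
    then have "core (R - set xs)" using fin M by (simp add: core_def)
    then have "two_cores R"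
      using two_coresI[of "set xs" "R - set xs" R] cyclic_core cycle_list_core[OF xs(1)] xs by auto
    then show False using nt by simp
  qed
  then have "set xs = R" using xs by auto
  then show ?thesis using xs a eq2 unfolding wheel_at_def by (intro exI[of _ xs]) simp
qed

section \<open>A hub from a bridge, and graphs with a double edge\<close>
lemma bridge_side_count:
  assumes "finite F" "\<not> cyclic F" "bridge_split F X Y x y"
    and "\<And>v. v \<in> X \<Longrightarrow> 3 \<le> dg F v + dg P v"
  shows "card X + 1 \<le> (\<Sum>v\<in>X. dg P v)"
proof -
  have XY: "F = X \<union> Y" "X \<inter> Y = {}" "x \<in> X" "y \<in> Y" "adj x y"
    "\<And>u w. u \<in> X \<Longrightarrow> w \<in> Y \<Longrightarrow> adj u w \<Longrightarrow> u = x \<and> w = y"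
    using assms(3) by (auto simp: bridge_split_def)
  have fin: "finite X" "finite Y" using XY(1) assms(1) by auto
  have "nb Y v = (if v = x then {y} else {})" if "v \<in> X" for v
  proof -
    have "w \<in> nb Y v \<longleftrightarrow> v = x \<and> w = y" for w
      unfolding nb_def mem_Collect_eq using XY(4,5) XY(6)[OF that, of w] by metis
    then show ?thesis by auto
  qed
  then have "(\<Sum>v\<in>X. dg Y v) = (\<Sum>v\<in>X. if v = x then 1 else 0)"
    by (intro sum.cong) (auto simp: dg_def)
  also have "\<dots> = 1" using fin XY(3) by simp
  finally have "(\<Sum>v\<in>X. dg Y v) = 1" .
  moreover have "card X + 2 \<le> (\<Sum>v\<in>X. dg Y v) + (\<Sum>v\<in>X. dg P v)"
  proof (rule forest_boundary_count)
    show "\<not> cyclic X" using assms(2) cyclic_mono[of X F] XY(1) by auto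
    show "3 \<le> dg X v + dg Y v + dg P v" if "v \<in> X" for v
      using assms(4)[OF that] dg_Un[OF fin XY(2), of v] XY(1) by simp
  qed (use fin XY(3) in auto)
  ultimately show ?thesis by simp
qed

text \<open>The side \<open>X\<close> forms a cycle with \<open>a\<close>, so \<open>Y\<close> and \<open>Q\<close> together contain none, which leaves at most
  one edge between them. Nearly all edges counted at \<open>Y\<close> must then end in \<open>a\<close>.\<close>
lemma apex_cycle_limits_far_side:
  assumes fin: "finite X" "finite Y" "finite Q" and c: "conn X" "conn Y" "conn Q"
    and d: "X \<inter> Y = {}" "(X \<union> Y) \<inter> insert a Q = {}" "a \<notin> Q"
    and nt: "\<not> two_cores (X \<union> Y \<union> insert a Q)"
    and X: "2 \<le> dg X a" and Y: "card Y + 1 \<le> (\<Sum>v\<in>Y. dg (insert a Q) v)"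
  shows "card Y \<le> dg Y a" "(\<Sum>v\<in>Y. dg Q v) \<le> 1"
proof -
  have cy: "cyclic (insert a X)" using cyclic_apex fin c X d by auto
  show le: "(\<Sum>v\<in>Y. dg Q v) \<le> 1"
  proof (rule ccontr)
    assume "\<not> ?thesis"
    then have "cyclic (Y \<union> Q)" using fin c d by (intro cyclic_edge_count) auto
    then have "two_cores (X \<union> Y \<union> insert a Q)"
      using d by (intro two_coresI[OF cy]) auto
    then show False using nt by simp
  qed
  have "(\<Sum>v\<in>Y. dg (insert a Q) v) = (\<Sum>v\<in>Y. dg {a} v) + (\<Sum>v\<in>Y. dg Q v)"
    using fin d dg_Un[of "{a}" Q] by (simp add: sum.distrib[symmetric])
  also have "(\<Sum>v\<in>Y. dg {a} v) = dg Y a" using sum_dg_swap[of Y "{a}"] fin by simp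
  finally show "card Y \<le> dg Y a" using Y le by simp
qed

text \<open>One application of the preceding lemma makes \<open>a\<close> adjacent to all of \<open>Y\<close>. As \<open>Y\<close> has two vertices,
  it also forms a cycle with \<open>a\<close>, and the lemma applies with the sides exchanged. Now \<open>a\<close> is adjacent to
  everything and at most two edges join \<open>F\<close> to \<open>Q\<close>; with the bounds for the forests \<open>F\<close> and \<open>Q\<close> the
  rest has at most as many edges as vertices.\<close>
lemma hub_of_bridge:
  assumes fin: "finite F" "finite Q" and ac: "\<not> cyclic F" "\<not> cyclic Q" and Q: "conn Q" "Q \<noteq> {}" "a \<notin> Q"
    and d: "F \<inter> insert a Q = {}"
    and b: "bridge_split F X Y x y" and XY: "2 \<le> dg X a" "2 \<le> card Y"
    and deg: "\<And>v. v \<in> F \<union> Q \<Longrightarrow> 3 \<le> dg (F \<union> insert a Q) v"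
    and aQ: "\<And>q. q \<in> Q \<Longrightarrow> adj a q"
    and nt: "\<not> two_cores (F \<union> insert a Q)"
  shows "wheel_at a (F \<union> insert a Q)"
proof -
  have sp: "F = X \<union> Y" "X \<inter> Y = {}" "conn X" "conn Y" using b by (auto simp: bridge_split_def)
  have finXY: "finite X" "finite Y" using sp(1) fin(1) by auto
  have deg': "3 \<le> dg F v + dg (insert a Q) v" if "v \<in> F" for v
    using deg[of v] that dg_Un[of F "insert a Q" v] fin d by simp
  have cX: "card X + 1 \<le> (\<Sum>v\<in>X. dg (insert a Q) v)"
    by (rule bridge_side_count[OF fin(1) ac(1) b]) (use deg' sp(1) in auto)
  have cY: "card Y + 1 \<le> (\<Sum>v\<in>Y. dg (insert a Q) v)"
    by (rule bridge_side_count[OF fin(1) ac(1) bridge_split_commute[OF b]]) (use deg' sp(1) in auto)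
  have Y: "card Y \<le> dg Y a" "(\<Sum>v\<in>Y. dg Q v) \<le> 1"
    using apex_cycle_limits_far_side[of X Y Q a] finXY fin sp Q d nt XY cY by auto
  then have "2 \<le> dg Y a" using XY by simp
  then have X: "card X \<le> dg X a" "(\<Sum>v\<in>X. dg Q v) \<le> 1"
    using apex_cycle_limits_far_side[of Y X Q a] finXY fin sp Q d nt cX by (auto simp: Un_commute Int_commute)
  have hub: "adj a v" if "v \<in> F \<union> Q" for v
    using that aQ sp(1) dg_full[OF finXY(1) X(1)] dg_full[OF finXY(2) Y(1)] by auto
  define R where "R = F \<union> Q"
  have FQ: "finite R" "F \<inter> Q = {}" "a \<notin> R" "F \<noteq> {}" "F \<union> insert a Q = insert a R"
    using fin d Q b by (auto simp: bridge_split_def R_def)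
  have eFQ: "(\<Sum>v\<in>F. dg Q v) \<le> 2"
    using X(2) Y(2) sp finXY by (simp add: sum.union_disjoint)
  have "(\<Sum>v\<in>R. dg R v) = (\<Sum>v\<in>F. dg F v + dg Q v) + (\<Sum>v\<in>Q. dg F v + dg Q v)"
    unfolding R_def using fin FQ by (simp add: sum.union_disjoint dg_Un)
  also have "\<dots> = (\<Sum>v\<in>F. dg F v) + 2 * (\<Sum>v\<in>F. dg Q v) + (\<Sum>v\<in>Q. dg Q v)"
    using sum_dg_swap[OF fin] by (simp add: sum.distrib)
  also have "\<dots> \<le> 2 * card R"
    using forest_sum[OF fin(1) FQ(4) ac(1)] forest_sum[OF fin(2) Q(2) ac(2)] eFQ FQ(2) fin
    by (simp add: R_def card_Un_disjoint)
  finally have sum: "(\<Sum>v\<in>R. dg R v) \<le> 2 * card R" .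
  have "2 \<le> dg R v" if "v \<in> R" for v
    using deg[of v] that FQ hub[of v] by (auto simp: R_def[symmetric] dg_insert split: if_splits)
  moreover have "\<not> two_cores R" using nt FQ two_cores_mono[of R "insert a R"] by auto
  ultimately have "wheel_at a (insert a R)"
    using FQ hub sum by (intro wheel_criterion) (auto simp: R_def)
  then show ?thesis using FQ by simp
qed

text \<open>The simple part of a multigraph in which \<open>uv\<close> is a double edge: the double edge is a cycle, so the
  remaining vertices form a forest, and the ends \<open>u\<close> and \<open>v\<close> carry no degree condition here. Either the
  hub is an end of the double edge or both ends lie in the first class, so doubling \<open>uv\<close> stays within
  types (2) and (3).\<close>
lemma digon_structure:
  assumes fin: "finite V" and uv: "u \<in> V" "v \<in> V" "adj u v" and ne: "V - {u, v} \<noteq> {}"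
    and ac: "\<not> cyclic (V - {u, v})" and deg: "\<And>w. w \<in> V - {u, v} \<Longrightarrow> 3 \<le> dg V w"
    and nt: "\<not> two_cores V"
  shows "wheel_at u V \<or> wheel_at v V \<or> (\<exists>A. u \<in> A \<and> v \<in> A \<and> k3_at A V)"
proof -
  define F where "F = V - {u, v}"
  have nuv: "u \<noteq> v" using uv by auto
  have F: "finite F" "F \<noteq> {}" "\<not> cyclic F" "V = F \<union> {u, v}" "F \<inter> {u, v} = {}" "u \<notin> F" "v \<notin> F"
    using fin ne ac uv by (auto simp: F_def)
  have deg': "3 \<le> dg F w + dg {u, v} w" if "w \<in> F" for w
    using deg[of w] that dg_Un[of F "{u, v}" w] F by auto
  have sum_uv: "(\<Sum>w\<in>C. dg {u, v} w) = dg C u + dg C v" if "finite C" for C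
    using sum_dg_swap[of C "{u, v}"] that nuv by simp
  have comp: "2 \<le> dg C u \<and> 2 \<le> dg C v"
    if C: "C \<subseteq> F" "C \<noteq> {}" "\<forall>x \<in> C. \<forall>y \<in> F - C. \<not> adj x y" for C
  proof -
    have fC: "finite C" using C(1) F(1) by (rule finite_subset)
    have "card C + 2 \<le> (\<Sum>w\<in>C. dg {} w) + (\<Sum>w\<in>C. dg {u, v} w)"
    proof (rule forest_boundary_count[OF fC C(2)])
      show "\<not> cyclic C" using F(3) cyclic_mono C(1) by auto
      show "3 \<le> dg C w + dg {} w + dg {u, v} w" if "w \<in> C" for w
        using deg'[of w] closed_dg[OF F(1) C(1,3) that] C(1) that by auto
    qed
    then show ?thesis using sum_uv[OF fC] dg_le_card[OF fC, of u] dg_le_card[OF fC, of v] by simp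
  qed
  have "conn F"
  proof (rule ccontr)
    assume "\<not> conn F"
    then obtain C D where CD: "C \<subseteq> F" "D \<subseteq> F" "C \<inter> D = {}" "C \<noteq> {}" "D \<noteq> {}" "conn C" "conn D"
      "\<forall>x \<in> C. \<forall>y \<in> F - C. \<not> adj x y" "\<forall>x \<in> D. \<forall>y \<in> F - D. \<not> adj x y"
      using component_pair[OF F(1)] F(2) by (metis empty_iff ex_in_conv)
    have "finite C" "finite D" using finite_subset[OF CD(1) F(1)] finite_subset[OF CD(2) F(1)] .
    moreover have "u \<notin> C" "v \<notin> D" "u \<notin> D" "v \<notin> C" using CD(1,2) F(6,7) by auto
    ultimately have "cyclic (insert u C)" "cyclic (insert v D)"
      using comp[OF CD(1,4,8)] comp[OF CD(2,5,9)] CD(6,7) cyclic_apex by auto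
    moreover have "insert u C \<subseteq> V" "insert v D \<subseteq> V" using CD F(4) by auto
    moreover have "insert u C \<inter> insert v D = {}"
      using CD(3) nuv \<open>u \<notin> D\<close> \<open>v \<notin> C\<close> by auto
    ultimately have "two_cores V" by (rule two_coresI)
    then show False using nt by simp
  qed
  with F(1-3) consider z where "z \<in> F" "\<forall>l \<in> F - {z}. nb F l = {z}"
    | X Y x y where "bridge_split F X Y x y" "2 \<le> card X" "2 \<le> card Y"
    using star_or_bridge by metis
  then show ?thesis
  proof cases
    case 1
    have leaf: "adj l z \<and> adj l u \<and> adj l v" if l: "l \<in> F - {z}" for l
    proof -
      have "nb F l = {z}" using 1 l by auto
      then have "dg F l = 1" "adj l z" by (auto simp: dg_def nb_def)
      then have "2 \<le> dg {u, v} l" using deg'[of l] l by simp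
      then have "adj l u" "adj l v" using dg_full[of "{u, v}" l] nuv by auto
      then show ?thesis using \<open>adj l z\<close> by simp
    qed
    have "k3_at {u, v, z} V" unfolding k3_at_def
    proof (intro conjI ballI)
      show "{u, v, z} \<subseteq> V" using F 1 by auto
      show "card {u, v, z} = 3" using F(6,7) 1(1) nuv card_3_iff by metis
      show "adj a b" if "a \<in> {u, v, z}" "b \<in> V - {u, v, z}" for a b
        using leaf[of b] that F(4) sym by auto
      show "\<not> adj b b'" if "b \<in> V - {u, v, z}" "b' \<in> V - {u, v, z}" for b b'
      proof -
        have "b' \<notin> nb F b" using 1 that F(4) by auto
        then show ?thesis using that F(4) by (auto simp: nb_def)
      qed
    qed
    then show ?thesis by auto
  next
    case 2
    have finX: "finite X" "X \<subseteq> F" using 2 F(1) by (auto simp: bridge_split_def)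
    have "card X + 1 \<le> (\<Sum>w\<in>X. dg {u, v} w)"
      by (rule bridge_side_count[OF F(1,3) 2(1)]) (use deg' finX in auto)
    \<comment> \<open>At least three edges run from \<open>X\<close> to \<open>u\<close> and \<open>v\<close>, so one of these has two neighbours in \<open>X\<close>
      and is the hub.\<close>
    then have "2 \<le> dg X u \<or> 2 \<le> dg X v" using sum_uv[OF finX(1)] 2(2) by linarith
    moreover have "wheel_at a V" if a: "2 \<le> dg X a" "{a, b} = {u, v}" "a \<noteq> b" "adj a b" for a b
    proof -
      have V: "V = F \<union> insert a {b}" using F(4) a(2) by auto
      have ab: "a \<notin> F" "b \<notin> F" using F(6,7) a(2) by (auto simp: doubleton_eq_iff)
      have "2 \<le> dg F b" using comp[of F] F(2) a(2,3) by (auto simp: doubleton_eq_iff)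
      moreover have "dg V b = dg F b + dg {a, b} b" using dg_Un[of F "{a, b}" b] F(1) ab V by simp
      moreover have "dg {a, b} b = 1" using a(3,4) sym[OF a(4)] by (simp add: dg_insert)
      ultimately have "3 \<le> dg V b" by simp
      have "\<not> cyclic {b}"
      proof
        assume "cyclic {b}"
        then obtain T where "T \<subseteq> {b}" "core T" by (auto simp: cyclic_def)
        then have "core {b}" by (auto simp: core_def subset_singleton_iff)
        then show False by (simp add: core_def dg_insert)
      qed
      have "wheel_at a (F \<union> insert a {b})"
      proof (rule hub_of_bridge[OF F(1) _ F(3) \<open>\<not> cyclic {b}\<close> conn_singleton _ _ _ 2(1) a(1) 2(3)])
        show "F \<inter> insert a {b} = {}" using ab by auto
        show "3 \<le> dg (F \<union> insert a {b}) w" if "w \<in> F \<union> {b}" for w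
        proof (cases "w = b")
          case True
          then show ?thesis using \<open>3 \<le> dg V b\<close> V by simp
        next
          case False
          then have "w \<in> V - {u, v}" using that by (simp add: F_def)
          then show ?thesis using deg V by metis
        qed
        show "\<not> two_cores (F \<union> insert a {b})" using nt V by simp
      qed (use a(3,4) in auto)
      then show ?thesis using V by simp
    qed
    ultimately show ?thesis using nuv uv sym by (metis insert_commute)
  qed
qed

section \<open>Graphs with a triangle\<close>
definition k5 :: "'a set \<Rightarrow> bool" where
  "k5 V \<longleftrightarrow> card V = 5 \<and> (\<forall>x \<in> V. \<forall>y \<in> V. x \<noteq> y \<longrightarrow> adj x y)"

definition lovasz_type :: "'a set \<Rightarrow> bool" where
  "lovasz_type V \<longleftrightarrow> k5 V \<or> (\<exists>h. wheel_at h V) \<or> (\<exists>A. k3_at A V)"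

text \<open>On five vertices a vertex misses at most one other. If \<open>p\<close> and \<open>q\<close> are not adjacent, both are joined
  to the other three, which therefore can serve as the first class.\<close>
lemma lovasz_five_vertices:
  assumes "card V = 5" and deg: "\<And>v. v \<in> V \<Longrightarrow> 3 \<le> dg V v"
  shows "lovasz_type V"
proof (cases "k5 V")
  case True
  then show ?thesis by (simp add: lovasz_type_def)
next
  case False
  then obtain p q where pq: "p \<in> V" "q \<in> V" "p \<noteq> q" "\<not> adj p q"
    using assms(1) by (auto simp: k5_def)
  have fin: "finite V" using assms(1) card.infinite by fastforce
  define A where "A = V - {p, q}"
  have A: "finite A" "card A = 3" using fin pq assms(1) by (auto simp: A_def card_Diff_subset)
  have full: "adj b a" if "b \<in> {p, q}" "a \<in> A" for a b
  proof -
    have "nb V b = nb A b" using pq sym that by (auto simp: A_def nb_def)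
    moreover have "3 \<le> dg V b" using deg pq that by auto
    ultimately have "card A \<le> dg A b" using A by (simp add: dg_def)
    then show ?thesis using dg_full A that by metis
  qed
  have "k3_at A V" unfolding k3_at_def
  proof (intro conjI ballI)
    show "adj a b" if "a \<in> A" "b \<in> V - A" for a b
      using full[of b a] that sym[of b a] by (auto simp: A_def)
    show "\<not> adj b b'" if "b \<in> V - A" "b' \<in> V - A" for b b'
      using that pq(3,4) sym[of q p] by (auto simp: A_def)
  qed (use A in \<open>auto simp: A_def\<close>)
  then show ?thesis by (auto simp: lovasz_type_def)
qed

lemma nb_subset_full:
  assumes "finite A" "nb V v \<subseteq> A" "card A \<le> dg V v" "y \<in> A"
  shows "adj v y"
proof -
  have "nb V v = A" using assms by (intro card_seteq) (auto simp: dg_def)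
  then show ?thesis using assms(4) by (auto simp: nb_def)
qed

lemma card3_cases:
  assumes "2 \<le> dg {a, b, c} v"
  shows "adj v a \<and> adj v b \<or> adj v b \<and> adj v c \<or> adj v a \<and> adj v c"
  using assms by (elim dg_ge2E) auto

text \<open>Here a tree with centre \<open>z\<close> and set of leaves \<open>L\<close> is left after deleting the triangle \<open>abc\<close>, and two
  leaves are both joined to \<open>b\<close> and \<open>c\<close>. If some leaf were joined to \<open>a\<close>, there would be two disjoint
  cycles, in most cases a triangle of that leaf with \<open>a\<close> and one of \<open>b\<close>, \<open>c\<close>, and a cycle through \<open>z\<close> and
  the other one. So every
  leaf is joined to exactly \<open>b\<close>, \<open>c\<close> and \<open>z\<close>, and the degree of \<open>a\<close> forces the edge \<open>az\<close>.\<close>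
lemma star_shared_pair:
  assumes deg: "\<And>v. v \<in> V \<Longrightarrow> 3 \<le> dg V v" and nt: "\<not> two_cores V"
    and tri: "adj a b" "adj b c" "adj c a"
    and V: "V = {a, b, c} \<union> insert z L" "z \<notin> {a, b, c}" "L \<inter> {z, a, b, c} = {}"
    and star: "\<And>l. l \<in> L \<Longrightarrow> adj l z" "\<And>l m. l \<in> L \<Longrightarrow> m \<in> L \<Longrightarrow> \<not> adj l m"
    and two: "\<And>l. l \<in> L \<Longrightarrow> 2 \<le> dg {a, b, c} l"
    and l: "l1 \<in> L" "l2 \<in> L" "l1 \<noteq> l2" "adj l1 b" "adj l1 c" "adj l2 b" "adj l2 c"
  shows "k3_at {b, c, z} V"
proof -
  have ne: "a \<noteq> b" "b \<noteq> c" "c \<noteq> a" "z \<noteq> a" "z \<noteq> b" "z \<noteq> c" using tri V(2) by auto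
  have nL: "l \<noteq> a" "l \<noteq> b" "l \<noteq> c" "l \<noteq> z" if "l \<in> L" for l using that V(3) by auto
  have inV: "{a, b, c, z} \<subseteq> V" "L \<subseteq> V" using V(1) by auto
  have tt: False if "adj p q" "adj q r" "adj r p" "adj p' q'" "adj q' r'" "adj r' p'"
    "{p, q, r} \<inter> {p', q', r'} = {}" "{p, q, r, p', q', r'} \<subseteq> V" for p q r p' q' r'
    using nt two_coresI[OF cyclic_core[OF core_triangle[OF that(1-3)]]
        cyclic_core[OF core_triangle[OF that(4-6)]]] that(7,8) by auto
  have ts: False if "adj p q" "adj q r" "adj r p" "adj p' q'" "adj q' r'" "adj r' s'" "adj s' p'"
    "p' \<noteq> r'" "q' \<noteq> s'" "{p, q, r} \<inter> {p', q', r', s'} = {}" "{p, q, r, p', q', r', s'} \<subseteq> V"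
    for p q r p' q' r' s'
    using nt two_coresI[OF cyclic_core[OF core_triangle[OF that(1-3)]]
        cyclic_core[OF core_square[OF that(4-9)]]] that(10,11) by auto
  \<comment> \<open>A third leaf leaves \<open>l1\<close> and \<open>l2\<close> free for the 4-cycle through \<open>z\<close>.\<close>
  have other: "\<not> adj m a" if m: "m \<in> L" "m \<noteq> l1" "m \<noteq> l2" for m
  proof
    assume ma: "adj m a"
    have "m \<in> V" "l1 \<in> V" "l2 \<in> V" using inV l m by auto
    have "adj m b \<or> adj m c" using card3_cases[OF two[OF m(1)]] by auto
    then show False
    proof
      assume "adj m b"
      then show False
        using ts[of m a b z l1 c l2] ma tri l star(1) m sym ne nL[of m] nL[of l1] nL[of l2] inV
          \<open>m \<in> V\<close> \<open>l1 \<in> V\<close> \<open>l2 \<in> V\<close> by auto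
    next
      assume "adj m c"
      then show False
        using ts[of m a c z l1 b l2] ma tri l star(1) m sym ne nL[of m] nL[of l1] nL[of l2] inV
          \<open>m \<in> V\<close> \<open>l1 \<in> V\<close> \<open>l2 \<in> V\<close> by auto
    qed
  qed
  \<comment> \<open>For \<open>l1\<close> and \<open>l2\<close> themselves the second cycle needs another leaf or an edge at \<open>z\<close>; if \<open>z\<close> has no
    third leaf, its degree supplies the edge.\<close>
  have self: "\<not> adj m a" if m: "{m, m'} = {l1, l2}" for m m'
  proof
    assume ma: "adj m a"
    have mm: "m \<in> L" "m' \<in> L" "m \<noteq> m'" "adj m b" "adj m c" "adj m' b" "adj m' c"
      using m l by (auto simp: doubleton_eq_iff)
    have mV: "m \<in> V" "m' \<in> V" using mm inV by auto
    have nzb: "\<not> adj z b"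
      using tt[of m a c z m' b] ma tri mm star(1) sym ne nL[of m] nL[of m'] inV mV by auto
    have nzc: "\<not> adj z c"
      using tt[of m a b z m' c] ma tri mm star(1) sym ne nL[of m] nL[of m'] inV mV by auto
    show False
    proof (cases "L \<subseteq> {m, m'}")
      case True
      have "adj z a"
      proof (rule nb_subset_full)
        show "nb V z \<subseteq> {a, m, m'}" using nzb nzc True V(1) by (auto simp: nb_def)
        show "card {a, m, m'} \<le> dg V z"
          using deg[of z] inV mm(3) nL(1)[OF mm(1)] nL(1)[OF mm(2)] by auto
      qed auto
      then show False
        using tt[of m a z m' b c] ma tri mm star(1) sym ne nL[of m] nL[of m'] inV mV by auto
    next
      case False
      then obtain k where k: "k \<in> L" "k \<noteq> m" "k \<noteq> m'" by auto
      then have "\<not> adj k a" using other[of k] m by (auto simp: doubleton_eq_iff)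
      then have "adj k b" "adj k c" using card3_cases[OF two[OF k(1)]] by auto
      then show False
        using ts[of m a b z m' c k] ma tri mm star(1) sym ne nL[of m] nL[of m'] nL[of k] inV mV k
        by auto
    qed
  qed
  have na: "\<not> adj m a" if "m \<in> L" for m
    using other[OF that] self[of l1 l2] self[of l2 l1] by auto
  have bc: "adj m b" "adj m c" if "m \<in> L" for m
    using card3_cases[OF two[OF that]] na[OF that] by auto
  have az: "adj a z"
  proof (rule nb_subset_full)
    have "y \<in> {b, c, z}" if "y \<in> V" "adj a y" for y
      using that na[of y] V(1) sym[of a y] by auto
    then show "nb V a \<subseteq> {b, c, z}" by (auto simp: nb_def)
    show "card {b, c, z} \<le> dg V a" using deg[of a] inV ne by auto
  qed auto
  have out: "x = a \<or> x \<in> L" if "x \<in> V - {b, c, z}" for x using that V(1) by auto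
  show ?thesis unfolding k3_at_def
  proof (intro conjI ballI)
    show "{b, c, z} \<subseteq> V" using inV by auto
    show "card {b, c, z} = 3" using ne by auto
    show "adj x y" if "x \<in> {b, c, z}" "y \<in> V - {b, c, z}" for x y
      using out[OF that(2)] that(1) az tri bc star(1) sym by auto
    show "\<not> adj x y" if "x \<in> V - {b, c, z}" "y \<in> V - {b, c, z}" for x y
      using out[OF that(1)] out[OF that(2)] na star(2) sym[of a y] by auto
  qed
qed

text \<open>The other case: no two leaves are joined to the same two vertices of the triangle. A third leaf would
  be joined to \<open>a\<close> and \<open>b\<close> and give two disjoint cycles, so the graph has six vertices, and it is the wheel
  with hub \<open>c\<close> and rim \<open>a, l1, z, l2, b\<close>.\<close>
lemma star_distinct_pairs:
  assumes deg: "\<And>v. v \<in> V \<Longrightarrow> 3 \<le> dg V v" and nt: "\<not> two_cores V"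
    and tri: "adj a b" "adj b c" "adj c a"
    and V: "V = {a, b, c} \<union> insert z L" "z \<notin> {a, b, c}" "L \<inter> {z, a, b, c} = {}"
    and star: "\<And>l. l \<in> L \<Longrightarrow> adj l z" "\<And>l m. l \<in> L \<Longrightarrow> m \<in> L \<Longrightarrow> \<not> adj l m"
    and two: "\<And>l. l \<in> L \<Longrightarrow> 2 \<le> dg {a, b, c} l"
    and l: "l1 \<in> L" "l2 \<in> L" "l1 \<noteq> l2" "adj l1 a" "adj l1 c" "adj l2 b" "adj l2 c"
    and unshared: "\<And>l m. l \<in> L \<Longrightarrow> m \<in> L \<Longrightarrow> l \<noteq> m \<Longrightarrow>
      \<not> (adj l a \<and> adj l c \<and> adj m a \<and> adj m c) \<and> \<not> (adj l b \<and> adj l c \<and> adj m b \<and> adj m c)"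
  shows "wheel_at c V"
proof -
  have ne: "a \<noteq> b" "b \<noteq> c" "c \<noteq> a" "z \<noteq> a" "z \<noteq> b" "z \<noteq> c" using tri V(2) by auto
  have nL: "l \<noteq> a" "l \<noteq> b" "l \<noteq> c" "l \<noteq> z" if "l \<in> L" for l using that V(3) by auto
  have inV: "{a, b, c, z} \<subseteq> V" "L \<subseteq> V" "l1 \<in> V" "l2 \<in> V" using V(1) l by auto
  note nl = nL[OF l(1)] nL[OF l(2)]
  have n1: "\<not> adj l1 b" using unshared[OF l(1-3)] l by auto
  have n2: "\<not> adj l2 a" using unshared[OF l(1-3)] l by auto
  have L: "L = {l1, l2}"
  proof (rule ccontr)
    assume "L \<noteq> {l1, l2}"
    then obtain m where m: "m \<in> L" "m \<noteq> l1" "m \<noteq> l2" using l by auto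
    have "\<not> (adj m a \<and> adj m c)" "\<not> (adj m b \<and> adj m c)"
      using unshared[OF m(1) l(1) m(2)] unshared[OF m(1) l(2) m(3)] l by auto
    then have "adj m a" "adj m b" using card3_cases[OF two[OF m(1)]] by auto
    then have "core {l1, a, c}" "core {l2, b, m, z}"
      using l m tri star(1) sym ne nl nL[OF m(1)]
      by (auto intro!: core_triangle core_square)
    moreover have "{l1, a, c} \<inter> {l2, b, m, z} = {}" using ne nl nL[OF m(1)] l m by auto
    moreover have "{l1, a, c} \<subseteq> V" "{l2, b, m, z} \<subseteq> V" using inV m by auto
    ultimately have "two_cores V" using two_coresI cyclic_core by metis
    then show False using nt by simp
  qed
  have nza: "\<not> adj z a"
  proof
    assume "adj z a"
    then have "core {z, l1, a}" "core {l2, b, c}"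
      using l tri star(1) sym by (auto intro!: core_triangle)
    moreover have "{z, l1, a} \<inter> {l2, b, c} = {}" using ne nl l by auto
    moreover have "{z, l1, a} \<subseteq> V" "{l2, b, c} \<subseteq> V" using inV by auto
    ultimately have "two_cores V" using two_coresI cyclic_core by metis
    then show False using nt by simp
  qed
  have nzb: "\<not> adj z b"
  proof
    assume "adj z b"
    then have "core {z, l2, b}" "core {l1, a, c}"
      using l tri star(1) sym by (auto intro!: core_triangle)
    moreover have "{z, l2, b} \<inter> {l1, a, c} = {}" using ne nl l by auto
    moreover have "{z, l2, b} \<subseteq> V" "{l1, a, c} \<subseteq> V" using inV by auto
    ultimately have "two_cores V" using two_coresI cyclic_core by metis
    then show False using nt by simp
  qed
  have zc: "adj z c"
  proof (rule nb_subset_full)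
    show "nb V z \<subseteq> {c, l1, l2}" using nza nzb V(1) L by (auto simp: nb_def)
    show "card {c, l1, l2} \<le> dg V z" using deg[of z] inV nl l by auto
  qed auto
  have nll: "\<not> adj l1 l2" using star(2) l by auto
  show ?thesis unfolding wheel_at_def
  proof (intro exI[of _ "[a, l1, z, l2, b]"] conjI ballI)
    show "cycle_list [a, l1, z, l2, b]"
      using ne nl l tri star(1) sym by (auto simp: cycle_list_def)
    show "c \<notin> set [a, l1, z, l2, b]" using ne nl by auto
    show "V = insert c (set [a, l1, z, l2, b])" using V(1) L by auto
    fix x assume x: "x \<in> set [a, l1, z, l2, b]"
    show "adj c x" using x tri l zc sym by auto
    have "dg {a, l1, z, l2, b} x = 2"
      using x ne nl l(3-7) tri star(1)[OF l(1)] star(1)[OF l(2)] nll n1 n2 nza nzb adj_commute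
      by (auto simp: dg_insert)
    then show "dg (set [a, l1, z, l2, b]) x = 2" by simp
  qed
qed

lemma triangle_star:
  assumes fin: "finite V" and deg: "\<And>v. v \<in> V \<Longrightarrow> 3 \<le> dg V v" and nt: "\<not> two_cores V"
    and tri: "adj a b" "adj b c" "adj c a"
    and V: "V = {a, b, c} \<union> insert z L" "z \<notin> {a, b, c}" "L \<inter> {z, a, b, c} = {}" and ne: "L \<noteq> {}"
    and star: "\<And>l. l \<in> L \<Longrightarrow> adj l z" "\<And>l m. l \<in> L \<Longrightarrow> m \<in> L \<Longrightarrow> \<not> adj l m"
    and two: "\<And>l. l \<in> L \<Longrightarrow> 2 \<le> dg {a, b, c} l"
  shows "lovasz_type V"
proof -
  obtain l1 where l1: "l1 \<in> L" using ne by auto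
  show ?thesis
  proof (cases "L = {l1}")
    case True
    have "a \<noteq> b" "b \<noteq> c" "c \<noteq> a" using tri by auto
    then have "card V = 5" using V l1 True by auto
    then show ?thesis using deg by (rule lovasz_five_vertices)
  next
    case False
    then obtain l2 where l2: "l2 \<in> L" "l1 \<noteq> l2" using l1 by auto
    have shared: "lovasz_type V"
      if "{p, q, r} = {a, b, c}" "adj p q" "adj q r" "adj r p"
        "l \<in> L" "m \<in> L" "l \<noteq> m" "adj l q" "adj l r" "adj m q" "adj m r" for p q r l m
    proof -
      have "k3_at {q, r, z} V"
        by (rule star_shared_pair[OF deg nt that(2-4) V[folded that(1)] star
              two[folded that(1)] that(5-11)]) (use V(3) that(1) in auto)
      then show ?thesis by (auto simp: lovasz_type_def)
    qed
    show ?thesis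
    proof (cases "\<exists>l m. l \<in> L \<and> m \<in> L \<and> l \<noteq> m \<and>
        (adj l a \<and> adj l b \<and> adj m a \<and> adj m b \<or> adj l b \<and> adj l c \<and> adj m b \<and> adj m c \<or>
         adj l a \<and> adj l c \<and> adj m a \<and> adj m c)")
      case True
      then obtain l m where lm: "l \<in> L" "m \<in> L" "l \<noteq> m" and
        "adj l a \<and> adj l b \<and> adj m a \<and> adj m b \<or> adj l b \<and> adj l c \<and> adj m b \<and> adj m c \<or>
         adj l a \<and> adj l c \<and> adj m a \<and> adj m c" by metis
      then show ?thesis
        using shared[OF _ tri(3,1,2) lm] shared[OF _ tri lm] shared[OF _ tri(2,3,1) lm]
        by (auto simp: insert_commute)
    next
      case False
      then have uns: "\<not> (adj l a \<and> adj l b \<and> adj m a \<and> adj m b)"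
        "\<not> (adj l b \<and> adj l c \<and> adj m b \<and> adj m c)"
        "\<not> (adj l a \<and> adj l c \<and> adj m a \<and> adj m c)" if "l \<in> L" "m \<in> L" "l \<noteq> m" for l m
        using that by metis+
      have dist: "lovasz_type V"
        if "{p, q, r} = {a, b, c}" "adj p q" "adj q r" "adj r p"
          "l \<in> L" "m \<in> L" "l \<noteq> m" "adj l p" "adj l r" "adj m q" "adj m r" for p q r l m
      proof -
        have "p \<in> {a, b, c}" "q \<in> {a, b, c}" "r \<in> {a, b, c}" "p \<noteq> q" "q \<noteq> r" "r \<noteq> p"
          using that(1-4) by auto
        then have uns': "\<not> (adj l' p \<and> adj l' r \<and> adj m' p \<and> adj m' r) \<and>
            \<not> (adj l' q \<and> adj l' r \<and> adj m' q \<and> adj m' r)"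
          if "l' \<in> L" "m' \<in> L" "l' \<noteq> m'" for l' m'
          using uns[OF that] by auto
        have "wheel_at r V"
          by (rule star_distinct_pairs[OF deg nt that(2-4) V[folded that(1)] star
                two[folded that(1)] that(5-11)]) (use V(3) that(1) uns' in auto)
        then show ?thesis by (auto simp: lovasz_type_def)
      qed
      have c1: "adj l1 a \<and> adj l1 b \<or> adj l1 b \<and> adj l1 c \<or> adj l1 a \<and> adj l1 c"
        using card3_cases two l1 by metis
      have c2: "adj l2 a \<and> adj l2 b \<or> adj l2 b \<and> adj l2 c \<or> adj l2 a \<and> adj l2 c"
        using card3_cases two l2 by metis
      have perms: "{b, a, c} = {a, b, c}" "{c, a, b} = {a, b, c}" "{a, c, b} = {a, b, c}"
        "{b, c, a} = {a, b, c}" "{c, b, a} = {a, b, c}" by auto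
      note tri' = tri(1)[THEN sym] tri(2)[THEN sym] tri(3)[THEN sym]
      show ?thesis
        using c1 c2 uns[OF l1 l2] tri tri'
          dist[OF refl _ _ _ l1 l2] dist[OF perms(1) _ _ _ l1 l2] dist[OF perms(2) _ _ _ l1 l2]
          dist[OF perms(3) _ _ _ l1 l2] dist[OF perms(4) _ _ _ l1 l2] dist[OF perms(5) _ _ _ l1 l2]
        by argo
    qed
  qed
qed

text \<open>Deleting the triangle \<open>T\<close> leaves a forest \<open>F\<close>. Without edges in \<open>F\<close> the triangle is the first class of
  a \<open>K\<^sub>3\<^sub>,\<^sub>m\<close>. Otherwise \<open>F\<close> is a tree: a component with an edge sends at least four edges to \<open>T\<close> and forms a
  cycle with one vertex of \<open>T\<close>, and any other component forms one with the two others. A star is settled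
  by \<open>triangle_star\<close>, and a bridge yields a wheel as soon as a vertex of \<open>T\<close> has two neighbours on
  one side.\<close>
lemma triangle_structure:
  assumes fin: "finite V" and deg: "\<And>v. v \<in> V \<Longrightarrow> 3 \<le> dg V v" and nt: "\<not> two_cores V"
    and abc: "a \<in> V" "b \<in> V" "c \<in> V" and tri: "adj a b" "adj b c" "adj c a"
  shows "lovasz_type V"
proof -
  define T where "T = {a, b, c}"
  define F where "F = V - T"
  have abc_ne: "a \<noteq> b" "b \<noteq> c" "c \<noteq> a" using tri by auto
  have T: "finite T" "card T = 3" "T \<subseteq> V" using abc_ne abc by (auto simp: T_def)
  have F: "finite F" "V = F \<union> T" "F \<inter> T = {}" using fin T(3) by (auto simp: F_def)
  have split: "\<exists>q r. T = {t, q, r} \<and> adj t q \<and> adj q r \<and> adj r t" if "t \<in> T" for t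
  proof -
    consider "t = a" | "t = b" | "t = c" using \<open>t \<in> T\<close> by (auto simp: T_def)
    then show ?thesis
    proof cases
      case 1
      then show ?thesis using tri by (intro exI[of _ b] exI[of _ c]) (auto simp: T_def)
    next
      case 2
      then show ?thesis using tri by (intro exI[of _ c] exI[of _ a]) (auto simp: T_def)
    next
      case 3
      then show ?thesis using tri by (intro exI[of _ a] exI[of _ b]) (auto simp: T_def)
    qed
  qed
  have "core T" using core_triangle[OF tri] by (simp add: T_def)
  then have acF: "\<not> cyclic F"
    using nt two_coresI[of F T V] cyclic_core[of T] F by auto
  have deg': "3 \<le> dg F v + dg T v" if "v \<in> V" for v
    using deg[OF that] dg_Un[OF F(1) T(1) F(3), of v] F(2) by simp
  have neF: "F \<noteq> {}"
  proof
    assume "F = {}"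
    then have "3 \<le> dg T a" using deg'[OF abc(1)] by simp
    moreover have "dg T a < 3" using dg_less_card[OF T(1), of a] T(2) by (simp add: T_def)
    ultimately show False by simp
  qed
  show ?thesis
  proof (cases "\<exists>v \<in> F. \<exists>w \<in> F. adj v w")
    case False
    have "k3_at T V" unfolding k3_at_def
    proof (intro conjI ballI)
      show "adj x y" if "x \<in> T" "y \<in> V - T" for x y
      proof -
        have y: "y \<in> F" using that by (simp add: F_def)
        then have "nb F y = {}" using False by (auto simp: nb_def)
        then have "card T \<le> dg T y" using deg'[of y] y T(2) by (simp add: dg_def F_def)
        then show ?thesis using dg_full[OF T(1) _ that(1)] sym by auto
      qed
      show "\<not> adj x y" if "x \<in> V - T" "y \<in> V - T" for x y using False that by (auto simp: F_def)
    qed (use T in auto)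
    then show ?thesis by (auto simp: lovasz_type_def)
  next
    case True
    then obtain v w where vw: "v \<in> F" "w \<in> F" "adj v w" by auto
    have cF: "conn F"
    proof (rule ccontr)
      assume "\<not> conn F"
      then obtain C D where CD: "C \<subseteq> F" "D \<subseteq> F" "C \<inter> D = {}" "v \<in> C" "D \<noteq> {}" "conn C" "conn D"
        "\<forall>x \<in> C. \<forall>y \<in> F - C. \<not> adj x y" "\<forall>x \<in> D. \<forall>y \<in> F - D. \<not> adj x y"
        using component_pair[OF F(1) vw(1)] by metis
      have finCD: "finite C" "finite D"
        using finite_subset[OF CD(1) F(1)] finite_subset[OF CD(2) F(1)] .
      have cnt: "card B + 2 \<le> (\<Sum>x\<in>B. dg T x)"
        if B: "B \<subseteq> F" "B \<noteq> {}" "finite B" "\<forall>x \<in> B. \<forall>y \<in> F - B. \<not> adj x y" for B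
      proof -
        have "card B + 2 \<le> (\<Sum>x\<in>B. dg {} x) + (\<Sum>x\<in>B. dg T x)"
        proof (rule forest_boundary_count[OF B(3,2)])
          show "\<not> cyclic B" using acF cyclic_mono B(1) by auto
          show "3 \<le> dg B x + dg {} x + dg T x" if "x \<in> B" for x
            using deg'[of x] closed_dg[OF F(1) B(1,4) that] B(1) that F(2) by auto
        qed
        then show ?thesis by simp
      qed
      have neC: "C \<noteq> {}" using CD(4) by auto
      have "w \<in> C" using CD(4,8) vw by auto
      then have "2 \<le> card C"
        using card_mono[OF finCD(1), of "{v, w}"] CD(4) vw(3) by (cases "v = w") auto
      then have "4 \<le> (\<Sum>x\<in>C. dg T x)" using cnt[OF CD(1) neC finCD(1) CD(8)] by simp
      then have "4 \<le> (\<Sum>t\<in>T. dg C t)" using sum_dg_swap[OF finCD(1) T(1)] by simp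
      then obtain t where t: "t \<in> T" "2 \<le> dg C t"
        using sum_bounded_above[of T "dg C" 1] T(2) by fastforce
      obtain q r where qr: "T = {t, q, r}" "adj t q" "adj q r" "adj r t" using split[OF t(1)] by auto
      have tqr: "t \<noteq> q" "q \<noteq> r" "r \<noteq> t" "t \<notin> {q, r}" using qr by auto
      have nF: "t \<notin> F" "q \<notin> F" "r \<notin> F" using F(3) qr(1) by auto
      have "t \<notin> C" using nF CD(1) by auto
      then have c1: "cyclic (insert t C)" using cyclic_apex[OF finCD(1) CD(6)] t(2) by auto
      have "card D + 2 \<le> (\<Sum>x\<in>D. dg T x)" using cnt[OF CD(2,5) finCD(2) CD(9)] .
      also have "\<dots> = (\<Sum>x\<in>D. dg {t} x) + (\<Sum>x\<in>D. dg {q, r} x)"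
        unfolding sum.distrib[symmetric] qr(1) using tqr by (intro sum.cong) (auto simp: dg_insert)
      also have "(\<Sum>x\<in>D. dg {t} x) = dg D t" using sum_dg_swap[OF finCD(2), of "{t}"] by simp
      also have "\<dots> \<le> card D" using finCD(2) by (rule dg_le_card)
      finally have "2 \<le> (\<Sum>x\<in>D. dg {q, r} x)" by simp
      moreover have "D \<inter> {q, r} = {}" using nF CD(2) by auto
      ultimately have c2: "cyclic (D \<union> {q, r})"
        using cyclic_edge_count[OF finCD(2) _ CD(7) conn_pair[OF qr(3)]] by auto
      have "insert t C \<subseteq> V" "D \<union> {q, r} \<subseteq> V" using CD(1,2) F(2) qr(1) by auto
      moreover have "insert t C \<inter> (D \<union> {q, r}) = {}" using CD(1-3) nF tqr by auto
      ultimately have "two_cores V" using two_coresI[OF c1 c2] by auto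
      then show False using nt by simp
    qed
    consider z where "z \<in> F" "\<forall>l \<in> F - {z}. nb F l = {z}"
      | X Y x y where "bridge_split F X Y x y" "2 \<le> card X" "2 \<le> card Y"
      using star_or_bridge[OF F(1) acF cF neF] by metis
    then show ?thesis
    proof cases
      case 1
      show ?thesis
      proof (rule triangle_star[OF fin deg nt tri])
        show "V = {a, b, c} \<union> insert z (F - {z})" using F(2) 1(1) by (auto simp: T_def)
        show "z \<notin> {a, b, c}" "(F - {z}) \<inter> {z, a, b, c} = {}" using F(3) 1(1) by (auto simp: T_def)
        have "v \<noteq> w" using vw(3) by auto
        then show "F - {z} \<noteq> {}" using vw(1,2) by auto
        show "adj l z" if "l \<in> F - {z}" for l using 1(2) that by (auto simp: nb_def)
        show "\<not> adj l m" if "l \<in> F - {z}" "m \<in> F - {z}" for l m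
        proof -
          have "m \<notin> nb F l" using 1(2) that by auto
          then show ?thesis using that by (auto simp: nb_def)
        qed
        show "2 \<le> dg {a, b, c} l" if "l \<in> F - {z}" for l
        proof -
          have "dg F l = 1" using 1(2) that by (simp add: dg_def)
          then show ?thesis using deg'[of l] that F(2) by (simp add: T_def)
        qed
      qed auto
    next
      case 2
      have hub: "lovasz_type V"
        if bs: "bridge_split F X' Y' x' y'" "2 \<le> card Y'" and t: "t \<in> T" "2 \<le> dg X' t" for X' Y' x' y' t
      proof -
        obtain q r where qr: "T = {t, q, r}" "adj t q" "adj q r" "adj r t" using split[OF t(1)] by auto
        have tqr: "t \<noteq> q" "q \<noteq> r" "r \<noteq> t" "t \<notin> {q, r}" using qr by auto
        have acQ: "\<not> cyclic {q, r}"
        proof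
          assume "cyclic {q, r}"
          then obtain B where B: "B \<subseteq> {q, r}" "core B" by (auto simp: cyclic_def)
          then obtain s where "s \<in> B" "finite B" "2 \<le> dg B s" by (auto simp: core_def)
          then show False
            using dg_less_card[of B s] card_mono[OF _ B(1)] tqr by simp
        qed
        have VT: "V = F \<union> insert t {q, r}" using F(2) qr(1) by simp
        have "wheel_at t (F \<union> insert t {q, r})"
        proof (rule hub_of_bridge[OF F(1) _ acF acQ conn_pair[OF qr(3)] _ tqr(4) _ bs(1) t(2) bs(2)])
          show "F \<inter> insert t {q, r} = {}" using F(3) qr(1) by simp
          show "3 \<le> dg (F \<union> insert t {q, r}) s" if "s \<in> F \<union> {q, r}" for s
            using deg[of s] that VT by simp
          show "adj t s" if "s \<in> {q, r}" for s using that qr(2,4) sym by auto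
          show "\<not> two_cores (F \<union> insert t {q, r})" using nt VT by simp
        qed auto
        then show ?thesis using VT by (auto simp: lovasz_type_def)
      qed
      show ?thesis
      proof (cases "\<exists>t \<in> T. 2 \<le> dg X t \<or> 2 \<le> dg Y t")
        case True
        then show ?thesis using hub[OF 2(1,3)] hub[OF bridge_split_commute[OF 2(1)] 2(2)] by auto
      next
        case False
        then have le1: "dg X t \<le> 1" "dg Y t \<le> 1" if "t \<in> T" for t using that by force+
        have XY: "F = X \<union> Y" "X \<inter> Y = {}" "conn Y" "x \<in> X" "y \<in> Y" "adj x y"
          and cross: "\<And>u w. u \<in> X \<Longrightarrow> w \<in> Y \<Longrightarrow> adj u w \<Longrightarrow> u = x \<and> w = y"
          using 2(1) by (auto simp: bridge_split_def)
        have finXY: "finite X" "finite Y" using XY(1) F(1) by auto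
        have cX: "card X + 1 \<le> (\<Sum>t\<in>T. dg X t)"
          using bridge_side_count[OF F(1) acF 2(1), of T] deg' F(2) XY(1) sum_dg_swap[OF finXY(1) T(1)]
          by auto
        have cY: "card Y + 1 \<le> (\<Sum>t\<in>T. dg Y t)"
          using bridge_side_count[OF F(1) acF bridge_split_commute[OF 2(1)], of T] deg' F(2) XY(1)
            sum_dg_swap[OF finXY(2) T(1)]
          by auto
        have sum3: "(\<Sum>t\<in>T. f t) = f p + f q + f r" if "T = {p, q, r}" for f :: "'a \<Rightarrow> nat" and p q r
        proof -
          have "p \<noteq> q" "q \<noteq> r" "p \<noteq> r" using that T(2) by (auto simp: card_insert_if split: if_splits)
          then show ?thesis using that by simp
        qed
        \<comment> \<open>What is left is the path on four vertices, with each vertex of \<open>T\<close> joined to exactly one vertex of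
          each half. The end \<open>x'\<close> spans a triangle with its two neighbours \<open>p\<close>, \<open>q\<close> in \<open>T\<close>; the third vertex \<open>r\<close>
          is joined to \<open>x\<close> and to \<open>Y\<close>, which gives a second cycle.\<close>
        have "(\<Sum>t\<in>T. dg X t) \<le> 3" using sum_bounded_above[of T "dg X" 1] le1(1) T(2) by simp
        then have X2: "card X = 2" "(\<Sum>t\<in>T. dg X t) = 3" using cX 2(2) by auto
        have Y3: "3 \<le> (\<Sum>t\<in>T. dg Y t)" using cY 2(3) by simp
        have one: "\<exists>s\<in>X. adj t s" "\<exists>s\<in>Y. adj t s" if tT: "t \<in> T" for t
        proof -
          obtain q r where qr: "T = {t, q, r}" using split[OF tT] by auto
          have "dg X q \<le> 1" "dg X r \<le> 1" "dg Y q \<le> 1" "dg Y r \<le> 1" using le1 qr by auto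
          then have "0 < dg X t" "0 < dg Y t" using X2(2) Y3 sum3[OF qr] by auto
          then show "\<exists>s\<in>X. adj t s" "\<exists>s\<in>Y. adj t s" using dg_pos_iff finXY by auto
        qed
        obtain x' where x': "X = {x, x'}" "x \<noteq> x'"
          using X2(1) XY(4) by (auto simp: card_2_iff doubleton_eq_iff)
        have x'F: "x' \<in> F" "x \<in> F" using x' XY(1) by auto
        have "nb F x' \<subseteq> {x}"
        proof
          fix s assume "s \<in> nb F x'"
          then have s: "s \<in> F" "adj x' s" by (auto simp: nb_def)
          have "s \<notin> Y" using cross[of x' s] s x' by auto
          then show "s \<in> {x}" using s XY(1) x'(1) by auto
        qed
        then have "dg F x' \<le> 1" unfolding dg_def using card_mono[of "{x}" "nb F x'"] by simp
        then have "2 \<le> dg T x'" using deg'[of x'] x'F F(2) by simp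
        then obtain p q where pq: "p \<in> T" "q \<in> T" "p \<noteq> q" "adj x' p" "adj x' q" by (rule dg_ge2E)
        obtain q1 r1 where qr1: "T = {p, q1, r1}" "adj p q1" "adj q1 r1" "adj r1 p"
          using split[OF pq(1)] by auto
        then have "p \<noteq> q1" "q1 \<noteq> r1" "r1 \<noteq> p" by auto
        moreover have "T = {p, r1, q1}" "adj p r1" using qr1 sym by auto
        moreover have "q = q1 \<or> q = r1" using pq(2,3) qr1(1) by auto
        ultimately obtain r where r: "T = {p, q, r}" "r \<noteq> p" "r \<noteq> q" "adj p q"
          using qr1(1,2) by metis
        have nF: "p \<notin> F" "q \<notin> F" "r \<notin> F" using F(3) r(1) by auto
        have uniqX: "s = s'" if "t \<in> T" "s \<in> X" "s' \<in> X" "adj t s" "adj t s'" for t s s'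
          using dg_ge2I[OF finXY(1) that(2,3) _ that(4,5)] le1(1)[OF that(1)] by force
        have rx: "adj r x"
        proof (rule ccontr)
          assume n: "\<not> adj r x"
          have "\<not> adj t x" if t: "t \<in> T" for t
          proof
            assume "adj t x"
            then have "t = p \<or> t = q" using n t r by auto
            then have "adj t x'" using pq sym by auto
            then show False using uniqX[OF t, of x x'] \<open>adj t x\<close> x' by auto
          qed
          then have "nb T x = {}" using sym[of x] by (auto simp: nb_def)
          moreover have "nb F x \<subseteq> {x', y}"
          proof
            fix s assume "s \<in> nb F x"
            then have s: "s \<in> F" "adj x s" by (auto simp: nb_def)
            then have "s \<noteq> x" by auto
            then show "s \<in> {x', y}" using s XY(1) x'(1) cross[of x s] XY(4) by auto
          qed
          then have "dg F x \<le> 2" unfolding dg_def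
            using card_mono[of "{x', y}" "nb F x"] card_insert_le_m1[of 2 "{y}" x'] by auto
          ultimately show False using deg'[of x] x'F F(2) by (simp add: dg_def)
        qed
        obtain y' where y': "y' \<in> Y" "adj r y'" using one(2)[of r] r(1) by auto
        have rY: "r \<notin> Y" "x \<notin> Y" "x \<noteq> r" using nF XY x'F by auto
        have "cyclic (Y \<union> {r, x})"
          by (rule cyclic_two_edges[OF finXY(2) _ XY(3) conn_pair[OF rx] _ XY(5) _ sym[OF XY(6)] y'(1) _
                sym[OF y'(2)]]) (use rY in auto)
        moreover have "cyclic {x', p, q}"
          using cyclic_core[OF core_triangle] pq r(4) sym by auto
        moreover have "Y \<union> {r, x} \<subseteq> V" "{x', p, q} \<subseteq> V" using XY(1) F(2) r(1) x'(1) by auto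
        moreover have "(Y \<union> {r, x}) \<inter> {x', p, q} = {}"
          using nF XY(1,2) x'(1,2) r(2,3) x'F by auto
        ultimately have "two_cores V" using two_coresI by metis
        then show ?thesis using nt by simp
      qed
    qed
  qed
qed

section \<open>Triangle-free graphs, and the classification for minimum degree three\<close>
lemma cycle_list_chord:
  assumes "cycle_list (x # as @ y # bs)" "adj y x" "as \<noteq> []"
  shows "cycle_list (x # as @ [y])"
proof -
  have "successively adj ((x # as @ [y]) @ bs)" using assms(1) by (simp add: cycle_list_def)
  then have "successively adj (x # as @ [y])" unfolding successively_append_iff by simp
  moreover have "distinct (x # as @ [y])" using assms(1) by (auto simp: cycle_list_def)
  ultimately show ?thesis using assms(2,3) by (cases as) (simp_all add: cycle_list_def)
qed

lemma cycle_list_detour: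
  assumes "cycle_list (y # as @ z # bs)" "p \<notin> set (y # as @ z # bs)" "adj p y" "adj p z"
  shows "cycle_list (p # y # as @ [z])"
proof -
  have "successively adj ((y # as @ [z]) @ bs)" using assms(1) by (simp add: cycle_list_def)
  then have "successively adj (y # as @ [z])" unfolding successively_append_iff by simp
  moreover have "distinct (p # y # as @ [z])" using assms(1,2) by (auto simp: cycle_list_def)
  ultimately show ?thesis using assms(3) sym[OF assms(4)] by (simp add: cycle_list_def)
qed

text \<open>Let \<open>S\<close> be the vertex set of a shortest cycle. A vertex of degree at most one in the forest outside has
  two neighbours \<open>y\<close>, \<open>z\<close> in \<open>S\<close>, and with each of the two arcs between \<open>y\<close> and \<open>z\<close> it forms a cycle. Both
  of these are no shorter than \<open>S\<close>, so each arc has at most one inner vertex. There is a vertex outside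
  \<open>S\<close> because a shortest cycle has no chord.\<close>
lemma girth_le_4:
  assumes fin: "finite V" "V \<noteq> {}" and deg: "\<And>v. v \<in> V \<Longrightarrow> 3 \<le> dg V v" and nt: "\<not> two_cores V"
  obtains xs where "cycle_list xs" "set xs \<subseteq> V" "length xs \<le> 4"
proof -
  let ?P = "\<lambda>xs. cycle_list xs \<and> set xs \<subseteq> V"
  have "2 \<le> dg V v" if "v \<in> V" for v using deg[OF that] by simp
  then have "core V" using fin by (simp add: core_def)
  then obtain xs0 where "?P xs0" using core_cycle_list by metis
  then have "\<exists>xs. ?P xs \<and> (\<forall>ys. ?P ys \<longrightarrow> length xs \<le> length ys)" by (rule ex_has_least_nat)
  then obtain xs where xs: "cycle_list xs" "set xs \<subseteq> V"
    and min: "\<And>ys. cycle_list ys \<Longrightarrow> set ys \<subseteq> V \<Longrightarrow> length xs \<le> length ys"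
    by (elim exE conjE) metis
  define S where "S = set xs"
  define F where "F = V - S"
  have S: "finite S" "S \<subseteq> V" "core S" using xs cycle_list_core by (auto simp: S_def)
  have F: "finite F" "F \<inter> S = {}" "V = F \<union> S" using fin S(2) by (auto simp: F_def)
  have "F \<noteq> {}"
  proof
    assume "F = {}"
    then have V: "V = S" using F(3) by simp
    obtain x ys where x: "xs = x # ys" using xs(1) by (cases xs) (auto simp: cycle_list_def)
    have "x \<in> V" using x V by (simp add: S_def)
    have "\<not> nb V x \<subseteq> {hd ys, last ys}"
    proof
      assume "nb V x \<subseteq> {hd ys, last ys}"
      then have "dg V x \<le> card {hd ys, last ys}" unfolding dg_def by (intro card_mono) auto
      also have "\<dots> \<le> 2" by (simp add: card_insert_if)
      finally show False using deg[OF \<open>x \<in> V\<close>] by simp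
    qed
    then obtain y where y: "y \<in> V" "adj x y" "y \<noteq> hd ys" "y \<noteq> last ys" by (auto simp: nb_def)
    have "y \<noteq> x" using y(2) by auto
    then have "y \<in> set ys" using y(1) V x by (simp add: S_def)
    then obtain as bs where ys: "ys = as @ y # bs" by (meson split_list)
    have "as \<noteq> []" "bs \<noteq> []" using y(3,4) ys by auto
    have "cycle_list (x # as @ [y])"
      using cycle_list_chord[of x as y bs] xs(1) x ys sym[OF y(2)] \<open>as \<noteq> []\<close> by simp
    moreover have "set (x # as @ [y]) \<subseteq> V" using xs(2) x ys by auto
    ultimately have "length xs \<le> length (x # as @ [y])" by (rule min)
    then show False using x ys \<open>bs \<noteq> []\<close> by simp
  qed
  moreover have "\<not> cyclic F"
    using nt two_coresI[of F S V] cyclic_core[OF S(3)] F by auto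
  ultimately obtain p where p: "p \<in> F" "dg F p \<le> 1" using acyclic_low_vertex[OF F(1)] by metis
  have pV: "p \<in> V" using p F(3) by simp
  have "dg V p = dg F p + dg S p" using dg_Un[OF F(1) S(1) F(2)] F(3) by simp
  then have "2 \<le> dg S p" using deg[OF pV] p(2) by simp
  then obtain y z where yz: "y \<in> S" "z \<in> S" "y \<noteq> z" "adj p y" "adj p z" by (rule dg_ge2E)
  obtain ys where ys: "cycle_list (y # ys)" "set (y # ys) = set xs" "length (y # ys) = length xs"
    using cycle_list_rotate_to[OF xs(1)] yz(1) S_def by metis
  have "z \<in> set (y # ys)" using ys(2) yz(2) unfolding S_def by simp
  then have "z \<in> set ys" using yz(3) by simp
  then obtain as bs where s: "ys = as @ z # bs" by (meson split_list)
  have pn: "p \<notin> set (y # ys)" using p(1) ys(2) F_def S_def by auto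
  have sub: "set (y # as @ z # bs) \<subseteq> V" using ys(2) s xs(2) by auto
  have c1: "cycle_list (y # as @ z # bs)" using ys(1) s by simp
  then have c2: "cycle_list (z # bs @ y # as)" using cycle_list_rotate[of "y # as" "z # bs"] by simp
  have "cycle_list (p # y # as @ [z])"
    using cycle_list_detour[OF c1 _ yz(4,5)] pn s by simp
  then have "length xs \<le> length (p # y # as @ [z])"
    by (rule min) (use sub pV in auto)
  moreover have "cycle_list (p # z # bs @ [y])"
    using cycle_list_detour[OF c2 _ yz(5,4)] pn s by simp
  then have "length xs \<le> length (p # z # bs @ [y])"
    by (rule min) (use sub pV in auto)
  ultimately have "length xs \<le> 4" using ys(3) s by simp
  then show ?thesis using xs that by simp
qed

text \<open>If all vertices of \<open>X\<close> other than \<open>x\<close> had degree at least two, the degree sum of \<open>X\<close> would exceed the bound for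
  forests, as \<open>x\<close> has a neighbour in \<open>X\<close>.\<close>
lemma bridge_side_leaf:
  assumes "finite F" "\<not> cyclic F" "bridge_split F X Y x y" "2 \<le> card X"
  obtains p where "p \<in> X" "p \<noteq> x" "dg F p \<le> 1"
proof -
  have XY: "F = X \<union> Y" "x \<in> X" "conn X"
    and cross: "\<And>u w. u \<in> X \<Longrightarrow> w \<in> Y \<Longrightarrow> adj u w \<Longrightarrow> u = x \<and> w = y"
    using assms(3) by (auto simp: bridge_split_def)
  have fX: "finite X" using XY(1) assms(1) by simp
  have eq: "dg F p = dg X p" if "p \<in> X" "p \<noteq> x" for p
  proof -
    have "nb F p = nb X p" using cross[OF that(1)] that(2) XY(1) unfolding nb_def by blast
    then show ?thesis by (simp add: dg_def)
  qed
  have "X \<noteq> {x}" using assms(4) by auto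
  then have "\<exists>b\<in>X. adj x b" using XY(2,3) unfolding conn_def by (metis DiffD1 empty_subsetI insert_not_empty insert_subset singletonD)
  then have d1: "0 < dg X x" using dg_pos_iff[OF fX] by simp
  have "\<exists>p \<in> X - {x}. dg X p \<le> 1"
  proof (rule ccontr)
    assume n: "\<not> ?thesis"
    have "2 * card (X - {x}) \<le> (\<Sum>p\<in>X - {x}. dg X p)"
      using sum_bounded_below[of "X - {x}" 2 "dg X"] n by force
    moreover have "(\<Sum>p\<in>X. dg X p) = dg X x + (\<Sum>p\<in>X - {x}. dg X p)"
      using fX XY(2) by (rule sum.remove)
    moreover have "(\<Sum>p\<in>X. dg X p) + 2 \<le> 2 * card X"
      using forest_sum[OF fX] XY(1,2) cyclic_mono[of X F] assms(2) by auto
    moreover have "card X = Suc (card (X - {x}))" using fX XY(2) by (rule card.remove)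
    ultimately show False using d1 by simp
  qed
  then show ?thesis using eq that by auto
qed

text \<open>If all leaves of the star are joined to the opposite vertices \<open>c1\<close> and \<open>c3\<close>, then by triangle-freeness
  \<open>c2\<close> and \<open>c4\<close> have no possible neighbours but \<open>c1\<close>, \<open>c3\<close> and \<open>z\<close>; they play the same role as leaves.\<close>
lemma square_star:
  assumes deg: "\<And>v. v \<in> V \<Longrightarrow> 3 \<le> dg V v"
    and nt: "\<And>x y w. x \<in> V \<Longrightarrow> y \<in> V \<Longrightarrow> w \<in> V \<Longrightarrow> adj x y \<Longrightarrow> adj y w \<Longrightarrow> \<not> adj w x"
    and c: "adj c1 c2" "adj c2 c3" "adj c3 c4" "adj c4 c1" "c1 \<noteq> c3" "c2 \<noteq> c4"
    and V: "V = {c1, c2, c3, c4} \<union> insert z L" "z \<notin> {c1, c2, c3, c4}" "z \<notin> L"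
      "L \<inter> {c1, c2, c3, c4} = {}"
    and star: "\<And>l. l \<in> L \<Longrightarrow> adj l z" "\<And>l m. l \<in> L \<Longrightarrow> m \<in> L \<Longrightarrow> \<not> adj l m"
    and O: "\<And>l. l \<in> L \<Longrightarrow> adj l c1 \<and> adj l c3"
  shows "k3_at {c1, c3, z} V"
proof -
  have inV: "c1 \<in> V" "c2 \<in> V" "c3 \<in> V" "c4 \<in> V" "z \<in> V" "L \<subseteq> V" using V(1) by auto
  have n24: "\<not> adj c2 c4" using nt[of c1 c2 c4] inV c sym by auto
  have nL: "\<not> adj l c2" "\<not> adj l c4" if "l \<in> L" for l
    using nt[of c1 l c2] nt[of c1 l c4] O[OF that] inV c sym that by auto
  have out: "b = c2 \<or> b = c4 \<or> b \<in> L" if "b \<in> V - {c1, c3, z}" for b using that V(1) by auto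
  have ne: "card {c1, c3, z} = 3" using c(5) V(2) by auto
  have full: "adj b a" if b: "b = c2 \<or> b = c4" and a: "a \<in> {c1, c3, z}" for a b
  proof (rule nb_subset_full[of "{c1, c3, z}" V])
    show "nb V b \<subseteq> {c1, c3, z}"
    proof
      fix s assume "s \<in> nb V b"
      then have s: "s \<in> V" "adj b s" by (auto simp: nb_def)
      show "s \<in> {c1, c3, z}"
      proof (rule ccontr)
        assume "s \<notin> {c1, c3, z}"
        then have "s = c2 \<or> s = c4 \<or> s \<in> L" using out s(1) by auto
        then show False using s(2) b n24 nL sym by auto
      qed
    qed
    show "card {c1, c3, z} \<le> dg V b" using deg[of b] b inV ne by auto
  qed (use a in auto)
  show ?thesis unfolding k3_at_def
  proof (intro conjI ballI)
    show "{c1, c3, z} \<subseteq> V" using inV by auto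
    show "card {c1, c3, z} = 3" by (rule ne)
    show "adj a b" if "a \<in> {c1, c3, z}" "b \<in> V - {c1, c3, z}" for a b
    proof -
      have "adj b a" using out[OF that(2)] that(1) full[of b a] O[of b] star(1)[of b] by auto
      then show ?thesis by (rule sym)
    qed
    show "\<not> adj b b'" if "b \<in> V - {c1, c3, z}" "b' \<in> V - {c1, c3, z}" for b b'
      using out[OF that(1)] out[OF that(2)] n24 nL star(2) sym[of b b'] sym[of c2 c4] by auto
  qed
qed

text \<open>Deleting the 4-cycle leaves a forest \<open>F\<close>. By triangle-freeness a vertex has at most one
  neighbour in each pair of consecutive vertices of the 4-cycle, and a vertex with two neighbours on it is joined to
  an opposite pair. Hence every component of \<open>F\<close> has at least two edges to \<open>{c1, c2}\<close> and two to
  \<open>{c3, c4}\<close>, so there is only one component. A star is a \<open>K\<^sub>3\<^sub>,\<^sub>m\<close> or has two leaves joined to different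
  opposite pairs, and then a third leaf gives two 4-cycles.

  A bridge \<open>xy\<close> is impossible. Each side contains a leaf of \<open>F\<close>, here \<open>p\<close> and \<open>q\<close>, which has a neighbour
  in every pair of consecutive vertices. If further vertices of the two sides had different neighbours \<open>ci\<close>, \<open>cj\<close>
  on the 4-cycle, one could divide the latter into two consecutive pairs, one containing \<open>ci\<close> and the other
  \<open>cj\<close>, and each side would form a cycle with its pair. So all other vertices of \<open>F\<close> have at most one and, by
  counting, exactly one neighbour on the 4-cycle, the same one for all of them; together with \<open>x\<close> and \<open>y\<close>
  it is a triangle.\<close>
lemma square_structure:
  assumes fin: "finite V" and deg: "\<And>v. v \<in> V \<Longrightarrow> 3 \<le> dg V v" and ntc: "\<not> two_cores V"
    and nt: "\<And>x y w. x \<in> V \<Longrightarrow> y \<in> V \<Longrightarrow> w \<in> V \<Longrightarrow> adj x y \<Longrightarrow> adj y w \<Longrightarrow> \<not> adj w x"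
    and inV: "c1 \<in> V" "c2 \<in> V" "c3 \<in> V" "c4 \<in> V"
    and c: "adj c1 c2" "adj c2 c3" "adj c3 c4" "adj c4 c1" "c1 \<noteq> c3" "c2 \<noteq> c4"
  shows "\<exists>A. k3_at A V"
proof -
  define C where "C = {c1, c2, c3, c4}"
  define F where "F = V - C"
  have ne: "c1 \<noteq> c2" "c2 \<noteq> c3" "c3 \<noteq> c4" "c4 \<noteq> c1" using c by auto
  have C: "finite C" "C \<subseteq> V" "C = {c1, c2} \<union> {c3, c4}" using inV by (auto simp: C_def)
  have F: "finite F" "V = F \<union> C" "F \<inter> C = {}" using fin C(2) by (auto simp: F_def)
  have nF: "c1 \<notin> F" "c2 \<notin> F" "c3 \<notin> F" "c4 \<notin> F" by (auto simp: F_def C_def)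
  have "core C" using core_square[OF c] by (simp add: C_def)
  then have acF: "\<not> cyclic F" using ntc two_coresI[of F C V] cyclic_core[of C] F by auto
  have deg': "3 \<le> dg F v + dg C v" if "v \<in> V" for v
    using deg[OF that] dg_Un[OF F(1) C(1) F(3), of v] F(2) by simp
  have opp: "\<not> (adj v c1 \<and> adj v c2)" "\<not> (adj v c2 \<and> adj v c3)" "\<not> (adj v c3 \<and> adj v c4)"
    "\<not> (adj v c4 \<and> adj v c1)" if "v \<in> V" for v
    using nt[OF that inV(1,2)] nt[OF that inV(2,3)] nt[OF that inV(3,4)] nt[OF that inV(4,1)] c sym
    by metis+
  have dgC: "dg C v = dg {c1, c2} v + dg {c3, c4} v" for v
    unfolding C(3) using ne c(5,6) by (intro dg_Un) auto
  have le12: "dg {c1, c2} v \<le> 1" "dg {c3, c4} v \<le> 1" if "v \<in> V" for v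
    using opp[OF that] ne by (auto simp: dg_insert)
  have two: "adj v c1 \<and> adj v c3 \<or> adj v c2 \<and> adj v c4" if v: "v \<in> V" "2 \<le> dg C v" for v
    using v(2) opp[OF v(1)] by (elim dg_ge2E) (auto simp: C_def)
  have "F \<noteq> {}"
  proof
    assume "F = {}"
    then have "3 \<le> dg C c1" using deg'[OF inV(1)] by simp
    then show False using dgC[of c1] le12[OF inV(1)] by simp
  qed
  have cF: "conn F"
  proof (rule ccontr)
    assume "\<not> conn F"
    then obtain A B where AB: "A \<subseteq> F" "B \<subseteq> F" "A \<inter> B = {}" "A \<noteq> {}" "B \<noteq> {}" "conn A" "conn B"
      "\<forall>x \<in> A. \<forall>y \<in> F - A. \<not> adj x y" "\<forall>x \<in> B. \<forall>y \<in> F - B. \<not> adj x y"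
      using component_pair[OF F(1)] \<open>F \<noteq> {}\<close> by (metis empty_iff ex_in_conv)
    have cnt: "2 \<le> (\<Sum>x\<in>B. dg {c1, c2} x) \<and> 2 \<le> (\<Sum>x\<in>B. dg {c3, c4} x)"
      if B: "B \<subseteq> F" "B \<noteq> {}" "\<forall>x \<in> B. \<forall>y \<in> F - B. \<not> adj x y" for B
    proof -
      have fB: "finite B" using B(1) F(1) by (rule finite_subset)
      have "card B + 2 \<le> (\<Sum>x\<in>B. dg {} x) + (\<Sum>x\<in>B. dg C x)"
      proof (rule forest_boundary_count[OF fB B(2)])
        show "\<not> cyclic B" using acF cyclic_mono B(1) by auto
        show "3 \<le> dg B x + dg {} x + dg C x" if "x \<in> B" for x
          using deg'[of x] closed_dg[OF F(1) B(1,3) that] B(1) that F(2) by auto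
      qed
      then have "card B + 2 \<le> (\<Sum>x\<in>B. dg {c1, c2} x) + (\<Sum>x\<in>B. dg {c3, c4} x)"
        by (simp add: dgC sum.distrib)
      moreover have "x \<in> V" if "x \<in> B" for x using that B(1) F(2) by auto
      then have "(\<Sum>x\<in>B. dg {c1, c2} x) \<le> card B" "(\<Sum>x\<in>B. dg {c3, c4} x) \<le> card B"
        using sum_bounded_above[of B "dg {c1, c2}" 1] sum_bounded_above[of B "dg {c3, c4}" 1] le12
        by auto
      ultimately show ?thesis by simp
    qed
    have fAB: "finite A" "finite B" using finite_subset[OF AB(1) F(1)] finite_subset[OF AB(2) F(1)] .
    have "A \<inter> {c1, c2} = {}" "B \<inter> {c3, c4} = {}" using AB(1,2) nF by auto
    then have "cyclic (A \<union> {c1, c2})" "cyclic (B \<union> {c3, c4})"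
      using cyclic_edge_count[OF fAB(1) _ AB(6) conn_pair[OF c(1)]] cnt[OF AB(1,4,8)]
        cyclic_edge_count[OF fAB(2) _ AB(7) conn_pair[OF c(3)]] cnt[OF AB(2,5,9)] by auto
    moreover have "A \<union> {c1, c2} \<subseteq> V" "B \<union> {c3, c4} \<subseteq> V" using AB(1,2) F(2) inV by auto
    moreover have "(A \<union> {c1, c2}) \<inter> (B \<union> {c3, c4}) = {}" using AB(1-3) nF ne c(5,6) by auto
    ultimately have "two_cores V" by (rule two_coresI)
    then show False using ntc by simp
  qed
  consider z where "z \<in> F" "\<forall>l \<in> F - {z}. nb F l = {z}"
    | X Y x y where "bridge_split F X Y x y" "2 \<le> card X" "2 \<le> card Y"
    using star_or_bridge[OF F(1) acF cF \<open>F \<noteq> {}\<close>] by metis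
  then show ?thesis
  proof cases
    case 1
    define L where "L = F - {z}"
    have L: "V = {c1, c2, c3, c4} \<union> insert z L" "z \<notin> {c1, c2, c3, c4}" "z \<notin> L"
      "L \<inter> {c1, c2, c3, c4} = {}" "L \<subseteq> V" "z \<in> V"
      using 1(1) F(2) nF by (auto simp: L_def C_def)
    have star: "adj l z" "\<not> adj l m" if "l \<in> L" "m \<in> L" for l m
    proof -
      have "nb F l = {z}" "m \<in> F" "m \<noteq> z" using 1(2) that by (auto simp: L_def)
      then show "adj l z" "\<not> adj l m" by (auto simp: nb_def)
    qed
    have pair: "adj l c1 \<and> adj l c3 \<or> adj l c2 \<and> adj l c4" if "l \<in> L" for l
    proof -
      have "dg F l = 1" using 1(2) that by (simp add: L_def dg_def)
      moreover have lV: "l \<in> V" using L(5) that by auto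
      ultimately have "2 \<le> dg C l" using deg'[of l] by simp
      then show ?thesis using two lV by simp
    qed
    consider "\<forall>l \<in> L. adj l c1 \<and> adj l c3" | "\<forall>l \<in> L. adj l c2 \<and> adj l c4"
      | l1 l2 where "l1 \<in> L" "l2 \<in> L" "adj l1 c1" "adj l1 c3" "adj l2 c2" "adj l2 c4"
      using pair by metis
    then show ?thesis
    proof cases
      case 1
      have "k3_at {c1, c3, z} V"
        by (rule square_star[OF deg nt c L(1-4)]) (use star 1 in auto)
      then show ?thesis by auto
    next
      case 2
      have "k3_at {c2, c4, z} V"
        by (rule square_star[OF deg nt c(2-4,1) c(6) c(5)[THEN not_sym]])
          (use L star 2 in auto)
      then show ?thesis by auto
    next
      case 3
      have l12: "l1 \<in> V" "l2 \<in> V" "l1 \<noteq> l2" using 3 L(5) opp by auto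
      have nz: "\<not> adj z c1" "\<not> adj z c2" "\<not> adj z c3" "\<not> adj z c4"
        using nt[OF l12(1) L(6) inV(1)] nt[OF l12(2) L(6) inV(2)] nt[OF l12(1) L(6) inV(3)]
          nt[OF l12(2) L(6) inV(4)] 3 star(1) sym by metis+
      have "\<not> L \<subseteq> {l1, l2}"
      proof
        assume s: "L \<subseteq> {l1, l2}"
        have "nb V z \<subseteq> {l1, l2}"
        proof
          fix s assume "s \<in> nb V z"
          then have "s \<in> V" "adj z s" by (auto simp: nb_def)
          moreover from this have "s \<noteq> z" by auto
          ultimately have "s \<in> L" using L(1) nz by auto
          then show "s \<in> {l1, l2}" using s by auto
        qed
        then have "dg V z \<le> card {l1, l2}" unfolding dg_def by (intro card_mono) auto
        then show False using deg[OF L(6)] l12 by simp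
      qed
      then obtain l3 where l3: "l3 \<in> L" "l3 \<noteq> l1" "l3 \<noteq> l2" by auto
      have l3V: "l3 \<in> V" using l3 L(5) by auto
      have nl: "l \<noteq> c1" "l \<noteq> c2" "l \<noteq> c3" "l \<noteq> c4" "l \<noteq> z" if "l \<in> L" for l using that L(2-4) by auto
      note nls = nl[OF 3(1)] nl[OF 3(2)] nl[OF l3(1)]
      have nzc: "z \<noteq> c1" "z \<noteq> c2" "z \<noteq> c3" "z \<noteq> c4" using L(2) by auto
      have lz: "adj l1 z" "adj l2 z" "adj l3 z" using star(1) 3(1,2) l3(1) by auto
      have "two_cores V"
      proof (cases "adj l3 c1")
        case True
        have "core {l1, c1, l3, z}"
          by (rule core_square) (use 3(3) True lz l3 nzc sym in auto)
        moreover have "core {l2, c2, c3, c4}"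
          by (rule core_square) (use 3(5,6) c nls sym in auto)
        moreover have "{l1, c1, l3, z} \<inter> {l2, c2, c3, c4} = {}"
          using l3 l12 nls nzc ne c(5,6) by auto
        moreover have "{l1, c1, l3, z} \<subseteq> V" "{l2, c2, c3, c4} \<subseteq> V" using inV l12 L(6) l3V by auto
        ultimately show ?thesis using two_coresI cyclic_core by metis
      next
        case False
        then have l3c: "adj l3 c2" using pair[OF l3(1)] by auto
        have "core {l2, c2, l3, z}"
          by (rule core_square) (use 3(5) l3c lz l3 nzc sym in auto)
        moreover have "core {l1, c1, c4, c3}"
          by (rule core_square) (use 3(3,4) c nls sym in auto)
        moreover have "{l2, c2, l3, z} \<inter> {l1, c1, c4, c3} = {}"
          using l3 l12 nls nzc ne c(5,6) by auto
        moreover have "{l2, c2, l3, z} \<subseteq> V" "{l1, c1, c4, c3} \<subseteq> V" using inV l12 L(6) l3V by auto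
        ultimately show ?thesis using two_coresI cyclic_core by metis
      qed
      then show ?thesis using ntc by simp
    qed
  next
    case 2
    have XY: "F = X \<union> Y" "X \<inter> Y = {}" "conn X" "conn Y" "x \<in> X" "y \<in> Y" "adj x y"
      using 2(1) by (auto simp: bridge_split_def)
    have finXY: "finite X" "finite Y" using XY(1) F(1) by auto
    have subV: "X \<subseteq> V" "Y \<subseteq> V" using XY(1) F(2) by auto
    obtain p where p: "p \<in> X" "p \<noteq> x" "dg F p \<le> 1" using bridge_side_leaf[OF F(1) acF 2(1,2)] .
    obtain q where q: "q \<in> Y" "q \<noteq> y" "dg F q \<le> 1"
      using bridge_side_leaf[OF F(1) acF bridge_split_commute[OF 2(1)] 2(3)] .
    have pqV: "p \<in> V" "q \<in> V" using p q subV by auto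
    have pp: "adj p c1 \<and> adj p c3 \<or> adj p c2 \<and> adj p c4" using two[OF pqV(1)] deg'[OF pqV(1)] p(3) by simp
    have qq: "adj q c1 \<and> adj q c3 \<or> adj q c2 \<and> adj q c4" using two[OF pqV(2)] deg'[OF pqV(2)] q(3) by simp
    have cnt: "card (Z - {r}) \<le> (\<Sum>v\<in>Z - {r}. dg C v)"
      if bs: "bridge_split F Z W s t" and r: "r \<in> Z" for Z W s t r
    proof -
      have Z: "finite Z" "Z \<subseteq> V" using bs F(1,2) by (auto simp: bridge_split_def)
      have "card Z + 1 \<le> (\<Sum>v\<in>Z. dg C v)"
        by (rule bridge_side_count[OF F(1) acF bs]) (use deg' Z(2) in auto)
      also have "\<dots> = dg C r + (\<Sum>v\<in>Z - {r}. dg C v)" using Z(1) r by (rule sum.remove)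
      also have "dg C r \<le> 2" using dgC[of r] le12[of r] r Z(2) by fastforce
      finally show ?thesis using card.remove[OF Z(1) r] by simp
    qed
    have X: "card (X - {p}) \<le> (\<Sum>v\<in>X - {p}. dg C v)" using cnt[OF 2(1) p(1)] .
    have Y: "card (Y - {q}) \<le> (\<Sum>v\<in>Y - {q}. dg C v)" using cnt[OF bridge_split_commute[OF 2(1)] q(1)] .
    have same: "ci = cj"
      if ci: "x' \<in> X - {p}" "ci \<in> C" "adj x' ci" and cj: "y' \<in> Y - {q}" "cj \<in> C" "adj y' cj"
      for x' ci y' cj
    proof (rule ccontr)
      assume "ci \<noteq> cj"
      then have parts: "ci \<in> {c1, c2} \<and> cj \<in> {c3, c4} \<or> ci \<in> {c3, c4} \<and> cj \<in> {c1, c2} \<or>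
         ci \<in> {c2, c3} \<and> cj \<in> {c4, c1} \<or> ci \<in> {c4, c1} \<and> cj \<in> {c2, c3}"
        using ci(2) cj(2) by (auto simp: C_def)
      have no: False
        if st: "adj s t" "adj s' t'" "{s, t} \<inter> {s', t'} = {}" "{s, t, s', t'} \<subseteq> C"
          "ci \<in> {s, t}" "cj \<in> {s', t'}" "adj p s \<or> adj p t" "adj q s' \<or> adj q t'" for s t s' t'
      proof -
        obtain d e where de: "d \<in> {s, t}" "adj p d" "e \<in> {s', t'}" "adj q e" using st(7,8) by auto
        have disj: "X \<inter> {s, t} = {}" "Y \<inter> {s', t'} = {}" "X \<inter> {s', t'} = {}" "Y \<inter> {s, t} = {}"
          using XY(1) F(3) st(4) by auto
        have "cyclic (X \<union> {s, t})"
          by (rule cyclic_two_edges[OF finXY(1) _ XY(3) conn_pair[OF st(1)] disj(1) p(1) de(1,2) _ st(5) ci(3)])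
            (use ci(1) in auto)
        moreover have "cyclic (Y \<union> {s', t'})"
          by (rule cyclic_two_edges[OF finXY(2) _ XY(4) conn_pair[OF st(2)] disj(2) q(1) de(3,4) _ st(6) cj(3)])
            (use cj(1) in auto)
        moreover have "X \<union> {s, t} \<subseteq> V" "Y \<union> {s', t'} \<subseteq> V" using subV st(4) C(2) by auto
        moreover have "(X \<union> {s, t}) \<inter> (Y \<union> {s', t'}) = {}" using disj XY(2) st(3) by auto
        ultimately have "two_cores V" by (rule two_coresI)
        then show False using ntc by simp
      qed
      show False using parts
      proof (elim disjE conjE)
        assume "ci \<in> {c1, c2}" "cj \<in> {c3, c4}"
        then show False
          using no[OF c(1,3)] pp qq ne c(5,6) by (auto simp: C_def)
      next
        assume "ci \<in> {c3, c4}" "cj \<in> {c1, c2}"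
        then show False using no[OF c(3,1)] pp qq ne c(5,6) by (auto simp: C_def)
      next
        assume "ci \<in> {c2, c3}" "cj \<in> {c4, c1}"
        then show False using no[OF c(2,4)] pp qq ne c(5,6) by (auto simp: C_def)
      next
        assume "ci \<in> {c4, c1}" "cj \<in> {c2, c3}"
        then show False using no[OF c(4,2)] pp qq ne c(5,6) by (auto simp: C_def)
      qed
    qed
    have ex: "\<exists>v \<in> Z. \<exists>d \<in> C. adj v d" if "s \<in> Z" "finite Z" "card Z \<le> (\<Sum>v\<in>Z. dg C v)" for s Z
    proof (rule ccontr)
      assume "\<not> ?thesis"
      then have "dg C v = 0" if "v \<in> Z" for v using dg_pos_iff[OF C(1), of v] that by auto
      then have "card Z = 0" using that(3) by simp
      then show False using that(1,2) by auto
    qed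
    have xX: "x \<in> X - {p}" "y \<in> Y - {q}" using XY(5,6) p(2) q(2) by auto
    obtain x0 d where x0: "x0 \<in> X - {p}" "d \<in> C" "adj x0 d" using ex[OF xX(1) _ X] finXY by auto
    obtain y0 e where y0: "y0 \<in> Y - {q}" "e \<in> C" "adj y0 e" using ex[OF xX(2) _ Y] finXY by auto
    have de: "d = e" using same[OF x0 y0] .
    have all: "adj d s"
      if Z: "finite Z" "s \<in> Z" "card Z \<le> (\<Sum>v\<in>Z. dg C v)"
        "\<And>v w. v \<in> Z \<Longrightarrow> w \<in> C \<Longrightarrow> adj v w \<Longrightarrow> w = d" for Z s
    proof -
      have "dg C v = dg {d} v" if "v \<in> Z" for v
      proof -
        have "nb C v = nb {d} v" using Z(4)[OF that] x0(2) by (auto simp: nb_def)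
        then show ?thesis by (simp add: dg_def)
      qed
      then have "card Z \<le> (\<Sum>v\<in>Z. dg {d} v)" using Z(3) by simp
      also have "\<dots> = dg Z d" using sum_dg_swap[OF Z(1), of "{d}"] by simp
      finally show ?thesis using dg_full[OF Z(1) _ Z(2)] by simp
    qed
    have "adj d x"
    proof (rule all[OF _ xX(1) X])
      show "w = d" if "v \<in> X - {p}" "w \<in> C" "adj v w" for v w using same[OF that y0] de by simp
    qed (use finXY in simp)
    moreover have "adj d y"
    proof (rule all[OF _ xX(2) Y])
      show "w = d" if "v \<in> Y - {q}" "w \<in> C" "adj v w" for v w using same[OF x0 that] by simp
    qed (use finXY in simp)
    moreover have "d \<in> V" "x \<in> V" "y \<in> V" using x0(2) C(2) subV XY(5,6) by auto
    ultimately have False using nt[of d x y] XY(7) sym by auto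
    then show ?thesis by simp
  qed
qed

theorem lovasz_min_degree_3:
  assumes fin: "finite V" "V \<noteq> {}" and deg: "\<And>v. v \<in> V \<Longrightarrow> 3 \<le> dg V v" and ntc: "\<not> two_cores V"
  shows "lovasz_type V"
proof (cases "\<exists>x \<in> V. \<exists>y \<in> V. \<exists>w \<in> V. adj x y \<and> adj y w \<and> adj w x")
  case True
  then show ?thesis using triangle_structure[OF fin(1) deg ntc] by metis
next
  case False
  obtain xs where xs: "cycle_list xs" "set xs \<subseteq> V" "length xs \<le> 4"
    using girth_le_4[OF fin deg ntc] .
  obtain c1 c2 c3 ys where ys: "xs = c1 # c2 # c3 # ys"
    using xs(1) by (auto simp: cycle_list_def numeral_3_eq_3 Suc_le_length_iff)
  have "ys \<noteq> []" using False xs ys by (auto simp: cycle_list_def)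
  then obtain c4 where "ys = [c4]" using xs(3) ys by (cases ys) auto
  then have c: "xs = [c1, c2, c3, c4]" using ys by simp
  have c4: "adj c1 c2" "adj c2 c3" "adj c3 c4" "adj c4 c1" "c1 \<noteq> c3" "c2 \<noteq> c4"
    using xs(1) unfolding c by (auto simp: cycle_list_def)
  have inV: "c1 \<in> V" "c2 \<in> V" "c3 \<in> V" "c4 \<in> V" using xs(2) unfolding c by auto
  have tf: "\<not> adj w x" if "x \<in> V" "y \<in> V" "w \<in> V" "adj x y" "adj y w" for x y w
    using False that by metis
  have "\<exists>A. k3_at A V" by (rule square_structure[OF fin(1) deg ntc tf inV c4])
  then show ?thesis by (simp add: lovasz_type_def)
qed

text \<open>A wheel has at least three vertices of degree three. In a \<open>K\<^sub>3\<^sub>,\<^sub>m\<close> the vertices of the second class have degree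
  three and are pairwise not adjacent. Exceptional vertices \<open>x\<close>, \<open>y\<close> that are equal or adjacent
  therefore leave room for a second class of at most one vertex, and four vertices are too few for degree four.\<close>
lemma k5_of_degree_4:
  assumes fin: "finite V" "V \<noteq> {}" and deg: "\<And>v. v \<in> V \<Longrightarrow> 3 \<le> dg V v"
    and deg4: "\<And>v. v \<in> V - {x, y} \<Longrightarrow> 4 \<le> dg V v" and xy: "x = y \<or> adj x y"
    and ntc: "\<not> two_cores V"
  shows "k5 V"
proof -
  have no_wheel: False if w: "wheel_at h V" for h
  proof -
    obtain xs where xs: "cycle_list xs" "h \<notin> set xs" "V = insert h (set xs)"
      "\<forall>v \<in> set xs. adj h v \<and> dg (set xs) v = 2" using w unfolding wheel_at_def by metis
    have "v \<in> {x, y}" if v: "v \<in> set xs" for v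
    proof (rule ccontr)
      assume "v \<notin> {x, y}"
      then have "4 \<le> dg V v" using deg4 xs(3) v by auto
      moreover have "dg V v = 3" using xs v sym by (simp add: dg_insert)
      ultimately show False by simp
    qed
    then have "set xs \<subseteq> {x, y}" by auto
    then have "card (set xs) \<le> card {x, y}" by (intro card_mono) auto
    also have "\<dots> \<le> 2" by (simp add: card_insert_if)
    finally show False using xs(1) by (auto simp: cycle_list_def distinct_card)
  qed
  have no_k3: False if k: "k3_at A V" for A
  proof -
    have A: "A \<subseteq> V" "card A = 3" "\<And>b b'. b \<in> V - A \<Longrightarrow> b' \<in> V - A \<Longrightarrow> \<not> adj b b'"
      using k by (auto simp: k3_at_def)
    have finA: "finite A" using A(1) fin(1) by (rule finite_subset)
    have "b \<in> {x, y}" if b: "b \<in> V - A" for b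
    proof (rule ccontr)
      assume "b \<notin> {x, y}"
      then have "4 \<le> dg V b" using deg4 b by auto
      moreover have "nb V b \<subseteq> A" using A(3)[OF b] by (auto simp: nb_def)
      then have "dg V b \<le> 3" using card_mono[OF finA] A(2) by (simp add: dg_def)
      ultimately show False by simp
    qed
    then have sub: "V - A \<subseteq> {x, y}" by auto
    have "card (V - A) \<le> Suc 0"
    proof -
      have "b = b'" if "b \<in> V - A" "b' \<in> V - A" for b b'
        using that sub A(3)[OF that] A(3)[OF that(2,1)] xy by auto
      then show ?thesis using fin(1) by (simp add: card_le_Suc0_iff_eq)
    qed
    then have V4: "card V \<le> 4" using A(1,2) fin(1) finA by (simp add: card_Diff_subset)
    obtain v0 where "v0 \<in> V" using fin(2) by auto
    then have "3 < card V" using deg[of v0] dg_less_card[OF fin(1)] by force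
    moreover have "card {x, y} \<le> 2" by (simp add: card_insert_if)
    ultimately have "\<not> V \<subseteq> {x, y}" using card_mono[of "{x, y}" V] by auto
    then obtain v where v: "v \<in> V - {x, y}" by auto
    then have "4 \<le> dg V v" by (rule deg4)
    then show False using dg_less_card[OF fin(1), of v] V4 v by simp
  qed
  show ?thesis using lovasz_min_degree_3[OF fin deg ntc] no_wheel no_k3 by (auto simp: lovasz_type_def)
qed

end

section \<open>From relations to multigraphs\<close>
lemma path_edges_simps [simp]:
  "path_edges [] = {#}" "path_edges [x] = {#}"
  "path_edges (x # y # zs) = add_mset {x, y} (path_edges (y # zs))"
  by (auto simp: path_edges_def)

lemma path_edges_append: "path_edges (xs @ y # ys) = path_edges (xs @ [y]) + path_edges (y # ys)"
proof (induction xs)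
  case (Cons x xs)
  then show ?case by (cases xs) auto
qed auto

lemma path_edges_snoc: "xs \<noteq> [] \<Longrightarrow> path_edges (xs @ [y]) = add_mset {last xs, y} (path_edges xs)"
proof (induction xs)
  case (Cons x xs)
  then show ?case by (cases xs) auto
qed auto

lemma cycle_edges_snoc: "xs \<noteq> [] \<Longrightarrow> cycle_edges xs = add_mset {last xs, hd xs} (path_edges xs)"
  by (simp add: cycle_edges_def path_edges_snoc)

lemma cycle_edges_rotate: "cycle_edges (as @ v # bs) = cycle_edges (v # bs @ as)"
proof (cases as)
  case (Cons a as')
  have "cycle_edges (as @ v # bs) = path_edges (as @ [v]) + path_edges (v # bs @ [a])"
    using path_edges_append[of as v "bs @ [a]"] by (simp add: cycle_edges_def Cons)
  moreover have "cycle_edges (v # bs @ as) = path_edges (v # bs @ [a]) + path_edges (a # as' @ [v])"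
    using path_edges_append[of "v # bs" a "as' @ [v]"] by (simp add: cycle_edges_def Cons)
  ultimately show ?thesis by (simp add: Cons)
qed simp

lemma path_edges_subset: "e \<in># path_edges xs \<Longrightarrow> e \<subseteq> set xs"
proof (induction xs rule: induct_list012)
  case (3 x y zs)
  then show ?case by auto
qed auto

lemma path_edges_count: "distinct xs \<Longrightarrow> count (path_edges xs) e \<le> 1"
proof (induction xs rule: induct_list012)
  case (3 x y zs)
  then have "{x, y} \<notin># path_edges (y # zs)" using path_edges_subset by fastforce
  then show ?case using 3 by (auto simp: not_in_iff)
qed auto

lemma cycle_edges_count:
  assumes "3 \<le> length xs" "distinct xs"
  shows "count (cycle_edges xs) e \<le> 1"
proof -
  obtain x y zs where xs: "xs = x # y # zs" "zs \<noteq> []"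
    using assms(1) by (auto simp: numeral_3_eq_3 Suc_le_length_iff)
  have "last xs \<in> set zs" "hd xs = x" using xs by auto
  then have "{last xs, hd xs} \<notin># path_edges xs"
    using assms(2) xs path_edges_subset[of "{last xs, hd xs}" "y # zs"]
    by (auto simp: doubleton_eq_iff)
  then show ?thesis
    using path_edges_count[OF assms(2), of e] xs by (auto simp: cycle_edges_snoc not_in_iff)
qed

context rel_graph begin

definition edge_set :: "'a set \<Rightarrow> 'a set set" where
  "edge_set S = {{x, y} |x y. x \<in> S \<and> y \<in> S \<and> adj x y}"

definition graph_on :: "'a set \<Rightarrow> 'a multigraph" where
  "graph_on S = \<lparr>verts = S, edges = mset_set (edge_set S)\<rparr>"

text \<open>The new edge is parallel to an existing one if \<open>x\<close> and \<open>y\<close> are already adjacent. This is the common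
  form of all graphs that result from suppressing vertices of degree two.\<close>
definition plus_edge :: "'a set \<Rightarrow> 'a \<Rightarrow> 'a \<Rightarrow> 'a multigraph" where
  "plus_edge S x y = \<lparr>verts = S, edges = add_mset {x, y} (mset_set (edge_set S))\<rparr>"

lemma graph_on_sel [simp]:
  "verts (graph_on S) = S" "edges (graph_on S) = mset_set (edge_set S)"
  "verts (plus_edge S x y) = S" "edges (plus_edge S x y) = add_mset {x, y} (mset_set (edge_set S))"
  by (simp_all add: graph_on_def plus_edge_def)

lemma finite_edge_set [simp]: "finite S \<Longrightarrow> finite (edge_set S)"
  by (rule finite_subset[of _ "Pow S"]) (auto simp: edge_set_def)

lemma edge_set_card: "e \<in> edge_set S \<Longrightarrow> e \<subseteq> S \<and> card e = 2"
  by (auto simp: edge_set_def card_insert_if)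

lemma in_edge_set: "{x, y} \<in> edge_set S \<longleftrightarrow> x \<in> S \<and> y \<in> S \<and> adj x y"
  using sym by (auto simp: edge_set_def doubleton_eq_iff)

lemma simple_graph_on: "finite S \<Longrightarrow> simple_graph (graph_on S)"
  using edge_set_card[of _ S] by (simp add: simple_graph_def multigraph_def count_mset_set')

lemma multigraph_plus_edge:
  "finite S \<Longrightarrow> x \<in> S \<Longrightarrow> y \<in> S \<Longrightarrow> x \<noteq> y \<Longrightarrow> multigraph (plus_edge S x y)"
  using edge_set_card[of _ S] by (simp add: multigraph_def)

lemma edge_set_insert:
  assumes "w \<notin> S" "finite S"
  shows "mset_set (edge_set (insert w S)) = mset_set (edge_set S) + image_mset (\<lambda>y. {w, y}) (mset_set (nb S w))"
proof -
  have eq: "edge_set (insert w S) = edge_set S \<union> (\<lambda>y. {w, y}) ` nb S w"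
  proof (rule set_eqI)
    fix e
    show "e \<in> edge_set (insert w S) \<longleftrightarrow> e \<in> edge_set S \<union> (\<lambda>y. {w, y}) ` nb S w"
    proof
      assume "e \<in> edge_set (insert w S)"
      then obtain a b where "e = {a, b}" "a \<in> insert w S" "b \<in> insert w S" "adj a b"
        by (auto simp: edge_set_def)
      then consider "e = {w, b}" "b \<in> nb S w" | "e = {w, a}" "a \<in> nb S w" | "e \<in> edge_set S"
        using sym[of a b] by (auto simp: in_edge_set nb_def)
      then show "e \<in> edge_set S \<union> (\<lambda>y. {w, y}) ` nb S w" by cases auto
    qed (auto simp: edge_set_def nb_def)
  qed
  have "edge_set S \<inter> (\<lambda>y. {w, y}) ` nb S w = {}" using assms edge_set_card by fastforce
  moreover have "inj_on (\<lambda>y. {w, y}) (nb S w)" by (auto simp: inj_on_def doubleton_eq_iff)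
  ultimately show ?thesis
    unfolding eq using assms(2) by (simp add: mset_set_Union image_mset_mset_set)
qed

lemma complete_graph_on:
  assumes "k5 S"
  shows "complete_graph 5 (graph_on S)"
proof -
  have "finite S" using assms card.infinite by (fastforce simp: k5_def)
  moreover have "edge_set S = {e. e \<subseteq> S \<and> card e = 2}"
    using assms edge_set_card by (auto simp: k5_def card_2_iff in_edge_set)
  ultimately show ?thesis using assms by (simp add: complete_graph_def k5_def)
qed

text \<open>The two neighbours of \<open>x\<close> on the cycle are distinct, hence they are all neighbours of \<open>x\<close> in a 2-regular
  graph. Rotating the cycle until \<open>x\<close> is the first vertex makes them visible as second and last vertex.\<close>
lemma cycle_list_edges:
  assumes xs: "cycle_list xs" and two: "\<And>x. x \<in> set xs \<Longrightarrow> dg (set xs) x = 2"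
  shows "mset_set (edge_set (set xs)) = cycle_edges xs"
proof -
  have sub: "set_mset (cycle_edges xs) \<subseteq> edge_set (set xs)" if "cycle_list xs" for xs
  proof -
    have p: "set_mset (path_edges ys) \<subseteq> edge_set (set ys)" if "successively adj ys" for ys
      using that
    proof (induction ys rule: induct_list012)
      case (3 x y zs)
      have "edge_set (set (y # zs)) \<subseteq> edge_set (set (x # y # zs))" by (auto simp: edge_set_def)
      then show ?case using 3 by (auto simp: in_edge_set)
    qed auto
    have "xs \<noteq> []" using that by (auto simp: cycle_list_def)
    then show ?thesis
      using p[of xs] that by (auto simp: cycle_edges_snoc in_edge_set cycle_list_def)
  qed
  have "e \<in># cycle_edges xs" if e: "e \<in> edge_set (set xs)" for e
  proof -
    obtain x y where xy: "e = {x, y}" "x \<in> set xs" "y \<in> set xs" "adj x y"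
      using e by (auto simp: edge_set_def)
    obtain as bs where s: "xs = as @ x # bs" using xy(2) by (meson split_list)
    have cl: "cycle_list (x # bs @ as)" using xs cycle_list_rotate[of as "x # bs"] s by simp
    define ys where "ys = bs @ as"
    have setxs: "set xs = insert x (set ys)" using s by (auto simp: ys_def)
    note n = cycle_list_neighbours[OF cl[folded ys_def]]
    have "{hd ys, last ys} = nb (set xs) x"
      using n two[OF xy(2)] setxs
      by (intro card_seteq) (auto simp: nb_def dg_def)
    then have "y = hd ys \<or> y = last ys" using xy by (auto simp: nb_def)
    moreover have "ys \<noteq> []" using n(3) by auto
    then have "{x, hd ys} \<in># cycle_edges (x # ys)" "{x, last ys} \<in># cycle_edges (x # ys)"
      by (cases ys; auto simp: cycle_edges_snoc insert_commute)+
    ultimately show ?thesis using xy(1) cycle_edges_rotate[of as x bs] s by (auto simp: ys_def)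
  qed
  then have eq: "set_mset (cycle_edges xs) = edge_set (set xs)" using sub[OF xs] by auto
  show ?thesis
  proof (rule multiset_eqI)
    fix e
    have "count (cycle_edges xs) e \<le> 1"
      using cycle_edges_count xs by (auto simp: cycle_list_def)
    then show "count (mset_set (edge_set (set xs))) e = count (cycle_edges xs) e"
      using eq by (auto simp: count_mset_set' not_in_iff[symmetric] Suc_le_eq le_less)
  qed
qed

text \<open>The multiset \<open>D\<close> of additional parallel edges allows both the simple wheel and the one with a double
  spoke to be treated at once; the same device is used for type (3).\<close>
lemma wheel_type2:
  assumes w: "wheel_at h V" and fin: "finite V" and H: "multigraph H" "verts H = V"
    "edges H = mset_set (edge_set V) + D" and D: "\<And>e. e \<in># D \<Longrightarrow> h \<in> e"
  shows "type2 H"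
proof -
  obtain xs where xs: "cycle_list xs" "h \<notin> set xs" "V = insert h (set xs)"
    "\<forall>x \<in> set xs. adj h x \<and> dg (set xs) x = 2" using w unfolding wheel_at_def by metis
  have "filter_mset (\<lambda>e. h \<notin> e) D = {#}" using D by simp
  moreover have "{e \<in> edge_set V. h \<notin> e} = edge_set (set xs)"
    using xs(2) unfolding xs(3) by (auto simp: edge_set_def)
  then have "filter_mset (\<lambda>e. h \<notin> e) (mset_set (edge_set V)) = cycle_edges xs"
    using cycle_list_edges[OF xs(1)] xs(4) fin by simp
  ultimately have "{#e \<in># edges H. h \<notin> e#} = cycle_edges xs" using H(3) by simp
  moreover have "\<forall>x \<in> set xs. {h, x} \<in># edges H"
    using xs(3,4) fin unfolding H(3) by (auto simp: in_edge_set)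
  moreover have "3 \<le> length xs" "distinct xs" using xs(1) by (auto simp: cycle_list_def)
  ultimately show ?thesis using H(1,2) xs(2,3) unfolding type2_def by metis
qed

lemma k3_type3:
  assumes k: "k3_at A V" and fin: "finite V" and H: "multigraph H" "verts H = V"
    "edges H = mset_set (edge_set V) + D" and D: "\<And>e. e \<in># D \<Longrightarrow> e \<subseteq> A"
  shows "type3 H"
proof -
  have "filter_mset (\<lambda>e. \<not> e \<subseteq> A) D = {#}" using D by simp
  moreover have "{e \<in> edge_set V. \<not> e \<subseteq> A} = {{a, b} |a b. a \<in> A \<and> b \<in> V - A}"
  proof (intro set_eqI iffI)
    fix e assume "e \<in> {e \<in> edge_set V. \<not> e \<subseteq> A}"
    then obtain x y where e: "e = {x, y}" "x \<in> V" "y \<in> V" "adj x y" "\<not> {x, y} \<subseteq> A"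
      by (auto simp: edge_set_def)
    moreover have "x \<in> A \<or> y \<in> A" using k e by (auto simp: k3_at_def)
    ultimately show "e \<in> {{a, b} |a b. a \<in> A \<and> b \<in> V - A}" by (auto simp: insert_commute)
  next
    fix e assume "e \<in> {{a, b} |a b. a \<in> A \<and> b \<in> V - A}"
    then show "e \<in> {e \<in> edge_set V. \<not> e \<subseteq> A}" using k by (auto simp: k3_at_def in_edge_set)
  qed
  ultimately
  have "{#e \<in># edges H. \<not> e \<subseteq> A#} = mset_set {{a, b} |a b. a \<in> A \<and> b \<in> V - A}"
    using H(3) fin by simp
  moreover have "A \<subseteq> V" "card A = 3" using k by (auto simp: k3_at_def)
  ultimately show ?thesis unfolding type3_def H(2) using H(1) by (intro conjI exI[of _ A])
qed

lemma lovasz_type_graph_on: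
  assumes "lovasz_type V" "finite V"
  shows "type1 (graph_on V) \<or> type2 (graph_on V) \<or> type3 (graph_on V)"
proof -
  have m: "multigraph (graph_on V)" using simple_graph_on[OF assms(2)] by (simp add: simple_graph_def)
  show ?thesis
    using assms(1) complete_graph_on wheel_type2[OF _ assms(2) m, of _ "{#}"]
      k3_type3[OF _ assms(2) m, of _ "{#}"]
    by (auto simp: lovasz_type_def type1_def)
qed

lemma leaf_added_graph_on:
  assumes "l \<notin> S" "finite S" "nb S l = {v}"
  shows "leaf_added (graph_on S) v l (graph_on (insert l S))"
proof -
  have "v \<in> S" using assms(3) nb_subset by blast
  then show ?thesis using assms edge_set_insert[OF assms(1,2)]
    by (simp add: leaf_added_def graph_on_def insert_commute)
qed

lemma subdivided_0:
  assumes "{u, v} \<in># edges H"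
  shows "subdivided H u v 0 H"
  using assms by (simp add: subdivided_def)

lemma subdivided_once:
  assumes "w \<notin> S" "finite S" "nb S w = {x, y}" "x \<noteq> y"
  shows "subdivided (plus_edge S x y) x y 1 (graph_on (insert w S))"
  unfolding subdivided_def
proof (intro conjI exI[of _ "[w]"])
  show "graph_on (insert w S) = \<lparr>verts = verts (plus_edge S x y) \<union> set [w],
      edges = edges (plus_edge S x y) - {#{x, y}#} + path_edges (x # [w] @ [y])\<rparr>"
    using assms(4) edge_set_insert[OF assms(1,2)] unfolding assms(3)
    by (simp add: graph_on_def insert_commute)
qed (use assms in auto)

lemma subdivided_twice:
  assumes "w \<notin> S" "w' \<notin> S" "finite S" "nb S w = {x}" "nb S w' = {y}" "adj w w'"
  shows "subdivided (plus_edge S x y) x y 2 (graph_on (insert w' (insert w S)))"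
  unfolding subdivided_def
proof (intro conjI exI[of _ "[w, w']"])
  have ne: "w \<noteq> w'" using assms(6) by auto
  have y: "y \<in> S" using assms(5) nb_subset by blast
  have "nb (insert w S) w' = {w, y}" using assms(5) sym[OF assms(6)] by (auto simp: nb_def)
  moreover have "w \<noteq> y" using y assms(1) by auto
  ultimately show "graph_on (insert w' (insert w S)) = \<lparr>verts = verts (plus_edge S x y) \<union> set [w, w'],
      edges = edges (plus_edge S x y) - {#{x, y}#} + path_edges (x # [w, w'] @ [y])\<rparr>"
    using edge_set_insert[OF assms(1,3)] edge_set_insert[of w' "insert w S"] assms(2-4) ne
    by (simp add: graph_on_def insert_commute)
qed (use assms in auto)

section \<open>Suppressing vertices of degree two\<close>
definition added :: "'a \<Rightarrow> 'a \<Rightarrow> 'a \<Rightarrow> 'a \<Rightarrow> bool" where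
  "added x y a b \<longleftrightarrow> adj a b \<or> {a, b} = {x, y}"

lemma rel_graph_added: "x \<noteq> y \<Longrightarrow> rel_graph (added x y)"
  using sym by unfold_locales (auto simp: added_def insert_commute)

lemma graph_on_added:
  assumes "x \<in> S" "y \<in> S" "x \<noteq> y" "\<not> adj x y" "finite S"
  shows "rel_graph.graph_on (added x y) S = plus_edge S x y"
proof -
  interpret A: rel_graph "added x y" using assms(3) by (rule rel_graph_added)
  have "A.edge_set S = insert {x, y} (edge_set S)"
    using assms(1,2) by (auto simp: A.edge_set_def edge_set_def added_def)
  moreover have "{x, y} \<notin> edge_set S" using assms(4) by (simp add: in_edge_set)
  ultimately show ?thesis using assms(5) by (simp add: A.graph_on_def plus_edge_def)
qed

text \<open>Replacing a path from \<open>x\<close> to \<open>y\<close> with interior \<open>W\<close> by an edge keeps all degrees and creates no two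
  disjoint cycles. A core of the new graph that contains both \<open>x\<close> and \<open>y\<close> becomes a core of the old one
  when \<open>W\<close> is added to it, and at most one of two disjoint cores does.\<close>
lemma suppress:
  assumes fin: "finite S" "finite W" and d: "S \<inter> W = {}" and xy: "x \<in> S" "y \<in> S" "x \<noteq> y" "\<not> adj x y"
    and zero: "\<And>v. v \<in> S - {x, y} \<Longrightarrow> dg W v = 0" and one: "dg W x = 1" "dg W y = 1"
    and two: "\<And>w. w \<in> W \<Longrightarrow> 2 \<le> dg (W \<union> {x, y}) w"
  shows "v \<in> S \<Longrightarrow> rel_graph.dg (added x y) S v = dg (S \<union> W) v"
    and "rel_graph.two_cores (added x y) S \<Longrightarrow> two_cores (S \<union> W)"
proof -
  interpret A: rel_graph "added x y" using xy(3) by (rule rel_graph_added)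
  have nx: "A.nb T x = insert y (nb T x)" if "y \<in> T" for T
    using that xy by (auto simp: A.nb_def nb_def added_def doubleton_eq_iff)
  have ny: "A.nb T y = insert x (nb T y)" if "x \<in> T" for T
    using that xy by (auto simp: A.nb_def nb_def added_def doubleton_eq_iff)
  have n: "A.nb T v = nb T v" if "v \<notin> {x, y} \<or> \<not> {x, y} \<subseteq> T" "v \<in> T" for T v
    using that by (auto simp: A.nb_def nb_def added_def doubleton_eq_iff)
  have nn: "y \<notin> nb T x" "x \<notin> nb T y" for T using xy(4) sym by (auto simp: nb_def)
  have dg: "A.dg T v = dg T v + dg W v" if T: "{x, y} \<subseteq> T" "T \<subseteq> S" "v \<in> T" for T v
  proof -
    have "finite T" using T(2) fin(1) by (rule finite_subset)
    consider "v = x" | "v = y" | "v \<in> S - {x, y}" using T by auto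
    then show ?thesis
    proof cases
      case 1
      then show ?thesis using nx[of T] T nn one \<open>finite T\<close> by (simp add: A.dg_def dg_def)
    next
      case 2
      then show ?thesis using ny[of T] T nn one \<open>finite T\<close> by (simp add: A.dg_def dg_def)
    next
      case 3
      then show ?thesis using n[of v T] T(3) zero[OF 3] by (simp add: A.dg_def dg_def)
    qed
  qed
  show "A.dg S v = dg (S \<union> W) v" if "v \<in> S" for v
    using dg[OF _ _ that] xy dg_Un[OF fin d, of v] by simp
  have lift: "cyclic (T \<union> W)" "\<not> {x, y} \<subseteq> T \<Longrightarrow> cyclic T" if T: "A.core T" "T \<subseteq> S" for T
  proof -
    have fT: "finite T" using T(2) fin(1) by (rule finite_subset)
    have T2: "2 \<le> A.dg T v" if "v \<in> T" for v using T(1) that by (simp add: A.core_def)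
    have neT: "T \<noteq> {}" using T(1) by (simp add: A.core_def)
    show c: "cyclic T" if "\<not> {x, y} \<subseteq> T"
    proof -
      have "A.dg T v = dg T v" if "v \<in> T" for v
        using n[of v T] \<open>\<not> {x, y} \<subseteq> T\<close> that by (simp add: A.dg_def dg_def)
      then have "core T" using T2 fT neT by (auto simp: core_def)
      then show ?thesis by (rule cyclic_core)
    qed
    show "cyclic (T \<union> W)"
    proof (cases "{x, y} \<subseteq> T")
      case True
      have TW: "T \<inter> W = {}" using T(2) d by auto
      have "core (T \<union> W)" unfolding core_def
      proof (intro conjI ballI)
        fix v assume "v \<in> T \<union> W"
        then show "2 \<le> dg (T \<union> W) v"
        proof
          assume "v \<in> T"
          then show ?thesis using T2 dg[OF True T(2)] dg_Un[OF fT fin(2) TW, of v] by simp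
        next
          assume "v \<in> W"
          then have "2 \<le> dg (W \<union> {x, y}) v" by (rule two)
          also have "\<dots> \<le> dg (T \<union> W) v" using True fT fin(2) by (intro dg_mono) auto
          finally show ?thesis .
        qed
      qed (use fT fin neT in auto)
      then show ?thesis by (rule cyclic_core)
    next
      case False
      then show ?thesis using c cyclic_mono[of T "T \<union> W"] by auto
    qed
  qed
  assume "A.two_cores S"
  then obtain P Q where PQ: "P \<subseteq> S" "Q \<subseteq> S" "P \<inter> Q = {}" "A.core P" "A.core Q"
    unfolding A.two_cores_def by metis
  show "two_cores (S \<union> W)"
  proof (cases "{x, y} \<subseteq> P")
    case True
    then have "\<not> {x, y} \<subseteq> Q" using PQ(3) by auto
    then have "cyclic Q" using lift PQ(2,5) by metis
    moreover have "cyclic (P \<union> W)" using lift PQ(1,4) by metis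
    moreover have "P \<union> W \<subseteq> S \<union> W" "Q \<subseteq> S \<union> W" "(P \<union> W) \<inter> Q = {}" using PQ(1-3) d by auto
    ultimately show ?thesis using two_coresI by metis
  next
    case False
    then have "cyclic P" using lift PQ(1,4) by metis
    moreover have "cyclic (Q \<union> W)" using lift PQ(2,5) by metis
    moreover have "P \<subseteq> S \<union> W" "Q \<union> W \<subseteq> S \<union> W" "P \<inter> (Q \<union> W) = {}" using PQ(1-3) d by auto
    ultimately show ?thesis using two_coresI by metis
  qed
qed

lemma digon_types:
  assumes fin: "finite V" and uv: "u \<in> V" "v \<in> V" "adj u v"
    and l: "wheel_at u V \<or> wheel_at v V \<or> (\<exists>A. u \<in> A \<and> v \<in> A \<and> k3_at A V)"
  shows "(type2 (plus_edge V u v) \<or> type3 (plus_edge V u v)) \<and> one_double_edge (plus_edge V u v) u v"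
proof -
  have "u \<noteq> v" using uv by auto
  then have m: "multigraph (plus_edge V u v)" using multigraph_plus_edge fin uv by metis
  have "type2 (plus_edge V u v) \<or> type3 (plus_edge V u v)"
    using l wheel_type2[OF _ fin m, of _ "{#{u, v}#}"] k3_type3[OF _ fin m, of _ "{#{u, v}#}"]
    by auto
  moreover have "one_double_edge (plus_edge V u v) u v"
    using uv fin by (auto simp: one_double_edge_def in_edge_set count_mset_set')
  ultimately show ?thesis by simp
qed

end

section \<open>Graphs with large degree sums of nonadjacent vertices\<close>

text \<open>The possible outcomes (a) to (e), named so that the cases of the proof can refer to them.\<close>
definition listed :: "'a multigraph \<Rightarrow> bool" where
  "listed G \<longleftrightarrow>
    (\<exists>A B. complete_graph 5 A \<and> complete_graph 2 B \<and> disjoint_union A B G)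
     \<or> (\<exists>K v l P t. complete_graph 5 K \<and> leaf_added K v l P \<and> t \<le> 1 \<and> subdivided P v l t G)
     \<or> (\<exists>K u v S w l. complete_graph 5 K \<and> subdivided K u v 1 S \<and> w \<in> verts S - verts K \<and>
          leaf_added S w l G)
     \<or> (\<exists>H t. (type1 H \<or> type2 H \<or> type3 H) \<and> simple_graph H \<and>
          (t = 0 \<and> G = H \<or> t \<in> {1, 2} \<and> (\<exists>u v. subdivided H u v t G)) \<and>
          (\<forall>i \<ge> 1. card (verts H) + i = 6 \<longrightarrow> t \<ge> i))
     \<or> (\<exists>H u v t. (type2 H \<or> type3 H) \<and> one_double_edge H u v \<and>
          t \<in> {1, 2} \<and> subdivided H u v t G \<and>
          (card (verts H) = 4 \<longrightarrow> t = 2))"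

lemma listedI_leaf:
  "complete_graph 5 K \<Longrightarrow> leaf_added K v l P \<Longrightarrow> t \<le> 1 \<Longrightarrow> subdivided P v l t G \<Longrightarrow> listed G"
  unfolding listed_def by metis

lemma listedI_simple:
  assumes "type1 H \<or> type2 H \<or> type3 H" "simple_graph H"
    "t = 0 \<and> G = H \<or> t \<in> {1, 2} \<and> subdivided H u v t G" "6 \<le> card (verts H) + t"
  shows "listed G"
proof -
  have "\<forall>i \<ge> 1. card (verts H) + i = 6 \<longrightarrow> t \<ge> i" using assms(4) by auto
  then have "\<exists>H t. (type1 H \<or> type2 H \<or> type3 H) \<and> simple_graph H \<and>
      (t = 0 \<and> G = H \<or> t \<in> {1, 2} \<and> (\<exists>u v. subdivided H u v t G)) \<and>
      (\<forall>i \<ge> 1. card (verts H) + i = 6 \<longrightarrow> t \<ge> i)"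
    using assms(1-3) by (intro exI[of _ H] exI[of _ t]) auto
  then show ?thesis unfolding listed_def by simp
qed

lemma listedI_double:
  assumes "(type2 H \<or> type3 H) \<and> one_double_edge H u v" "subdivided H u v t G" "t \<in> {1, 2}"
    "card (verts H) = 4 \<longrightarrow> t = 2"
  shows "listed G"
  unfolding listed_def using assms by metis

context rel_graph begin

lemma dg_singleton: "dg {a} v = (if adj v a then 1 else 0)"
  by (simp add: dg_insert)

lemma two_nbs:
  assumes "finite S" "dg S v = 2"
  obtains x y where "nb S v = {x, y}" "x \<noteq> y"
  using assms by (auto simp: dg_def card_2_iff)

text \<open>All vertices not adjacent to the leaf \<open>w\<close> have degree at least four. Depending on the degree of
  its neighbour \<open>u\<close>, one deletes \<open>w\<close>, or deletes \<open>w\<close> and \<open>u\<close>, or deletes \<open>w\<close> and suppresses \<open>u\<close>.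
  The graph that remains has degrees at least four, with at most one exception or two adjacent ones, so it
  is \<open>K\<^sub>5\<close>. The four cases lead to (a), to (b) with a subdivided pendant edge, to (c), and to (b) with
  a plain pendant edge.\<close>
lemma listed_degree_1:
  assumes fin: "finite V" and card: "6 \<le> card V" and nt: "\<not> two_cores V"
    and ore: "\<And>x y. x \<in> V \<Longrightarrow> y \<in> V \<Longrightarrow> x \<noteq> y \<Longrightarrow> \<not> adj x y \<Longrightarrow> 5 \<le> dg V x + dg V y"
    and w: "w \<in> V" "nb V w = {u}"
  shows "listed (graph_on V)"
proof -
  define S where "S = V - {w, u}"
  have uw: "u \<in> V" "adj w u" using w(2) by (auto simp: nb_def)
  then have ne: "u \<noteq> w" by auto
  have S: "finite S" "u \<notin> S" "w \<notin> S" "V = insert w (insert u S)" using fin w uw by (auto simp: S_def)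
  have inV: "v \<in> V" "v \<noteq> w" "v \<noteq> u" if "v \<in> S" for v using that by (auto simp: S_def)
  have nw: "\<not> adj v w" "\<not> adj w v" if "v \<in> S" for v
  proof -
    have "v \<notin> nb V w" using inV[OF that] w(2) by simp
    then show "\<not> adj w v" using inV(1)[OF that] by (simp add: nb_def)
    then show "\<not> adj v w" using sym by auto
  qed
  have big: "4 \<le> dg V v" if "v \<in> S" for v
  proof -
    have "dg V w = 1" using w(2) by (simp add: dg_def)
    then show ?thesis using ore[OF w(1) inV(1)[OF that]] inV[OF that] nw[OF that] by auto
  qed
  have dgu: "dg (insert u S) v = dg V v" if "v \<in> S" for v
    using S nw[OF that] ne by (simp add: dg_insert)
  have dgV: "dg V v = dg S v + (if adj u v then 1 else 0)" if "v \<in> S" for v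
    using dgu[OF that, symmetric] S(1,2) adj_commute[of u v] by (simp add: dg_insert)
  have neS: "S \<noteq> {}"
  proof
    assume "S = {}"
    then have "card V \<le> 2" using S(4) by (simp add: card_insert_if)
    then show False using card by simp
  qed
  have SV: "S \<subseteq> V" "insert u S \<subseteq> V" using S(4) by auto
  have ntS: "\<not> two_cores S" "\<not> two_cores (insert u S)" using nt two_cores_mono SV by metis+
  have nbw: "nb (insert u S) w = {u}" using w(2) SV nw uw by (auto simp: nb_def)
  have GV: "mset_set (edge_set V) = add_mset {w, u} (mset_set (edge_set (insert u S)))"
    using edge_set_insert[of w "insert u S"] S ne nbw by simp
  consider "dg S u = 0" | "dg S u = 1" | "dg S u = 2" | "3 \<le> dg S u" by linarith
  then show ?thesis
  proof cases
    case 1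
    then have nbu: "nb S u = {}" using S(1) by (simp add: dg_def)
    then have "dg S v = dg V v" if "v \<in> S" for v using dgV[OF that] that by (auto simp: nb_def)
    then have d4: "4 \<le> dg S v" if "v \<in> S" for v using big[OF that] that by simp
    have "k5 S"
    proof (rule k5_of_degree_4[OF S(1) neS _ _ _ ntS(1), of u u])
      show "3 \<le> dg S v" if "v \<in> S" for v using d4[OF that] by simp
    qed (use d4 in auto)
    then have "complete_graph 5 (graph_on S)" by (rule complete_graph_on)
    moreover have "complete_graph 2 \<lparr>verts = {w, u}, edges = {#{w, u}#}\<rparr>"
    proof -
      have c: "card {w, u} = 2" using ne by simp
      have "{e. e \<subseteq> {w, u} \<and> card e = 2} = {{w, u}}"
      proof (intro equalityI subsetI)
        fix e assume "e \<in> {e. e \<subseteq> {w, u} \<and> card e = 2}"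
        then have "e \<subseteq> {w, u}" "card e = card {w, u}" using c by simp_all
        then have "e = {w, u}" by (rule card_subset_eq[rotated]) simp
        then show "e \<in> {{w, u}}" by simp
      next
        fix e assume "e \<in> {{w, u}}"
        then show "e \<in> {e. e \<subseteq> {w, u} \<and> card e = 2}" using c by simp
      qed
      then show ?thesis using ne by (simp add: complete_graph_def)
    qed
    moreover have "disjoint_union (graph_on S) \<lparr>verts = {w, u}, edges = {#{w, u}#}\<rparr> (graph_on V)"
      using S GV edge_set_insert[OF S(2,1)] nbu by (simp add: disjoint_union_def graph_on_def)
    ultimately show ?thesis unfolding listed_def by metis
  next
    case 2
    then obtain x where nbu: "nb S u = {x}" by (auto simp: dg_def card_1_singleton_iff)
    have x: "x \<in> S" "adj u x" using nbu by (auto simp: nb_def)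
    have d: "4 \<le> dg S v" if "v \<in> S" "v \<noteq> x" for v
    proof -
      have "v \<notin> nb S u" using nbu that(2) by simp
      then show ?thesis using dgV[OF that(1)] big[OF that(1)] that(1) by (auto simp: nb_def)
    qed
    have "k5 S"
    proof (rule k5_of_degree_4[OF S(1) neS _ _ _ ntS(1), of x x])
      show "3 \<le> dg S v" if "v \<in> S" for v using dgV[OF that] big[OF that] by (auto split: if_splits)
    qed (use d in auto)
    then have K: "complete_graph 5 (graph_on S)" by (rule complete_graph_on)
    define P where "P = \<lparr>verts = insert w S, edges = add_mset {x, w} (mset_set (edge_set S))\<rparr>"
    have "leaf_added (graph_on S) x w P" using S(3) x by (simp add: leaf_added_def P_def)
    moreover have "subdivided P x w 1 (graph_on V)" unfolding subdivided_def
    proof (intro conjI exI[of _ "[u]"])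
      have "insert w (insert u S) = insert u (insert w S)" by auto
      then show "graph_on V = \<lparr>verts = verts P \<union> set [u],
          edges = edges P - {#{x, w}#} + path_edges (x # [u] @ [w])\<rparr>"
        using S(4) GV edge_set_insert[OF S(2,1)] nbu by (simp add: P_def graph_on_def insert_commute)
    qed (use S ne in \<open>auto simp: P_def\<close>)
    ultimately show ?thesis using K listedI_leaf[of _ x w P 1] by simp
  next
    case 3
    then obtain x y where nbu: "nb S u = {x, y}" "x \<noteq> y" using two_nbs[OF S(1)] by metis
    have xy: "x \<in> S" "y \<in> S" "adj u x" "adj u y" using nbu by (auto simp: nb_def)
    have nu: "\<not> adj v u" if "v \<in> S - {x, y}" for v
    proof -
      have "v \<notin> nb S u" using nbu(1) that by simp
      then show ?thesis using that sym by (auto simp: nb_def)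
    qed
    show ?thesis
    proof (cases "adj x y")
      case False
      interpret A: rel_graph "added x y" using nbu(2) by (rule rel_graph_added)
      have sup: "S \<inter> {u} = {}" "\<And>v. v \<in> S - {x, y} \<Longrightarrow> dg {u} v = 0" "dg {u} x = 1" "dg {u} y = 1"
        "\<And>v. v \<in> {u} \<Longrightarrow> 2 \<le> dg ({u} \<union> {x, y}) v"
        using S(2) nu xy sym nbu(2) by (auto simp: dg_singleton intro: dg_ge2I[of _ x y])
      note sup = suppress[OF S(1) _ sup(1) xy(1,2) nbu(2) False sup(2-5), simplified]
      have d4: "4 \<le> A.dg S v" if "v \<in> S" for v
        using sup(1)[OF that] dgu[OF that] big[OF that] by simp
      have "A.k5 S"
      proof (rule A.k5_of_degree_4[OF S(1) neS, of x x])
        show "3 \<le> A.dg S v" if "v \<in> S" for v using d4[OF that] by simp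
      qed (use d4 sup(2) ntS(2) in auto)
      then have "complete_graph 5 (plus_edge S x y)"
        using A.complete_graph_on graph_on_added[OF xy(1,2) nbu(2) False S(1)] by metis
      moreover have "subdivided (plus_edge S x y) x y 1 (graph_on (insert u S))"
        by (rule subdivided_once[OF S(2,1) nbu])
      moreover have "leaf_added (graph_on (insert u S)) u w (graph_on V)"
        using leaf_added_graph_on[of w "insert u S" u] S ne nbw by simp
      moreover have "u \<in> verts (graph_on (insert u S)) - verts (plus_edge S x y)" using S(2) by simp
      ultimately show ?thesis unfolding listed_def by metis
    next
      case True
      have d4: "4 \<le> dg S v" if "v \<in> S - {x, y}" for v
        using dgV[of v] big[of v] nu[OF that] that adj_commute[of u v] by simp
      have "k5 S"
      proof (rule k5_of_degree_4[OF S(1) neS _ d4 _ ntS(1)])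
        show "3 \<le> dg S v" if "v \<in> S" for v using dgV[OF that] big[OF that] by (auto split: if_splits)
      qed (use True in auto)
      then have k: "card S = 5" "\<And>a b. a \<in> S \<Longrightarrow> b \<in> S \<Longrightarrow> a \<noteq> b \<Longrightarrow> adj a b" by (auto simp: k5_def)
      then have "card (S - {x, y}) = 3" using xy(1,2) nbu(2) by (simp add: card_Diff_subset)
      then obtain p q r where pqr: "S - {x, y} = {p, q, r}" "p \<noteq> q" "q \<noteq> r" "p \<noteq> r"
        by (auto simp: card_3_iff)
      have inS: "p \<in> S" "q \<in> S" "r \<in> S" using pqr(1) by auto
      \<comment> \<open>If the neighbours \<open>x\<close>, \<open>y\<close> of \<open>u\<close> are adjacent, the \<open>K\<^sub>5\<close> splits into the edge \<open>xy\<close>, completed by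
        \<open>u\<close> to a triangle, and another triangle.\<close>
      have "core {p, q, r}" using k(2) inS pqr(2-4) by (intro core_triangle) auto
      moreover have "core {u, x, y}" using xy(3,4) True sym by (intro core_triangle) auto
      moreover have "{p, q, r} \<subseteq> V" "{u, x, y} \<subseteq> V" using inS xy S(4) by auto
      moreover have "u \<notin> {p, q, r}" using inS S(2) by auto
      then have "{p, q, r} \<inter> {u, x, y} = {}" using pqr(1) by auto
      ultimately have "two_cores V" using two_coresI cyclic_core by metis
      then show ?thesis using nt by simp
    qed
  next
    case 4
    have du: "dg (insert u S) u = dg S u" using S by (simp add: dg_insert)
    have "k5 (insert u S)"
    proof (rule k5_of_degree_4[OF _ _ _ _ _ ntS(2), of u u])
      show "3 \<le> dg (insert u S) v" if "v \<in> insert u S" for v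
        using that 4 du dgu big by (cases "v = u") fastforce+
      show "4 \<le> dg (insert u S) v" if "v \<in> insert u S - {u, u}" for v
        using that dgu big by auto
    qed (use S in auto)
    then have "complete_graph 5 (graph_on (insert u S))" by (rule complete_graph_on)
    moreover have "leaf_added (graph_on (insert u S)) u w (graph_on V)"
      using leaf_added_graph_on[of w "insert u S" u] S ne nbw by simp
    moreover have "subdivided (graph_on V) u w 0 (graph_on V)"
      using uw w fin sym by (intro subdivided_0) (simp add: in_edge_set)
    ultimately show ?thesis using listedI_leaf[of _ u w _ 0] by simp
  qed
qed

text \<open>Suppressing \<open>w\<close> gives a graph with at least five vertices, so the side
  conditions on the size of \<open>H\<close> hold with a single subdivision.\<close>
lemma listed_one_degree_2:
  assumes fin: "finite V" and card: "6 \<le> card V" and nt: "\<not> two_cores V"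
    and w: "w \<in> V" "nb V w = {x, y}" "x \<noteq> y"
    and deg: "\<And>v. v \<in> V - {w} \<Longrightarrow> 3 \<le> dg V v"
  shows "listed (graph_on V)"
proof -
  define S where "S = V - {w}"
  have "x \<in> nb V w" "y \<in> nb V w" using w(2) by auto
  then have aw: "x \<in> V" "y \<in> V" "adj w x" "adj w y" by (auto simp: nb_def)
  then have xy: "x \<in> S" "y \<in> S" "adj w x" "adj w y" by (auto simp: S_def)
  have S: "finite S" "w \<notin> S" "V = insert w S" using fin w(1) by (auto simp: S_def)
  have nbw: "nb S w = {x, y}" using w(2) xy S(3) by (auto simp: nb_def)
  have cS: "5 \<le> card S" using card S by simp
  have nw: "\<not> adj v w" if "v \<in> S - {x, y}" for v
  proof -
    have "v \<notin> nb S w" using nbw that by simp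
    then show ?thesis using that sym by (auto simp: nb_def)
  qed
  have ntS: "\<not> two_cores S" using nt two_cores_mono[of S V] S(3) by auto
  have neS: "S \<noteq> {}" using xy by auto
  have sub: "subdivided (plus_edge S x y) x y 1 (graph_on V)"
    using subdivided_once[OF S(2,1) nbw w(3)] S(3) by simp
  show ?thesis
  proof (cases "adj x y")
    case True
    have "core {w, x, y}" using xy True sym by (intro core_triangle) auto
    moreover have "{w, x, y} \<subseteq> V" "S - {x, y} \<subseteq> V" "{w, x, y} \<inter> (S - {x, y}) = {}"
      using xy S by auto
    ultimately have ac: "\<not> cyclic (S - {x, y})" using nt two_coresI cyclic_core by metis
    have "\<not> S \<subseteq> {x, y}"
    proof
      assume "S \<subseteq> {x, y}"
      then have "card S \<le> card {x, y}" by (intro card_mono) auto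
      then show False using cS w(3) by simp
    qed
    then have "S - {x, y} \<noteq> {}" by auto
    moreover have "3 \<le> dg S v" if "v \<in> S - {x, y}" for v
      using deg[of v] nw[OF that] that S by (simp add: dg_insert)
    ultimately have "wheel_at x S \<or> wheel_at y S \<or> (\<exists>A. x \<in> A \<and> y \<in> A \<and> k3_at A S)"
      using digon_structure[OF S(1) xy(1,2) True _ ac _ ntS] by metis
    then show ?thesis
      using listedI_double[OF digon_types[OF S(1) xy(1,2) True] sub] cS by simp
  next
    case False
    interpret A: rel_graph "added x y" using w(3) by (rule rel_graph_added)
    have sup: "S \<inter> {w} = {}" "\<And>v. v \<in> S - {x, y} \<Longrightarrow> dg {w} v = 0" "dg {w} x = 1" "dg {w} y = 1"
      "\<And>v. v \<in> {w} \<Longrightarrow> 2 \<le> dg ({w} \<union> {x, y}) v"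
      using S(2) nw xy sym w(3) by (auto simp: dg_singleton intro: dg_ge2I[of _ x y])
    note sup = suppress[OF S(1) _ sup(1) xy(1,2) w(3) False sup(2-5), simplified]
    have "A.lovasz_type S"
    proof (rule A.lovasz_min_degree_3[OF S(1) neS])
      show "3 \<le> A.dg S v" if "v \<in> S" for v using sup(1)[OF that] deg[of v] that S by simp
    qed (use sup(2) nt S(3) in auto)
    then have "type1 (A.graph_on S) \<or> type2 (A.graph_on S) \<or> type3 (A.graph_on S)"
      using A.lovasz_type_graph_on S(1) by simp
    moreover have "simple_graph (A.graph_on S)" using A.simple_graph_on S(1) by simp
    moreover have "subdivided (A.graph_on S) x y 1 (graph_on V)"
      using sub graph_on_added[OF xy(1,2) w(3) False S(1)] by simp
    ultimately show ?thesis using cS by (intro listedI_simple[of _ 1]) auto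
  qed
qed

text \<open>The adjacent vertices \<open>w\<close> and \<open>w'\<close> have degree two. If their further neighbours coincide, then \<open>w\<close> and \<open>w'\<close>
  form a triangle with \<open>x\<close>, and the remaining vertices lose at most the neighbour \<open>x\<close>, so they contain another
  cycle. Otherwise suppressing both vertices leaves at least four vertices.\<close>
lemma listed_two_degree_2:
  assumes fin: "finite V" and card: "6 \<le> card V" and nt: "\<not> two_cores V"
    and w: "w \<in> V" "w' \<in> V" "nb V w = {w', x}" "nb V w' = {w, y}" "x \<noteq> w'" "y \<noteq> w"
    and deg: "\<And>v. v \<in> V - {w, w', x, y} \<Longrightarrow> 3 \<le> dg V v"
    and deg': "x \<noteq> y \<Longrightarrow> 3 \<le> dg V x \<and> 3 \<le> dg V y"
  shows "listed (graph_on V)"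
proof -
  define S where "S = V - {w, w'}"
  have a: "adj w w'" "adj w x" "adj w' y" "x \<in> V" "y \<in> V" using w(3,4) by (auto simp: nb_def)
  then have ne: "w \<noteq> w'" "x \<noteq> w" "y \<noteq> w'" by auto
  have S: "finite S" "w \<notin> S" "w' \<notin> S" "V = insert w' (insert w S)" "x \<in> S" "y \<in> S"
    using fin w a ne by (auto simp: S_def)
  have "nb S v = nb V v - {w, w'}" for v by (auto simp: nb_def S_def)
  then have nbw: "nb S w = {x}" "nb S w' = {y}" using w(3-6) ne by auto
  have nw: "\<not> adj v w" if "v \<in> S" "v \<noteq> x" for v
  proof -
    have "v \<notin> nb S w" using nbw that by simp
    then show ?thesis using that sym by (auto simp: nb_def)
  qed
  have nw': "\<not> adj v w'" if "v \<in> S" "v \<noteq> y" for v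
  proof -
    have "v \<notin> nb S w'" using nbw that by simp
    then show ?thesis using that sym by (auto simp: nb_def)
  qed
  have cS: "4 \<le> card S" using card S(1-4) ne(1) by simp
  have ntS: "\<not> two_cores S" using nt two_cores_mono[of S V] S(4) by auto
  show ?thesis
  proof (cases "x = y")
    case True
    have "2 \<le> dg (S - {x}) v" if v: "v \<in> S - {x}" for v
    proof -
      have "3 \<le> dg V v" using deg[of v] v True by (auto simp: S_def)
      moreover have "dg V v = dg S v" using S nw[of v] nw'[of v] v True ne(1) by (simp add: dg_insert)
      moreover have "dg S v \<le> Suc (dg (S - {x}) v)"
        using dg_insert[of "S - {x}" x v] S(1,5) by (simp add: insert_absorb)
      ultimately show ?thesis by simp
    qed
    moreover have "S - {x} \<noteq> {}"
    proof
      assume "S - {x} = {}"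
      then have "card S \<le> card {x}" by (intro card_mono) auto
      then show False using cS by simp
    qed
    ultimately have "core (S - {x})" using S(1) by (simp add: core_def)
    moreover have "core {w, w', x}" using a True sym by (intro core_triangle) auto
    moreover have "S - {x} \<subseteq> V" "{w, w', x} \<subseteq> V" "(S - {x}) \<inter> {w, w', x} = {}"
      using w a by (auto simp: S_def)
    ultimately have "two_cores V" using two_coresI cyclic_core by metis
    then show ?thesis using nt by simp
  next
    case False
    have degS: "3 \<le> dg V v" if "v \<in> S" for v
      using deg[of v] deg'[OF False] that by (auto simp: S_def)
    have sub: "subdivided (plus_edge S x y) x y 2 (graph_on V)"
      using subdivided_twice[OF S(2,3,1) nbw a(1)] S(4) by simp
    show ?thesis
    proof (cases "adj x y")
      case True
      have "core {w, w', y, x}" using a True sym w(5,6) by (intro core_square) auto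
      moreover have "{w, w', y, x} \<subseteq> V" "S - {x, y} \<subseteq> V" "{w, w', y, x} \<inter> (S - {x, y}) = {}"
        using a w by (auto simp: S_def)
      ultimately have ac: "\<not> cyclic (S - {x, y})" using nt two_coresI cyclic_core by metis
      have "\<not> S \<subseteq> {x, y}"
      proof
        assume "S \<subseteq> {x, y}"
        then have "card S \<le> card {x, y}" by (intro card_mono) auto
        then show False using cS False by simp
      qed
      then have "S - {x, y} \<noteq> {}" by auto
      moreover have "3 \<le> dg S v" if "v \<in> S - {x, y}" for v
        using degS[of v] nw[of v] nw'[of v] that S ne(1) by (simp add: dg_insert)
      ultimately have "wheel_at x S \<or> wheel_at y S \<or> (\<exists>A. x \<in> A \<and> y \<in> A \<and> k3_at A S)"
        using digon_structure[OF S(1,5,6) True _ ac _ ntS] by metis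
      then show ?thesis
        using listedI_double[OF digon_types[OF S(1,5,6) True] sub] by simp
    next
      case nadj: False
      interpret A: rel_graph "added x y" using False by (rule rel_graph_added)
      have VS: "S \<union> {w, w'} = V" using S(4) by auto
      have d: "S \<inter> {w, w'} = {}" using S(2,3) by auto
      have dgW: "dg {w, w'} v = (if adj v w then 1 else 0) + (if adj v w' then 1 else 0)" for v
        using ne(1) by (simp add: dg_insert)
      have zero: "dg {w, w'} v = 0" if "v \<in> S - {x, y}" for v
        using that nw nw' by (simp add: dgW)
      have one: "dg {w, w'} x = 1" "dg {w, w'} y = 1"
        using nw'[of x] nw[of y] S(5,6) a False sym by (auto simp: dgW)
      have two: "2 \<le> dg ({w, w'} \<union> {x, y}) v" if "v \<in> {w, w'}" for v
      proof (cases "v = w")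
        case True
        then show ?thesis using a w(5) by (intro dg_ge2I[of _ w' x]) auto
      next
        case False
        then show ?thesis using that a w(6) sym by (intro dg_ge2I[of _ w y]) auto
      qed
      note sup = suppress[OF S(1) _ d S(5,6) False nadj zero one two]
      have "A.lovasz_type S"
      proof (rule A.lovasz_min_degree_3[OF S(1)])
        show "3 \<le> A.dg S v" if "v \<in> S" for v using sup(1)[OF _ _ _ that] degS[OF that] VS by simp
        show "\<not> A.two_cores S" using sup(2) nt VS by auto
      qed (use S(5) in auto)
      then have "type1 (A.graph_on S) \<or> type2 (A.graph_on S) \<or> type3 (A.graph_on S)"
        using A.lovasz_type_graph_on S(1) by simp
      moreover have "simple_graph (A.graph_on S)" using A.simple_graph_on S(1) by simp
      moreover have "subdivided (A.graph_on S) x y 2 (graph_on V)"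
        using sub graph_on_added[OF S(5,6) False nadj S(1)] by simp
      ultimately show ?thesis using cS by (intro listedI_simple[of _ 2]) auto
    qed
  qed
qed

text \<open>The cases are distinguished by the minimum degree, attained at \<open>w\<close>. Degree zero would make all other
  degrees at least five, too large for the \<open>K\<^sub>5\<close> that they force. If \<open>w\<close> has degree two, every other vertex of
  degree two is adjacent to \<open>w\<close>.\<close>
lemma listed_of_ore:
  assumes fin: "finite V" and card: "6 \<le> card V" and nt: "\<not> two_cores V"
    and ore: "\<And>x y. x \<in> V \<Longrightarrow> y \<in> V \<Longrightarrow> x \<noteq> y \<Longrightarrow> \<not> adj x y \<Longrightarrow> 5 \<le> dg V x + dg V y"
  shows "listed (graph_on V)"
proof -
  have neV: "V \<noteq> {}" using card by auto
  have "\<exists>w. w \<in> V \<and> (\<forall>v. v \<in> V \<longrightarrow> dg V w \<le> dg V v)"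
    using neV ex_has_least_nat[of "\<lambda>v. v \<in> V" _ "dg V"] by (metis ex_in_conv)
  then obtain w where w: "w \<in> V" "\<And>v. v \<in> V \<Longrightarrow> dg V w \<le> dg V v" by metis
  have other: "5 \<le> dg V w + dg V v" if "v \<in> V" "v \<notin> insert w (nb V w)" for v
    using ore[of w v] w(1) that by (auto simp: nb_def)
  consider "dg V w = 0" | "dg V w = 1" | "dg V w = 2" | "3 \<le> dg V w" by linarith
  then show ?thesis
  proof cases
    case 1
    define S where "S = V - {w}"
    have S: "finite S" "w \<notin> S" "V = insert w S" using fin w(1) by (auto simp: S_def)
    have nb: "nb V w = {}" using 1 fin by (simp add: dg_def)
    have d5: "5 \<le> dg S v" if v: "v \<in> S" for v
    proof -
      have "\<not> adj v w" using nb v sym[of v w] S(3) by (auto simp: nb_def)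
      then have "dg V v = dg S v" using S by (simp add: dg_insert)
      then show ?thesis using other[of v] nb v 1 S by auto
    qed
    have neS: "S \<noteq> {}" using card S by auto
    have "\<not> two_cores S" using nt two_cores_mono[of S V] S(3) by auto
    moreover have "3 \<le> dg S v" "4 \<le> dg S v" if "v \<in> S" for v using d5[OF that] by auto
    ultimately have "k5 S" using k5_of_degree_4[OF S(1) neS, of w w] by auto
    then have c: "card S = 5" by (simp add: k5_def)
    obtain v where v: "v \<in> S" using neS by auto
    show ?thesis using d5[OF v] dg_less_card[OF S(1) v] c by simp
  next
    case 2
    then obtain u where "nb V w = {u}" by (auto simp: dg_def card_1_singleton_iff)
    then show ?thesis using listed_degree_1[OF fin card nt ore w(1)] by simp
  next
    case 3
    have min2: "2 \<le> dg V v" if "v \<in> V" for v using w(2)[OF that] 3 by simp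
    obtain x y where xy: "nb V w = {x, y}" "x \<noteq> y" using two_nbs[OF fin 3] by metis
    have inV: "x \<in> V" "y \<in> V" "adj w x" "adj w y" using xy by (auto simp: nb_def)
    have xyw: "x \<noteq> w" "y \<noteq> w" using inV(3,4) by auto
    have far: "3 \<le> dg V v" if "v \<in> V - {w, x, y}" for v
      using other[of v] that xy(1) 3 by auto
    show ?thesis
    proof (cases "3 \<le> dg V x \<and> 3 \<le> dg V y")
      case True
      have "3 \<le> dg V v" if "v \<in> V - {w}" for v
        using far[of v] True that by (cases "v = x \<or> v = y") auto
      then show ?thesis using listed_one_degree_2[OF fin card nt w(1) xy] by simp
    next
      case False
      then obtain p q where pq: "{x, y} = {p, q}" "\<not> 3 \<le> dg V p" by auto
      have p: "p \<in> V" "adj w p" "q \<in> V" "adj w q" "p \<noteq> q" "nb V w = {p, q}"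
        using inV xy pq(1) by (auto simp: doubleton_eq_iff)
      have p2: "dg V p = 2" using min2[OF p(1)] pq(2) by simp
      have "w \<in> nb V p" using w(1) sym[OF p(2)] by (simp add: nb_def)
      moreover obtain a b where ab: "nb V p = {a, b}" "a \<noteq> b" using two_nbs[OF fin p2] .
      ultimately have "w = a \<or> w = b" by simp
      then obtain z where z: "nb V p = {w, z}" "z \<noteq> w"
      proof
        assume "w = a"
        then show ?thesis using ab that[of b] by simp
      next
        assume "w = b"
        then show ?thesis using ab that[of a] by (simp add: insert_commute)
      qed
      have zV: "z \<in> V" "adj p z" using z by (auto simp: nb_def)
      show ?thesis
      proof (rule listed_two_degree_2[OF fin card nt w(1) p(1,6) z(1) _ z(2)])
        show "q \<noteq> p" using p(5) by simp
        show "3 \<le> dg V v" if "v \<in> V - {w, p, q, z}" for v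
          using far[of v] that pq(1) by auto
        assume "q \<noteq> z"
        have "q \<notin> nb V p" "z \<notin> nb V w" using z p(4-6) zV \<open>q \<noteq> z\<close> by auto
        then have "\<not> adj p q" "\<not> adj w z" using p(3) zV(1) by (auto simp: nb_def)
        then show "3 \<le> dg V q \<and> 3 \<le> dg V z"
          using ore[OF p(1,3,5)] ore[OF w(1) zV(1)] z(2) p2 3 by auto
      qed
    qed
  next
    case 4
    then have "3 \<le> dg V v" if "v \<in> V" for v using w(2)[OF that] by simp
    then have "lovasz_type V" using lovasz_min_degree_3[OF fin neV _ nt] by simp
    then have "type1 (graph_on V) \<or> type2 (graph_on V) \<or> type3 (graph_on V)"
      using lovasz_type_graph_on fin by simp
    then show ?thesis using card simple_graph_on[OF fin] by (intro listedI_simple[of _ 0]) auto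
  qed
qed

end

lemma rel_graph_adjacent:
  assumes "multigraph G"
  shows "rel_graph (adjacent G)"
proof
  show "adjacent G x y \<Longrightarrow> adjacent G y x" for x y by (simp add: adjacent_def insert_commute)
  show "\<not> adjacent G x x" for x using assms by (auto simp: adjacent_def multigraph_def)
qed

lemma simple_graph_edges:
  assumes "simple_graph G"
  shows "edges G = mset_set (rel_graph.edge_set (adjacent G) (verts G))"
proof -
  interpret rel_graph "adjacent G"
    using assms by (intro rel_graph_adjacent) (simp add: simple_graph_def)
  have fin: "finite (verts G)" and e: "\<And>e. e \<in># edges G \<Longrightarrow> e \<subseteq> verts G \<and> card e = 2"
    and c: "\<And>e. count (edges G) e \<le> 1"
    using assms by (auto simp: simple_graph_def multigraph_def)
  have "e \<in># edges G \<longleftrightarrow> e \<in> edge_set (verts G)" for e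
    using e[of e] by (auto simp: edge_set_def adjacent_def card_2_iff)
  then have "count (edges G) e = count (mset_set (edge_set (verts G))) e" for e
    using c[of e] fin by (auto simp: count_mset_set' not_in_iff[symmetric] Suc_le_eq le_less)
  then show ?thesis by (rule multiset_eqI)
qed

lemma degree_eq_dg:
  assumes "simple_graph G"
  shows "degree G x = rel_graph.dg (adjacent G) (verts G) x"
proof -
  interpret rel_graph "adjacent G"
    using assms by (intro rel_graph_adjacent) (simp add: simple_graph_def)
  have fin: "finite (verts G)" using assms by (simp add: simple_graph_def multigraph_def)
  have ends: "\<And>y z. adjacent G y z \<Longrightarrow> y \<in> verts G \<and> z \<in> verts G"
    using assms by (auto simp: simple_graph_def multigraph_def adjacent_def)
  have "{e \<in> edge_set (verts G). x \<in> e} = (\<lambda>y. {x, y}) ` nb (verts G) x"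
  proof (intro set_eqI iffI)
    fix e assume "e \<in> {e \<in> edge_set (verts G). x \<in> e}"
    then obtain a b where ab: "e = {a, b}" "a \<in> verts G" "b \<in> verts G" "adjacent G a b" "x = a \<or> x = b"
      by (auto simp: edge_set_def)
    then consider "e = {x, b}" "b \<in> nb (verts G) x" | "e = {x, a}" "a \<in> nb (verts G) x"
      using sym[of a b] by (auto simp: nb_def)
    then show "e \<in> (\<lambda>y. {x, y}) ` nb (verts G) x" by cases auto
  next
    fix e assume "e \<in> (\<lambda>y. {x, y}) ` nb (verts G) x"
    then obtain y where "e = {x, y}" "y \<in> verts G" "adjacent G x y" by (auto simp: nb_def)
    then show "e \<in> {e \<in> edge_set (verts G). x \<in> e}" using ends[of x y] by (simp add: in_edge_set)
  qed
  moreover have "inj_on (\<lambda>y. {x, y}) (nb (verts G) x)" by (auto simp: inj_on_def doubleton_eq_iff)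
  moreover have "degree G x = card {e \<in> edge_set (verts G). x \<in> e}"
    using fin by (simp add: degree_def simple_graph_edges[OF assms])
  ultimately show ?thesis by (simp add: card_image dg_def)
qed

lemma two_disjoint_cycles_of_two_cores:
  assumes G: "simple_graph G" and tc: "rel_graph.two_cores (adjacent G) (verts G)"
  shows "has_two_disjoint_cycles G"
proof -
  interpret rel_graph "adjacent G"
    using G by (intro rel_graph_adjacent) (simp add: simple_graph_def)
  obtain S T where ST: "S \<subseteq> verts G" "T \<subseteq> verts G" "S \<inter> T = {}" "core S" "core T"
    using tc unfolding two_cores_def by metis
  have cyc: "is_cycle G xs" if xs: "cycle_list xs" "set xs \<subseteq> verts G" for xs
  proof -
    have p: "e \<in># path_edges ys \<Longrightarrow> e \<in># edges G" if "successively (adjacent G) ys" for ys e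
      using that by (induction ys rule: induct_list012) (auto simp: adjacent_def)
    have len: "3 \<le> length xs" "distinct xs" "xs \<noteq> []" using xs(1) by (auto simp: cycle_list_def)
    have "e \<in># edges G" if "e \<in># cycle_edges xs" for e
      using that p[of xs e] xs(1) len(3) by (auto simp: cycle_edges_snoc cycle_list_def adjacent_def)
    moreover have "count (cycle_edges xs) e \<le> 1" for e using cycle_edges_count len by metis
    ultimately have "count (cycle_edges xs) e \<le> count (edges G) e" for e
      by (metis count_eq_zero_iff count_greater_eq_one_iff le_trans zero_le)
    then have "cycle_edges xs \<subseteq># edges G" by (rule mset_subset_eqI)
    then show ?thesis using len xs(2) by (simp add: is_cycle_def)
  qed
  obtain xs where xs: "cycle_list xs" "set xs \<subseteq> S" using ST(4) by (rule core_cycle_list)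
  obtain ys where ys: "cycle_list ys" "set ys \<subseteq> T" using ST(5) by (rule core_cycle_list)
  have "set xs \<inter> set ys = {}" "set xs \<subseteq> verts G" "set ys \<subseteq> verts G" using ST xs ys by auto
  then show ?thesis using cyc xs(1) ys(1) unfolding has_two_disjoint_cycles_def by metis
qed

lemma sigma2_le:
  assumes "finite (verts G)" "x \<in> verts G" "y \<in> verts G" "x \<noteq> y" "\<not> adjacent G x y"
  shows "sigma2 G \<le> enat (degree G x + degree G y)"
proof -
  let ?D = "{degree G x + degree G y |x y. x \<in> verts G \<and> y \<in> verts G \<and> x \<noteq> y \<and> \<not> adjacent G x y}"
  have "?D \<subseteq> (\<lambda>(x, y). degree G x + degree G y) ` (verts G \<times> verts G)" by auto
  then have "finite ?D" using assms(1) by (meson finite_SigmaI finite_imageI finite_subset)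
  moreover have "degree G x + degree G y \<in> ?D" using assms(2-5) by auto
  ultimately have "Min ?D \<le> degree G x + degree G y" by (rule Min_le)
  moreover have "\<not> is_complete G" using assms(2-5) by (auto simp: is_complete_def)
  ultimately show ?thesis by (simp add: sigma2_def)
qed

theorem lemma3p2:
  fixes G :: "'a multigraph"
  assumes "simple_graph G"
    and "card (verts G) \<ge> 6"
    and "sigma2 G \<ge> 5"
    and "\<not> has_two_disjoint_cycles G"
  shows
    "(\<exists>A B. complete_graph 5 A \<and> complete_graph 2 B \<and> disjoint_union A B G)
     \<or> (\<exists>K v l P t. complete_graph 5 K \<and> leaf_added K v l P \<and> t \<le> 1 \<and> subdivided P v l t G)
     \<or> (\<exists>K u v S w l. complete_graph 5 K \<and> subdivided K u v 1 S \<and> w \<in> verts S - verts K \<and>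
          leaf_added S w l G)
     \<or> (\<exists>H t. (type1 H \<or> type2 H \<or> type3 H) \<and> simple_graph H \<and>
          (t = 0 \<and> G = H \<or> t \<in> {1, 2} \<and> (\<exists>u v. subdivided H u v t G)) \<and>
          (\<forall>i \<ge> 1. card (verts H) + i = 6 \<longrightarrow> t \<ge> i))
     \<or> (\<exists>H u v t. (type2 H \<or> type3 H) \<and> one_double_edge H u v \<and>
          t \<in> {1, 2} \<and> subdivided H u v t G \<and>
          (card (verts H) = 4 \<longrightarrow> t = 2))"
proof -
  interpret rel_graph "adjacent G"
    using assms(1) by (intro rel_graph_adjacent) (simp add: simple_graph_def)
  have fin: "finite (verts G)" using assms(1) by (simp add: simple_graph_def multigraph_def)
  have nt: "\<not> two_cores (verts G)" using two_disjoint_cycles_of_two_cores assms(1,4) by metis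
  have "5 \<le> dg (verts G) x + dg (verts G) y"
    if "x \<in> verts G" "y \<in> verts G" "x \<noteq> y" "\<not> adjacent G x y" for x y
  proof -
    have "5 \<le> enat (degree G x + degree G y)"
      using assms(3) sigma2_le[OF fin that] by (rule order.trans)
    then show ?thesis by (simp add: degree_eq_dg[OF assms(1)] numeral_eq_enat)
  qed
  then have "listed (graph_on (verts G))" by (rule listed_of_ore[OF fin assms(2) nt])
  moreover have "graph_on (verts G) = G"
    by (simp add: graph_on_def simple_graph_edges[OF assms(1), symmetric])
  ultimately have "listed G" by simp
  then show ?thesis unfolding listed_def .
qed

end
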